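(* Let $n\ge1$ and $\mu\in\mathbb{Z}^n$. The nonsymmetric (electronic) Macdonald polynomial $E_\mu=E_\mu(q,t)$ is the unique element of $K[X]$ such that (a) $E_\mu(q,t)=x^\mu+(\text{a linear combination of } x^\nu \text{ with } \nu<\mu \text{ in DBlex order})$; (b) if $\nu\in\mathbb{Z}^n$ and $\nu<\mu$ (in DBlex order) then $(E_\mu(q,t),x^\nu)_{q,t}=0$.
   Context: Let $q,t^{1/2}$ be independent indeterminates over $\mathbb{C}$, $t=(t^{1/2})^2$, $K=\mathbb{C}(q,t^{1/2})$, $K[X]=K[x_1^{\pm1},\ldots,x_n^{\pm1}]$, $x^\mu=x_1^{\mu_1}\cdots x_n^{\mu_n}$. $S_n$ acts on $K[X]$ by permuting variables and on $\mathbb{Z}^n$ by $(w\mu)_{w(i)}=\mu_i$; $s_i=(i,i+1)$; $\partial_if=\frac{f-s_if}{x_i-x_{i+1}}$. For $\mu\in\mathbb{Z}^n$, $v_\mu\in S_n$ is the minimal length permutation such that $v_\mu\mu$ is weakly increasing; explicitly $v_\mu(r)=1+\#\{r'<r:\mu_{r'}\le\mu_r\}+\#\{r'>r:\mu_{r'}<\mu_r\}$. The polynomials $E_\mu\in K[X]$, $\mu\in\mathbb{Z}^n$, are determined by: (E0) $E_{(0,\ldots,0)}=1$; (E1) $E_{(\mu_n+1,\mu_1,\ldots,\mu_{n-1})}=q^{\mu_n}x_1E_\mu(x_2,\ldots,x_n,q^{-1}x_1)$; (E2) if $\mu\in\mathbb{Z}_{\ge0}^n$ and $\mu_i>\mu_{i+1}$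 then $E_{s_i\mu}=\partial_i(x_iE_\mu)-tx_i\partial_iE_\mu+\frac{(1-t)a}{1-a}E_\mu$ with $a=q^{\mu_i-\mu_{i+1}}t^{v_\mu(i)-v_\mu(i+1)}$; (E3) $E_{(\mu_1-1,\ldots,\mu_n-1)}=x_1^{-1}\cdots x_n^{-1}E_\mu$. DBlex order: for weakly decreasing $\lambda^+,\mu^+\in\mathbb{Z}^n$, dominance order is $\lambda^+\le\mu^+$ iff $\lambda^+_1+\cdots+\lambda^+_i\le\mu^+_1+\cdots+\mu^+_i$ for all $i\in\{1,\ldots,n\}$. For $\mu\in\mathbb{Z}^n$ let $\mu^+$ be its weakly decreasing rearrangement and $z_\mu\in S_n$ the minimal length element with $\mu=z_\mu\mu^+$. Then $\lambda<\mu$ iff $\lambda^+<\mu^+$ in dominance order, or $\lambda^+=\mu^+$ and $z_\lambda<z_\mu$ in Bruhat order of $S_n$. Inner product: the bar involution on $K[X]$ is the $\mathbb{C}$-algebra automorphism $x_i\mapsto x_i^{-1}$, $q\mapsto q^{-1}$, $t^{1/2}\mapsto t^{-1/2}$. With $(z;q)_\infty=\prod_{r\ge0}(1-q^rz)$, $J_{q,t}=\prod_{i<j}\frac{(x_ix_j^{-1};q)_\infty}{(tx_ix_j^{-1};q)_\infty}\frac{(qx_i^{-1}x_j;q)_\infty}{(qtx_i^{-1}x_j;q)_\infty}$ is expanded as a formal power series, with coefficients in $\mathbb{Z}[t]$, in $x_ix_{i+1}^{-1}$ ($1\le i\le n-1$) and $qx_1^{-1}x_n$ (so the coefficient of each $x^\mu$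 lies in $\mathbb{Z}[t][[q]]$); $(f_1,f_2)_{q,t}=\mathrm{ct}(f_1\overline{f_2}J_{q,t})\in\mathbb{C}(t^{1/2})((q))\supset K$, where $\mathrm{ct}$ is the coefficient of $x^0$. *)

theory Defs
  imports
    "HOL-Computational_Algebra.Computational_Algebra"
    "HOL-Combinatorics.Permutations"
    "HOL-Library.FuncSet"
    "HOL-Library.Poly_Mapping"
begin

abbreviation lookup :: "('a \<Rightarrow>\<^sub>0 'b::zero) \<Rightarrow> 'a \<Rightarrow> 'b" where
  "lookup \<equiv> Poly_Mapping.lookup"

abbreviation single :: "'a \<Rightarrow> 'b \<Rightarrow> ('a \<Rightarrow>\<^sub>0 'b::zero)" where
  "single \<equiv> Poly_Mapping.single"

abbreviation keys :: "('a \<Rightarrow>\<^sub>0 'b::zero) \<Rightarrow> 'a set" where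
  "keys \<equiv> Poly_Mapping.keys"


section \<open>The coefficient field\<close>

text \<open>
  The base field \<open>\<complex>(q, t\<^sup>1\<^sup>/\<^sup>2)\<close> is built as \<open>\<complex>(t\<^sup>1\<^sup>/\<^sup>2)(q)\<close>, so that it embeds into
  \<open>\<complex>(t\<^sup>1\<^sup>/\<^sup>2)((q))\<close>.
\<close>

type_synonym tfield = "complex poly fract"
type_synonym qtfield = "tfield poly fract"

definition const_t :: "complex \<Rightarrow> tfield" where
  "const_t c = Fract [:c:] 1"

definition const_qt :: "tfield \<Rightarrow> qtfield" where
  "const_qt c = Fract [:c:] 1"

definition thalf :: tfield where
  "thalf = Fract [:0, 1:] 1"

definition qK :: qtfield where
  "qK = Fract [:0, 1:] 1"

definition tK :: qtfield where
  "tK = (const_qt thalf)\<^sup>2"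

text \<open>The extension to the field of fractions of a multiplicative map \<open>h\<close> sending nonzero
  elements to nonzero elements.\<close>

definition fract_lift :: "('a::idom \<Rightarrow> 'b::field) \<Rightarrow> 'a fract \<Rightarrow> 'b" where
  "fract_lift h z = (THE w. \<exists>a b. b \<noteq> 0 \<and> z = Fract a b \<and> w = h a / h b)"

lemma fract_lift_Fract:
  assumes "\<And>x y. h (x * y) = h x * h y" and "\<And>x. x \<noteq> 0 \<Longrightarrow> h x \<noteq> 0" and "b \<noteq> 0"
  shows "fract_lift h (Fract a b) = h a / h b"
  unfolding fract_lift_def
proof (rule the_equality)
  show "\<exists>a' b'. b' \<noteq> 0 \<and> Fract a b = Fract a' b' \<and> h a / h b = h a' / h b'"
    using assms(3) by blast
next
  fix w assume "\<exists>a' b'. b' \<noteq> 0 \<and> Fract a b = Fract a' b' \<and> w = h a' / h b'"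
  then obtain a' b' where *: "b' \<noteq> 0" "Fract a b = Fract a' b'" "w = h a' / h b'"
    by blast
  have "a * b' = a' * b"
    using * assms(3) by (simp add: eq_fract)
  then have "h a * h b' = h a' * h b"
    using assms(1) by metis
  then show "w = h a / h b"
    using * assms(2,3) by (simp add: frac_eq_eq)
qed

text \<open>The bar involution inverts \<open>t\<^sup>1\<^sup>/\<^sup>2\<close>, \<open>q\<close> and the \<open>x\<^sub>i\<close> and fixes \<open>\<complex>\<close>; it is defined in three layers,
  \<open>bar_t\<close>, \<open>bar_qt\<close> and \<open>bar\<close>, by evaluating polynomials at the inverse variable.\<close>

definition bar_t :: "tfield \<Rightarrow> tfield" where
  "bar_t = fract_lift (\<lambda>p. poly (map_poly const_t p) (inverse thalf))"

definition bar_qt :: "qtfield \<Rightarrow> qtfield" where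
  "bar_qt = fract_lift (\<lambda>p. poly (map_poly (\<lambda>c. const_qt (bar_t c)) p) (inverse qK))"

definition to_qseries :: "qtfield \<Rightarrow> tfield fls" where
  "to_qseries = fract_lift (\<lambda>p. fps_to_fls (fps_of_poly p))"


section \<open>Laurent polynomials\<close>

text \<open>
  Exponents are finitely supported functions on \<open>nat\<close>; the variables \<open>x\<^sub>1, \<dots>, x\<^sub>n\<close> are those
  with index in \<open>{1..n}\<close>, and \<open>\<int>\<^sup>n\<close> and \<open>K[X]\<close> are cut out by restricting supports.
\<close>

type_synonym expo = "nat \<Rightarrow>\<^sub>0 int"
type_synonym laurent = "expo \<Rightarrow>\<^sub>0 qtfield"

definition Zvec :: "nat \<Rightarrow> expo set" where
  "Zvec n = {\<mu>. keys \<mu> \<subseteq> {1..n}}"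

definition vec :: "nat \<Rightarrow> (nat \<Rightarrow> int) \<Rightarrow> expo" where
  "vec n f = (\<Sum>i\<in>{1..n}. single i (f i))"

definition Laurents :: "nat \<Rightarrow> laurent set" where
  "Laurents n = {f. keys f \<subseteq> Zvec n}"

definition xmono :: "expo \<Rightarrow> laurent" where
  "xmono \<nu> = single \<nu> 1"

definition scalar :: "qtfield \<Rightarrow> laurent" where
  "scalar c = single 0 c"

definition xvar :: "nat \<Rightarrow> laurent" where
  "xvar i = xmono (single i 1)"

text \<open>For a permutation \<open>w\<close> this is the action \<open>(w\<mu>)\<^bsub>w(i)\<^esub> = \<mu>\<^sub>i\<close>.\<close>

definition act :: "(nat \<Rightarrow> nat) \<Rightarrow> expo \<Rightarrow> expo" where
  "act w \<mu> = (\<Sum>i\<in>keys \<mu>. single (w i) (lookup \<mu> i))"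

text \<open>The substitution \<open>x\<^sub>i \<mapsto> c\<^sub>i x\<^bsub>w(i)\<^esub>\<close>, where all \<open>c\<^sub>i\<close> are nonzero.\<close>

definition msubst :: "(nat \<Rightarrow> qtfield) \<Rightarrow> (nat \<Rightarrow> nat) \<Rightarrow> laurent \<Rightarrow> laurent" where
  "msubst c w f =
     (\<Sum>\<nu>\<in>keys f. single (act w \<nu>) (lookup f \<nu> * (\<Prod>i\<in>keys \<nu>. c i powi lookup \<nu> i)))"

abbreviation adj :: "nat \<Rightarrow> nat \<Rightarrow> nat" where
  "adj i \<equiv> transpose i (i + 1)"

definition divided_diff :: "nat \<Rightarrow> laurent \<Rightarrow> laurent" where
  "divided_diff i f = (THE g. (xvar i - xvar (i + 1)) * g = f - msubst (\<lambda>_. 1) (adj i) f)"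

definition bar :: "laurent \<Rightarrow> laurent" where
  "bar f = (\<Sum>\<nu>\<in>keys f. single (- \<nu>) (bar_qt (lookup f \<nu>)))"


section \<open>The electronic Macdonald polynomials\<close>

text \<open>The minimal length permutation \<open>v\<close> for which \<open>v\<mu>\<close> is weakly increasing, by its explicit
  formula.\<close>

definition vperm :: "nat \<Rightarrow> expo \<Rightarrow> nat \<Rightarrow> nat" where
  "vperm n \<mu> r = 1 + card {s \<in> {1..n}. s < r \<and> lookup \<mu> s \<le> lookup \<mu> r}
                   + card {s \<in> {1..n}. r < s \<and> lookup \<mu> s < lookup \<mu> r}"

definition Macdonald_family :: "nat \<Rightarrow> (expo \<Rightarrow> laurent) \<Rightarrow> bool" where
  "Macdonald_family n E \<longleftrightarrow>
     E 0 = 1 \<and>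
     (\<forall>\<mu>\<in>Zvec n.
        E (vec n (\<lambda>i. if i = 1 then lookup \<mu> n + 1 else lookup \<mu> (i - 1))) =
          scalar (qK powi lookup \<mu> n) * xvar 1 *
          msubst (\<lambda>i. if i = n then inverse qK else 1) (\<lambda>i. if i = n then 1 else i + 1) (E \<mu>)) \<and>
     (\<forall>\<mu>\<in>Zvec n. \<forall>i. 1 \<le> i \<and> i < n \<and> (\<forall>j\<in>{1..n}. 0 \<le> lookup \<mu> j) \<and>
          lookup \<mu> i > lookup \<mu> (i + 1) \<longrightarrow>
        (let a = qK powi (lookup \<mu> i - lookup \<mu> (i + 1)) *
                 tK powi (int (vperm n \<mu> i) - int (vperm n \<mu> (i + 1)))
         in E (act (adj i) \<mu>) =
              divided_diff i (xvar i * E \<mu>) - scalar tK * xvar i * divided_diff i (E \<mu>)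
              + scalar ((1 - tK) * a / (1 - a)) * E \<mu>)) \<and>
     (\<forall>\<mu>\<in>Zvec n. E (\<mu> - vec n (\<lambda>_. 1)) = xmono (- vec n (\<lambda>_. 1)) * E \<mu>)"

text \<open>The value \<open>undefined\<close> forced outside \<open>\<int>\<^sup>n\<close> makes the family unique as a HOL function.\<close>

definition Macdonald_E :: "nat \<Rightarrow> expo \<Rightarrow> laurent" where
  "Macdonald_E n = (THE E. E \<in> Zvec n \<rightarrow>\<^sub>E Laurents n \<and> Macdonald_family n E)"


section \<open>The DBlex order\<close>

definition perm_length :: "nat \<Rightarrow> (nat \<Rightarrow> nat) \<Rightarrow> nat" where
  "perm_length n w = card {(i, j). 1 \<le> i \<and> i < j \<and> j \<le> n \<and> w i > w j}"

text \<open>Bruhat order as the transitive closure of multiplication by a length-increasing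
  reflection.\<close>

definition bruhat_step :: "nat \<Rightarrow> (nat \<Rightarrow> nat) \<Rightarrow> (nat \<Rightarrow> nat) \<Rightarrow> bool" where
  "bruhat_step n u w \<longleftrightarrow> (\<exists>i j. 1 \<le> i \<and> i < j \<and> j \<le> n \<and> w = u \<circ> transpose i j) \<and>
     perm_length n u < perm_length n w"

definition bruhat_less :: "nat \<Rightarrow> (nat \<Rightarrow> nat) \<Rightarrow> (nat \<Rightarrow> nat) \<Rightarrow> bool" where
  "bruhat_less n = (bruhat_step n)\<^sup>+\<^sup>+"

definition decreasing :: "nat \<Rightarrow> expo \<Rightarrow> bool" where
  "decreasing n \<mu> \<longleftrightarrow> (\<forall>i j. 1 \<le> i \<and> i \<le> j \<and> j \<le> n \<longrightarrow> lookup \<mu> i \<ge> lookup \<mu> j)"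

definition dec_rearr :: "nat \<Rightarrow> expo \<Rightarrow> expo" where
  "dec_rearr n \<mu> = (THE \<nu>. (\<exists>w. w permutes {1..n} \<and> \<nu> = act w \<mu>) \<and> decreasing n \<nu>)"

definition zperm :: "nat \<Rightarrow> expo \<Rightarrow> nat \<Rightarrow> nat" where
  "zperm n \<mu> = (ARG_MIN (perm_length n) w. w permutes {1..n} \<and> \<mu> = act w (dec_rearr n \<mu>))"

text \<open>Equality of the total sums is not required, so exponents of different total degree may be
  comparable.\<close>

definition dom_le :: "nat \<Rightarrow> expo \<Rightarrow> expo \<Rightarrow> bool" where
  "dom_le n \<kappa> \<mu> \<longleftrightarrow> (\<forall>i\<in>{1..n}. (\<Sum>j=1..i. lookup \<kappa> j) \<le> (\<Sum>j=1..i. lookup \<mu> j))"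

definition DBlex_less :: "nat \<Rightarrow> expo \<Rightarrow> expo \<Rightarrow> bool" where
  "DBlex_less n \<nu> \<mu> \<longleftrightarrow>
     (dom_le n (dec_rearr n \<nu>) (dec_rearr n \<mu>) \<and> dec_rearr n \<nu> \<noteq> dec_rearr n \<mu>) \<or>
     (dec_rearr n \<nu> = dec_rearr n \<mu> \<and> bruhat_less n (zperm n \<nu>) (zperm n \<mu>))"


section \<open>The inner product\<close>

text \<open>
  The kernel is a formal power series in \<open>y\<^sub>i = x\<^sub>i x\<^bsub>i+1\<^esub>\<^sup>-\<^sup>1\<close> (\<open>1 \<le> i < n\<close>) and
  \<open>y\<^sub>0 = q x\<^sub>1\<^sup>-\<^sup>1 x\<^sub>n\<close>. It is formed in the ring \<open>R[X][[h]]\<close>, \<open>R = \<complex>(t\<^sup>1\<^sup>/\<^sup>2)[[q]]\<close>, where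
  the extra variable \<open>h\<close> records the total degree in the \<open>y\<^sub>i\<close>: every \<open>y\<^sub>i\<close> is replaced by
  \<open>h y\<^sub>i\<close>. Since \<open>x\<^sub>i x\<^sub>j\<^sup>-\<^sup>1 = y\<^sub>i \<cdots> y\<^bsub>j-1\<^esub>\<close> for \<open>i < j\<close> and \<open>q = y\<^sub>0 \<cdots> y\<^bsub>n-1\<^esub>\<close>, this means
  replacing \<open>x\<^sub>i x\<^sub>j\<^sup>-\<^sup>1\<close> by \<open>h\<^bsup>j-i\<^esup> x\<^sub>i x\<^sub>j\<^sup>-\<^sup>1\<close>, \<open>q\<close> by \<open>h\<^bsup>n\<^esup> q\<close> and
  \<open>q x\<^sub>i\<^sup>-\<^sup>1 x\<^sub>j\<close> by \<open>h\<^bsup>n-(j-i)\<^esup> q x\<^sub>i\<^sup>-\<^sup>1 x\<^sub>j\<close>. Distinct monomials in the \<open>y\<^sub>i\<close> remain distinct.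
  At the end, the coefficient of \<open>x\<^sup>\<mu>\<close> is obtained by setting \<open>h = 1\<close>, which amounts to a
  \<open>q\<close>-adically convergent sum.
\<close>

type_synonym graded_series = "(expo \<Rightarrow>\<^sub>0 tfield fps) fps"

definition gterm :: "tfield fps \<Rightarrow> expo \<Rightarrow> nat \<Rightarrow> graded_series" where
  "gterm c \<nu> d = fps_const (single \<nu> c) * fps_X ^ d"

definition gq :: "nat \<Rightarrow> graded_series" where
  "gq n = gterm fps_X 0 n"

definition gtpar :: graded_series where
  "gtpar = gterm (fps_const (thalf\<^sup>2)) 0 0"

definition gx_ratio :: "nat \<Rightarrow> nat \<Rightarrow> graded_series" where
  "gx_ratio i j = gterm 1 (single i 1 - single j 1) (j - i)"

definition gqx_ratio :: "nat \<Rightarrow> nat \<Rightarrow> nat \<Rightarrow> graded_series" where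
  "gqx_ratio n i j = gterm fps_X (single j 1 - single i 1) (n - (j - i))"

text \<open>\<open>(z; q)\<^sub>\<infinity>\<close>, with the limit taken in the \<open>h\<close>-adic topology.\<close>

definition qpoch :: "nat \<Rightarrow> graded_series \<Rightarrow> graded_series" where
  "qpoch n z = lim (\<lambda>N. \<Prod>r<N. 1 - gq n ^ r * z)"

definition kernel :: "nat \<Rightarrow> graded_series" where
  "kernel n = (THE J.
     J * (\<Prod>(i, j) | 1 \<le> i \<and> i < j \<and> j \<le> n. qpoch n (gtpar * gx_ratio i j) * qpoch n (gtpar * gqx_ratio n i j)) =
     (\<Prod>(i, j) | 1 \<le> i \<and> i < j \<and> j \<le> n. qpoch n (gx_ratio i j) * qpoch n (gqx_ratio n i j)))"

definition kernel_coeff :: "nat \<Rightarrow> expo \<Rightarrow> tfield fps" where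
  "kernel_coeff n \<mu> = suminf (\<lambda>d. lookup (fps_nth (kernel n) d) \<mu>)"

definition ct_kernel :: "nat \<Rightarrow> laurent \<Rightarrow> tfield fls" where
  "ct_kernel n f = (\<Sum>\<nu>\<in>keys f. to_qseries (lookup f \<nu>) * fps_to_fls (kernel_coeff n (- \<nu>)))"

definition inner_qt :: "nat \<Rightarrow> laurent \<Rightarrow> laurent \<Rightarrow> tfield fls" where
  "inner_qt n f g = ct_kernel n (f * bar g)"

end

theory Submission
  imports Defs
begin

text \<open>
  The Demazure--Lusztig operators \<open>T\<^sub>i\<close> and the twisted rotation of the variables generate commuting
  Cherednik operators \<open>Y\<^sub>1, \<dots>, Y\<^sub>n\<close>. These are triangular on monomials with respect to the DBlex order,
  with eigenvalues \<open>q\<^bsup>-\<mu>\<^sub>i\<^esup> t\<^bsup>i - v\<^sub>\<mu>(i)\<^esup>\<close>; already their orders in \<open>q\<close> determine \<open>\<mu>\<close>, so a joint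
  eigenvector with these eigenvalues is unique up to a scalar and has \<open>x\<^sup>\<mu>\<close> as its only maximal monomial.
  Each step of the recursion (E1)--(E3) carries joint eigenvectors to joint eigenvectors, so \<open>E\<^sub>\<mu>\<close> exists
  and is this eigenvector, which gives (a).

  The kernel is invariant under the rotation, and under \<open>s\<^sub>i\<close> up to the factor that makes \<open>T\<^sub>i\<close>
  self-adjoint for \<open>(f, h) \<mapsto> ct(f h J)\<close>. Hence \<open>Y\<^sub>i\<close> has an adjoint which is triangular on the monomials
  \<open>x\<^bsup>-\<nu>\<^esup>\<close> with the same eigenvalues, and comparing eigenvalues gives (b) by induction on \<open>\<nu>\<close>.
  Conversely (a) and (b) determine \<open>E\<^sub>\<mu>\<close>, because at \<open>q = 0\<close> the Gram matrix of the monomials is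
  unitriangular with respect to the cone of positive roots.

  These symmetries of \<open>J\<close> are proved by clearing denominators in finite truncations of its products:
  \<open>J\<close> is regarded as a formal function on exponents on which the group ring acts by convolution,
  index \<open>0\<close> standing for \<open>q\<close>.
\<close>

text \<open>The order \<open>DBlex_less\<close> does not fix the total degree, so it has infinite
  descending chains. Inductions on the order therefore run along \<open>prec\<close>, its
  restriction to one degree, while orthogonality is proved for smaller exponents of whatever degree,
  since distinct exponents are separated by the eigenvalues alone. The factors \<open>T_i\<close> of
  a Cherednik operator are not triangular one by one; they become so when the order is measured
  after undoing the permutation of positions performed so far. The reflection \<open>s_i\<close>
  inverts \<open>y_i\<close> and so does not act on power series in the \<open>y_l\<close>. This is
  why the kernel is treated as a function on exponents, in a module over the group ring. An element
  of the group ring can be cancelled there if it is \<open>1\<close> plus terms of positive degree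
  and the functions are bounded below in that degree; for \<open>s_i\<close> this degree has to omit
  \<open>y_i\<close>. The second argument of the inner product is always a monomial, whose bar is
  the inverse monomial, so orthogonality can be handled in the bilinear form.\<close>

lemma poly_mapping_sum_single:
  fixes f :: "'a \<Rightarrow>\<^sub>0 'b::comm_monoid_add"
  shows "f = (\<Sum>k\<in>keys f. single k (lookup f k))"
  by (rule poly_mapping_eqI)
    (simp add: lookup_sum lookup_single when_def in_keys_iff)

lemma poly_mapping_linear_induct [case_names zero single add]:
  fixes f :: "'a \<Rightarrow>\<^sub>0 'b::comm_monoid_add"
  assumes "P 0" and "\<And>k c. P (single k c)" and "\<And>f g. P f \<Longrightarrow> P g \<Longrightarrow> P (f + g)"
  shows "P f"
proof -
  have "P (\<Sum>k\<in>A. single k (lookup f k))" if "finite A" for A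
    using that by (induction A) (use assms in auto)
  from this[of "keys f"] show ?thesis
    using poly_mapping_sum_single[of f] by simp
qed

lemma sum_keys_superset:
  fixes \<phi> :: "'a \<Rightarrow> 'b::ab_group_add \<Rightarrow> 'c::ab_group_add"
  assumes "\<And>k a b. \<phi> k (a + b) = \<phi> k a + \<phi> k b" and "finite A" and "keys f \<subseteq> A"
  shows "(\<Sum>k\<in>keys f. \<phi> k (lookup f k)) = (\<Sum>k\<in>A. \<phi> k (lookup f k))"
proof (rule sum.mono_neutral_left)
  have "\<phi> k 0 = 0" for k
    using assms(1)[of k 0 0] by simp
  then show "\<forall>i\<in>A - keys f. \<phi> i (lookup f i) = 0"
    by (simp add: in_keys_iff)
qed (use assms in auto)

lemma sum_keys_add:
  fixes \<phi> :: "'a \<Rightarrow> 'b::ab_group_add \<Rightarrow> 'c::ab_group_add"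
  assumes add: "\<And>k a b. \<phi> k (a + b) = \<phi> k a + \<phi> k b"
  shows "(\<Sum>k\<in>keys (f + g). \<phi> k (lookup (f + g) k)) =
    (\<Sum>k\<in>keys f. \<phi> k (lookup f k)) + (\<Sum>k\<in>keys g. \<phi> k (lookup g k))"
proof -
  let ?A = "keys f \<union> keys g"
  have *: "(\<Sum>k\<in>keys h. \<phi> k (lookup h k)) = (\<Sum>k\<in>?A. \<phi> k (lookup h k))" if "keys h \<subseteq> ?A" for h
    by (rule sum_keys_superset) (use add that in auto)
  show ?thesis
    unfolding *[OF keys_add] *[OF Un_upper1] *[OF Un_upper2] by (simp add: lookup_add add sum.distrib)
qed

lemma keys_uminus_eq: "keys (- f) = keys (f :: 'a \<Rightarrow>\<^sub>0 'b::ab_group_add)"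
  by (auto simp: in_keys_iff)

lemma keys_minus_subset: "keys (f - g) \<subseteq> keys f \<union> keys (g :: 'a \<Rightarrow>\<^sub>0 'b::ab_group_add)"
  by (auto simp: in_keys_iff lookup_minus)

lemma additive_minus:
  fixes F :: "'a::ab_group_add \<Rightarrow> 'b::ab_group_add"
  assumes "\<And>f g. F (f + g) = F f + F g"
  shows "F (f - g) = F f - F g"
  using assms[of "f - g" g] by (simp add: algebra_simps)

lemma additive_zero:
  fixes F :: "'a::ab_group_add \<Rightarrow> 'b::ab_group_add"
  assumes "\<And>f g. F (f + g) = F f + F g"
  shows "F 0 = 0"
  using assms[of 0 0] by simp

lemma additive_uminus:
  fixes F :: "'a::ab_group_add \<Rightarrow> 'b::ab_group_add"
  assumes "\<And>f g. F (f + g) = F f + F g"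
  shows "F (- f) = - F f"
  using additive_minus[OF assms, of 0 f] additive_zero[OF assms] by simp

lemma additive_sum:
  fixes F :: "'a::ab_group_add \<Rightarrow> 'b::ab_group_add"
  assumes "\<And>f g. F (f + g) = F f + F g"
  shows "F (sum h A) = (\<Sum>a\<in>A. F (h a))"
  by (induction A rule: infinite_finite_induct) (use assms additive_zero[OF assms] in auto)

section \<open>Substitutions of monomials\<close>

lemma act_add: "act w (\<mu> + \<nu>) = act w \<mu> + act w \<nu>"
  unfolding act_def
  by (rule sum_keys_add[where \<phi> = "\<lambda>i a. single (w i) a"]) (rule single_add)

lemma act_zero [simp]: "act w 0 = 0"
  by (simp add: act_def)

lemma act_single [simp]: "act w (single i a) = single (w i) a"
  by (cases "a = 0") (simp_all add: act_def)

lemma act_minus: "act w (\<mu> - \<nu>) = act w \<mu> - act w \<nu>"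
  by (rule additive_minus) (rule act_add)

lemma act_uminus: "act w (- \<nu>) = - act w \<nu>"
  by (rule additive_uminus) (rule act_add)

lemma act_id [simp]: "act id \<mu> = \<mu>" "act (\<lambda>i. i) \<mu> = \<mu>"
  using poly_mapping_sum_single[of \<mu>] by (simp_all add: act_def)

lemma act_act: "act w (act w' \<mu>) = act (w \<circ> w') \<mu>"
  by (induction \<mu> rule: poly_mapping_linear_induct) (simp_all add: act_add)

lemma lookup_act_eq: "inj w \<Longrightarrow> lookup (act w \<mu>) (w i) = lookup \<mu> i"
  by (induction \<mu> rule: poly_mapping_linear_induct)
    (simp_all add: act_add lookup_add lookup_single when_def inj_eq)

lemma lookup_act: "bij w \<Longrightarrow> lookup (act w \<mu>) j = lookup \<mu> (inv w j)"
  by (metis bij_def lookup_act_eq surj_f_inv_f)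

lemma act_cong: "(\<And>i. i \<in> keys \<mu> \<Longrightarrow> w i = w' i) \<Longrightarrow> act w \<mu> = act w' \<mu>"
  by (simp add: act_def)

lemma lookup_act_transpose: "lookup (act (transpose a b) \<mu>) j = lookup \<mu> (transpose a b j)"
  by (simp add: lookup_act)

lemma act_transpose_transpose [simp]: "act (transpose a b) (act (transpose a b) \<mu>) = \<mu>"
  by (simp add: act_act)

text \<open>The scalar that \<open>msubst\<close> puts in front of a monomial. It is split off
  because it is a character of the exponents for nonzero \<open>c\<close> (\<open>chi_add\<close>),
  which makes \<open>msubst\<close> multiplicative.\<close>

definition chi :: "(nat \<Rightarrow> qtfield) \<Rightarrow> expo \<Rightarrow> qtfield" where
  "chi c \<nu> = (\<Prod>i\<in>keys \<nu>. c i powi lookup \<nu> i)"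

lemma chi_superset: "finite A \<Longrightarrow> keys \<nu> \<subseteq> A \<Longrightarrow> chi c \<nu> = (\<Prod>i\<in>A. c i powi lookup \<nu> i)"
  unfolding chi_def by (rule prod.mono_neutral_left) (auto simp: in_keys_iff)

lemma chi_add:
  assumes "\<And>i. c i \<noteq> 0"
  shows "chi c (\<mu> + \<nu>) = chi c \<mu> * chi c \<nu>"
proof -
  let ?A = "keys \<mu> \<union> keys \<nu>"
  have "keys (\<mu> + \<nu>) \<subseteq> ?A"
    by (rule keys_add)
  then show ?thesis
    using assms by (simp add: chi_superset[where A = ?A] lookup_add power_int_add prod.distrib)
qed

lemma chi_single [simp]: "chi c (single i a) = c i powi a"
  by (cases "a = 0") (simp_all add: chi_def)

lemma chi_one [simp]: "chi (\<lambda>_. 1) \<nu> = 1"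
  by (simp add: chi_def)

lemma chi_zero [simp]: "chi c 0 = 1"
  by (simp add: chi_def)

lemma chi_mult: "chi (\<lambda>i. c i * c' i) \<nu> = chi c \<nu> * chi c' \<nu>"
  by (simp add: chi_def power_int_mult_distrib prod.distrib)

lemma chi_act:
  assumes "\<And>i. c i \<noteq> 0"
  shows "chi c (act w \<nu>) = chi (\<lambda>i. c (w i)) \<nu>"
  by (induction \<nu> rule: poly_mapping_linear_induct) (simp_all add: act_add chi_add assms)

lemma msubst_single: "msubst c w (single \<nu> a) = single (act w \<nu>) (a * chi c \<nu>)"
  by (cases "a = 0") (simp_all add: msubst_def chi_def)

lemma msubst_add: "msubst c w (f + g) = msubst c w f + msubst c w g"
  unfolding msubst_def
  by (rule sum_keys_add[where \<phi> = "\<lambda>\<nu> a. single (act w \<nu>) (a * (\<Prod>i\<in>keys \<nu>. c i powi lookup \<nu> i))"])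
    (simp add: single_add algebra_simps)

lemma msubst_zero [simp]: "msubst c w 0 = 0"
  by (simp add: msubst_def)

lemma msubst_minus: "msubst c w (f - g) = msubst c w f - msubst c w g"
  by (rule additive_minus) (rule msubst_add)

lemma msubst_mult:
  assumes "\<And>i. c i \<noteq> 0"
  shows "msubst c w (f * g) = msubst c w f * msubst c w g"
proof (induction f rule: poly_mapping_linear_induct)
  case (single k a)
  show ?case
  proof (induction g rule: poly_mapping_linear_induct)
    case (single l b)
    then show ?case
      by (simp add: mult_single msubst_single act_add chi_add assms mult.assoc mult.left_commute)
  qed (simp_all add: msubst_add algebra_simps)
qed (simp_all add: msubst_add algebra_simps)

lemma msubst_msubst:
  assumes "\<And>i. c i \<noteq> 0"
  shows "msubst c w (msubst c' w' f) = msubst (\<lambda>i. c' i * c (w' i)) (w \<circ> w') f"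
  by (induction f rule: poly_mapping_linear_induct)
    (simp_all add: msubst_add msubst_single act_act chi_act assms chi_mult mult.assoc comp_def)

lemma msubst_id [simp]: "msubst (\<lambda>_. 1) id f = f" "msubst (\<lambda>_. 1) (\<lambda>i. i) f = f"
  by (induction f rule: poly_mapping_linear_induct) (simp_all add: msubst_add msubst_single)

lemma msubst_scalar [simp]: "msubst c w (scalar a) = scalar a"
  by (simp add: scalar_def msubst_single)

lemma msubst_xvar: "msubst c w (xvar i) = scalar (c i) * xvar (w i)"
  by (simp add: xvar_def xmono_def scalar_def msubst_single mult_single)

lemma msubst_xmono: "msubst c w (xmono \<nu>) = scalar (chi c \<nu>) * xmono (act w \<nu>)"
  by (simp add: xmono_def scalar_def msubst_single mult_single)

lemma scalar_0 [simp]: "scalar 0 = 0" and scalar_1 [simp]: "scalar 1 = 1"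
  by (simp_all add: scalar_def)

lemma msubst_1 [simp]: "msubst c w 1 = 1"
  using msubst_scalar[of c w 1] by simp

lemma scalar_add: "scalar (a + b) = scalar a + scalar b"
  and scalar_minus: "scalar (a - b) = scalar a - scalar b"
  and scalar_uminus: "scalar (- a) = - scalar a"
  and scalar_mult: "scalar (a * b) = scalar a * scalar b"
  by (simp_all add: scalar_def single_add single_diff single_uminus mult_single)

lemma scalar_eq_0_iff [simp]: "scalar a = 0 \<longleftrightarrow> a = 0"
  by (metis lookup_single_eq lookup_zero scalar_def scalar_0)

lemma xmono_add: "xmono (\<mu> + \<nu>) = xmono \<mu> * xmono \<nu>"
  by (simp add: xmono_def mult_single)

lemma xmono_0 [simp]: "xmono 0 = 1"
  by (simp add: xmono_def)

lemma single_eq_scalar_xmono: "single \<nu> a = scalar a * xmono \<nu>"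
  by (simp add: scalar_def xmono_def mult_single)

lemma lookup_single_mult:
  fixes f :: "'a::ab_group_add \<Rightarrow>\<^sub>0 'b::comm_ring_1"
  shows "lookup (single \<kappa> a * f) \<nu> = a * lookup f (\<nu> - \<kappa>)"
proof (induction f rule: poly_mapping_linear_induct)
  case (single k c)
  show ?case
    by (auto simp: mult_single lookup_single when_def algebra_simps)
qed (simp_all add: lookup_add algebra_simps)

lemma lookup_scalar_mult [simp]: "lookup (scalar a * f) \<nu> = a * lookup f \<nu>"
  by (simp add: scalar_def lookup_single_mult)

lemma lookup_xmono_mult [simp]: "lookup (xmono \<kappa> * f) \<nu> = lookup f (\<nu> - \<kappa>)"
  by (simp add: xmono_def lookup_single_mult)

lemma lookup_xmono: "lookup (xmono \<kappa>) \<nu> = (if \<nu> = \<kappa> then 1 else 0)"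
  by (auto simp: xmono_def lookup_single when_def)

lemma laurent_linear_induct [case_names zero mono add scale]:
  assumes "P 0" and "\<And>\<nu>. P (xmono \<nu>)" and "\<And>f g. P f \<Longrightarrow> P g \<Longrightarrow> P (f + g)"
    and "\<And>a f. P f \<Longrightarrow> P (scalar a * f)"
  shows "P f"
  by (induction f rule: poly_mapping_linear_induct) (use assms in \<open>auto simp: single_eq_scalar_xmono\<close>)

section \<open>Demazure--Lusztig operators\<close>

abbreviation sw :: "nat \<Rightarrow> nat \<Rightarrow> nat" where
  "sw i \<equiv> transpose i (Suc i)"

abbreviation sv :: "nat \<Rightarrow> laurent \<Rightarrow> laurent" where
  "sv i \<equiv> msubst (\<lambda>_. 1) (sw i)"

lemma sv_mult: "sv i (f * g) = sv i f * sv i g"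
  by (rule msubst_mult) simp

lemma sv_sv [simp]: "sv i (sv i f) = f"
  by (simp add: msubst_msubst)

lemma sv_xvar: "sv i (xvar j) = xvar (sw i j)"
  by (simp add: msubst_xvar)

lemma sv_xvar_simps [simp]: "sv i (xvar i) = xvar (Suc i)" "sv i (xvar (Suc i)) = xvar i"
  by (simp_all add: sv_xvar)

text \<open>Laurent polynomials form a domain, so this allows cancelling \<open>x_i - x_j\<close>:
  divided differences become unique, and relations between the \<open>T_i\<close> can be checked
  after clearing denominators.\<close>

lemma xvar_diff_nonzero: "i \<noteq> j \<Longrightarrow> xvar i - xvar j \<noteq> 0"
proof
  assume "i \<noteq> j" and "xvar i - xvar j = 0"
  then have "lookup (xvar i) (single i 1) = lookup (xvar j) (single i 1)"
    by simp
  moreover have "single i (1::int) \<noteq> single j 1"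
    using \<open>i \<noteq> j\<close> by (metis lookup_single_eq lookup_single_not_eq zero_neq_one)
  ultimately show False
    by (simp add: xvar_def xmono_def lookup_single when_def)
qed

text \<open>The simple root, that is, the exponent of \<open>x_i / x_{i+1}\<close>.\<close>

definition aroot :: "nat \<Rightarrow> expo" where
  "aroot i = single i 1 - single (Suc i) 1"

lemma lookup_aroot: "lookup (aroot i) j = (if j = i then 1 else if j = Suc i then - 1 else 0)"
  by (simp add: aroot_def lookup_minus lookup_single when_def)

definition zmul :: "int \<Rightarrow> expo \<Rightarrow> expo" where
  "zmul k \<nu> = Poly_Mapping.map ((*) k) \<nu>"

lemma lookup_zmul [simp]: "lookup (zmul k \<nu>) i = k * lookup \<nu> i"
  by (simp add: zmul_def Poly_Mapping.map.rep_eq when_def)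

lemma zmul_simps: "zmul (k + l) \<nu> = zmul k \<nu> + zmul l \<nu>" "zmul 0 \<nu> = 0" "zmul 1 \<nu> = \<nu>"
  by (rule poly_mapping_eqI; simp add: lookup_add algebra_simps)+

lemma act_adj_eq: "act (sw i) \<nu> = \<nu> - zmul (lookup \<nu> i - lookup \<nu> (Suc i)) (aroot i)"
  by (rule poly_mapping_eqI)
    (auto simp: lookup_act_transpose lookup_minus lookup_aroot transpose_def)

text \<open>A geometric sum: multiplied by \<open>x_i - x_{i+1}\<close>, the term with index
  \<open>k\<close> becomes \<open>F k - F (Suc k)\<close>, and the sum telescopes from \<nu> to its
  reflection.\<close>

lemma divided_diff_sum:
  assumes "lookup \<nu> i - lookup \<nu> (Suc i) = int N"
  shows "(xvar i - xvar (Suc i)) * (\<Sum>k<N. xmono (\<nu> - single i 1 - zmul (int k) (aroot i)))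
    = xmono \<nu> - sv i (xmono \<nu>)"
proof -
  define F where "F k = xmono (\<nu> - zmul (int k) (aroot i))" for k
  have "(xvar i - xvar (Suc i)) * xmono (\<nu> - single i 1 - zmul (int k) (aroot i)) = F k - F (Suc k)" for k
  proof -
    have "single i 1 + (\<nu> - single i 1 - zmul (int k) (aroot i)) = \<nu> - zmul (int k) (aroot i)"
      by simp
    moreover have "single (Suc i) 1 + (\<nu> - single i 1 - zmul (int k) (aroot i))
        = \<nu> - zmul (int (Suc k)) (aroot i)"
      by (rule poly_mapping_eqI)
        (simp add: lookup_add lookup_minus lookup_aroot lookup_single when_def algebra_simps)
    ultimately show ?thesis
      unfolding F_def xvar_def left_diff_distrib xmono_add[symmetric] by (simp only:)
  qed
  then have "(xvar i - xvar (Suc i)) * (\<Sum>k<N. xmono (\<nu> - single i 1 - zmul (int k) (aroot i)))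
      = (\<Sum>k<N. F k - F (Suc k))"
    by (simp add: sum_distrib_left)
  also have "\<dots> = F 0 - F N"
    by (rule sum_lessThan_telescope')
  also have "\<dots> = xmono \<nu> - sv i (xmono \<nu>)"
    by (simp add: F_def msubst_xmono act_adj_eq assms zmul_simps)
  finally show ?thesis .
qed

lemma divided_diff_unique:
  assumes "(xvar i - xvar (Suc i)) * g = f - sv i f"
  shows "divided_diff i f = g"
  unfolding divided_diff_def Suc_eq_plus1[symmetric]
proof (rule the_equality)
  fix g' assume "(xvar i - xvar (Suc i)) * g' = f - sv i f"
  then have "(xvar i - xvar (Suc i)) * g' = (xvar i - xvar (Suc i)) * g"
    using assms by simp
  then show "g' = g"
    using xvar_diff_nonzero[of i "Suc i"] by simp
qed (rule assms)

text \<open>By linearity only monomials matter. If \<nu> has the smaller entry at \<open>i\<close>,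
  the sum for the reflected exponent is used with the opposite sign, because
  \<open>f - s_i f\<close> is antisymmetric.\<close>

lemma divided_diff_exists: "\<exists>g. (xvar i - xvar (Suc i)) * g = f - sv i f"
proof (induction f rule: laurent_linear_induct)
  case zero
  show ?case
    by (intro exI[of _ 0]) simp
next
  case (mono \<nu>)
  consider N where "lookup \<nu> i - lookup \<nu> (Suc i) = int N"
    | N where "lookup (act (sw i) \<nu>) i - lookup (act (sw i) \<nu>) (Suc i) = int N"
    by (cases "lookup \<nu> i \<ge> lookup \<nu> (Suc i)")
      (simp_all add: lookup_act_transpose, metis int_nat_eq diff_ge_0_iff_ge, metis zle_iff_zadd add_diff_cancel_left' linear)
  then show ?case
  proof cases
    case 1
    then show ?thesis
      using divided_diff_sum by blast
  next
    case 2
    from divided_diff_sum[OF this] obtain g where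
      "(xvar i - xvar (Suc i)) * g = sv i (xmono \<nu>) - sv i (sv i (xmono \<nu>))"
      by (auto simp: msubst_xmono)
    then have "(xvar i - xvar (Suc i)) * (- g) = xmono \<nu> - sv i (xmono \<nu>)"
      by simp
    then show ?thesis ..
  qed
next
  case (add f g)
  then obtain f' g' where "(xvar i - xvar (Suc i)) * f' = f - sv i f"
    "(xvar i - xvar (Suc i)) * g' = g - sv i g"
    by blast
  then have "(xvar i - xvar (Suc i)) * (f' + g') = (f + g) - sv i (f + g)"
    by (simp add: distrib_left msubst_add)
  then show ?case ..
next
  case (scale a f)
  then obtain f' where "(xvar i - xvar (Suc i)) * f' = f - sv i f"
    by blast
  then have "(xvar i - xvar (Suc i)) * (scalar a * f') = scalar a * f - sv i (scalar a * f)"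
    by (simp only: mult.left_commute[of _ "scalar a"] sv_mult msubst_scalar right_diff_distrib)
  then show ?case ..
qed

lemma divided_diff_eq: "(xvar i - xvar (Suc i)) * divided_diff i f = f - sv i f"
  using divided_diff_exists divided_diff_unique by metis

text \<open>The operator part of (E2), the Demazure--Lusztig operator \<open>T_i\<close> normalised
  by \<open>(T_i - 1)(T_i + t) = 0\<close>, so that it fixes constants.\<close>

definition DL :: "nat \<Rightarrow> laurent \<Rightarrow> laurent" where
  "DL i f = divided_diff i (xvar i * f) - scalar tK * xvar i * divided_diff i f"

text \<open>The denominator-free form of \<open>T_i\<close>. Since \<open>x_i - x_{i+1}\<close> can
  be cancelled, it characterises \<open>T_i\<close> (\<open>DL_unique\<close>), and the Hecke
  relations are verified against it.\<close>

lemma DL_eq: "(xvar i - xvar (Suc i)) * DL i f =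
    (scalar tK * xvar i - xvar (Suc i)) * sv i f + scalar (1 - tK) * xvar i * f"
proof -
  have "(xvar i - xvar (Suc i)) * DL i f = (xvar i - xvar (Suc i)) * divided_diff i (xvar i * f)
     - scalar tK * xvar i * ((xvar i - xvar (Suc i)) * divided_diff i f)"
    by (simp add: DL_def algebra_simps)
  also have "\<dots> = (xvar i * f - xvar (Suc i) * sv i f) - scalar tK * xvar i * (f - sv i f)"
    by (simp add: divided_diff_eq sv_mult)
  finally show ?thesis
    by (simp add: scalar_minus algebra_simps)
qed

lemma DL_unique:
  assumes "(xvar i - xvar (Suc i)) * g =
    (scalar tK * xvar i - xvar (Suc i)) * sv i f + scalar (1 - tK) * xvar i * f"
  shows "DL i f = g"
proof -
  have "(xvar i - xvar (Suc i)) * DL i f = (xvar i - xvar (Suc i)) * g"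
    using assms DL_eq by simp
  then show ?thesis
    using xvar_diff_nonzero[of i "Suc i"] by simp
qed

lemma DL_add: "DL i (f + g) = DL i f + DL i g"
proof (rule DL_unique)
  show "(xvar i - xvar (Suc i)) * (DL i f + DL i g) =
    (scalar tK * xvar i - xvar (Suc i)) * sv i (f + g) + scalar (1 - tK) * xvar i * (f + g)"
    by (simp only: distrib_left DL_eq msubst_add) (simp add: algebra_simps)
qed

lemma DL_mult_symmetric:
  assumes "sv i p = p"
  shows "DL i (p * f) = p * DL i f"
proof (rule DL_unique)
  have "(xvar i - xvar (Suc i)) * (p * DL i f) = p * ((xvar i - xvar (Suc i)) * DL i f)"
    by (simp add: mult.left_commute)
  also have "\<dots> = (scalar tK * xvar i - xvar (Suc i)) * sv i (p * f) + scalar (1 - tK) * xvar i * (p * f)"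
    unfolding DL_eq sv_mult assms by (simp add: algebra_simps)
  finally show "(xvar i - xvar (Suc i)) * (p * DL i f) =
    (scalar tK * xvar i - xvar (Suc i)) * sv i (p * f) + scalar (1 - tK) * xvar i * (p * f)" .
qed

lemma DL_scalar: "DL i (scalar a * f) = scalar a * DL i f"
  by (rule DL_mult_symmetric) simp

lemma DL_xvar_other: "j \<noteq> i \<Longrightarrow> j \<noteq> Suc i \<Longrightarrow> DL i (xvar j * f) = xvar j * DL i f"
  by (rule DL_mult_symmetric) (simp add: sv_xvar)

lemma DL_sum: "DL i (sum h A) = (\<Sum>a\<in>A. DL i (h a))"
  by (rule additive_sum) (rule DL_add)

text \<open>The substitution carries \<open>s_i\<close> to \<open>s_j\<close>, and the common scalar
  of \<open>x_i\<close> and \<open>x_{i+1}\<close> cancels from the homogeneous relation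
  \<open>DL_eq\<close>.\<close>

lemma msubst_DL:
  assumes c: "\<And>l. c l \<noteq> 0" "c i = c (Suc i)" and w: "inj w" "w i = j" "w (Suc i) = Suc j"
  shows "msubst c w (DL i f) = DL j (msubst c w f)"
proof (rule DL_unique[symmetric])
  let ?M = "msubst c w"
  have M: "?M (g * h) = ?M g * ?M h" for g h
    using c(1) by (rule msubst_mult)
  have "w \<circ> sw i = sw j \<circ> w"
  proof
    fix l
    have "w l = j \<longleftrightarrow> l = i" and "w l = Suc j \<longleftrightarrow> l = Suc i"
      using inj_eq[OF w(1)] w(2,3) by metis+
    then show "(w \<circ> sw i) l = (sw j \<circ> w) l"
      using w(2,3) by (simp add: transpose_def)
  qed
  moreover have "(\<lambda>l. c (sw i l)) = c"
  proof
    show "c (sw i l) = c l" for l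
      using c(2) by (cases "l = i"; cases "l = Suc i") simp_all
  qed
  ultimately have s: "?M (sv i f) = sv j (?M f)"
    using c(1) by (simp add: msubst_msubst)
  have "?M ((xvar i - xvar (Suc i)) * DL i f) =
    ?M ((scalar tK * xvar i - xvar (Suc i)) * sv i f + scalar (1 - tK) * xvar i * f)"
    by (simp only: DL_eq)
  then have "scalar (c i) * ((xvar j - xvar (Suc j)) * ?M (DL i f)) = scalar (c i) *
    ((scalar tK * xvar j - xvar (Suc j)) * sv j (?M f) + scalar (1 - tK) * xvar j * ?M f)"
    using w(2,3) by (simp add: M msubst_add msubst_minus msubst_xvar s c(2) algebra_simps)
  then show "(xvar j - xvar (Suc j)) * ?M (DL i f) =
    (scalar tK * xvar j - xvar (Suc j)) * sv j (?M f) + scalar (1 - tK) * xvar j * ?M f"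
    using c(1) by simp
qed

text \<open>The ring identity behind the quadratic relation, with \<open>g\<close>,
  \<open>s\<close>, \<open>h\<close> in the roles of \<open>T_i f\<close>, \<open>s_i f\<close> and
  \<open>s_i (T_i f)\<close>; the assumption \<open>D'\<close> is the image of \<open>D\<close>
  under \<open>s_i\<close>.\<close>

lemma DL_quadratic_identity:
  fixes x :: "'a::comm_ring_1"
  assumes D: "(x - y) * g = (t * x - y) * s + (1 - t) * x * f"
    and D': "(y - x) * h = (t * y - x) * f + (1 - t) * y * s"
  shows "(x - y) * ((x - y) * ((1 - t) * g + t * f)) = (x - y) * ((t * x - y) * h + (1 - t) * x * g)"
proof -
  have "(x - y) * ((x - y) * ((1 - t) * g + t * f)) = (1 - t) * (x - y) * ((x - y) * g) + t * (x - y) * (x - y) * f"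
    by (simp add: algebra_simps)
  also have "\<dots> = (1 - t) * x * ((x - y) * g) - (t * x - y) * ((y - x) * h)"
    unfolding D D' by (simp add: algebra_simps)
  finally show ?thesis
    by (simp add: algebra_simps)
qed

lemma DL_quadratic: "DL i (DL i f) = scalar (1 - tK) * DL i f + scalar tK * f"
proof (rule DL_unique)
  define x y t g where "x = xvar i" "y = xvar (Suc i)" "t = scalar tK" "g = DL i f"
  have D: "(x - y) * g = (t * x - y) * sv i f + (1 - t) * x * f"
    using DL_eq[of i f] by (simp add: x_y_t_g_def scalar_minus)
  then have "sv i ((x - y) * g) = sv i ((t * x - y) * sv i f + (1 - t) * x * f)"
    by simp
  then have D': "(y - x) * sv i g = (t * y - x) * f + (1 - t) * y * sv i f"
    by (simp add: sv_mult msubst_add msubst_minus x_y_t_g_def)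
  have "(x - y) * ((x - y) * ((1 - t) * g + t * f)) = (x - y) * ((t * x - y) * sv i g + (1 - t) * x * g)"
    using DL_quadratic_identity[OF D D'] .
  then have "(x - y) * ((1 - t) * g + t * f) = (t * x - y) * sv i g + (1 - t) * x * g"
    using xvar_diff_nonzero[of i "Suc i"] by (simp add: x_y_t_g_def)
  then show "(xvar i - xvar (Suc i)) * (scalar (1 - tK) * DL i f + scalar tK * f) =
    (scalar tK * xvar i - xvar (Suc i)) * sv i (DL i f) + scalar (1 - tK) * xvar i * DL i f"
    by (simp add: x_y_t_g_def scalar_minus)
qed

lemma DL_far:
  assumes "Suc i < j"
  shows "DL i (DL j f) = DL j (DL i f)"
proof -
  have "(xvar j - xvar (Suc j)) * DL i (DL j f) = DL i ((xvar j - xvar (Suc j)) * DL j f)"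
    using assms by (simp add: DL_mult_symmetric msubst_minus sv_xvar)
  also have "\<dots> = (scalar tK * xvar j - xvar (Suc j)) * DL i (sv j f)
      + scalar (1 - tK) * xvar j * DL i f"
    unfolding DL_eq DL_add using assms
    by (simp add: DL_mult_symmetric msubst_minus sv_mult sv_xvar)
  also have "DL i (sv j f) = sv j (DL i f)"
    using assms by (subst msubst_DL[where j = i]) simp_all
  finally show ?thesis
    by (intro DL_unique[symmetric]) simp
qed

lemma sv_braid: "sv i (sv (Suc i) (sv i f)) = sv (Suc i) (sv i (sv (Suc i) f))"
proof -
  have "sw i \<circ> (sw (Suc i) \<circ> sw i) = sw (Suc i) \<circ> (sw i \<circ> sw (Suc i))"
    by (auto simp: fun_eq_iff transpose_def)
  then show ?thesis
    by (simp add: msubst_msubst)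
qed

text \<open>Expands a composite of two operators while clearing the denominators of the outer
  operator and of both inner terms together.\<close>

lemma braid_step:
  fixes D1 :: "'a::comm_ring"
  assumes "D1 * a = A * b + B * c" and "D2 * b = b'" and "D3 * c = c'"
  shows "D1 * D2 * D3 * a = A * D3 * b' + B * D2 * c'"
proof -
  have "D1 * D2 * D3 * a = D2 * D3 * (D1 * a)"
    by (simp only: mult_ac)
  also have "\<dots> = A * D3 * (D2 * b) + B * D2 * (D3 * c)"
    unfolding assms(1) by (simp only: distrib_left mult_ac)
  finally show ?thesis
    unfolding assms .
qed

text \<open>What remains of the braid relation once all denominators are cleared; \<open>f1\<close>,
  \<open>f2\<close>, \<open>f12\<close>, \<open>f21\<close>, \<open>f121\<close> stand for the
  images of \<open>f\<close> under the nontrivial elements of the group generated by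
  \<open>s_i\<close> and \<open>s_{i+1}\<close>.\<close>

lemma braid_identity:
  fixes x :: "'a::comm_ring_1"
  shows "(y - z) * ((t * x - y) * ((t * x - z) * (x - y) * ((t * y - z) * f121 + (1 - t) * y * f12)
      - (1 - t) * x * (y - z) * ((t * y - x) * f + (1 - t) * y * f1))
    + (1 - t) * x * ((t * y - z) * (x - y) * ((t * x - z) * f21 + (1 - t) * x * f2)
      + (1 - t) * y * (x - z) * ((t * x - y) * f1 + (1 - t) * x * f))) =
    (x - y) * ((t * y - z) * ((t * x - z) * (y - z) * ((t * x - y) * f121 + (1 - t) * x * f21)
      - (1 - t) * x * (x - y) * ((t * z - y) * f + (1 - t) * z * f2))
    + (1 - t) * y * ((t * x - y) * (y - z) * ((t * x - z) * f12 + (1 - t) * x * f1)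
      + (1 - t) * x * (x - z) * ((t * y - z) * f2 + (1 - t) * y * f)))"
proof -
  define a b c p q r u a' b' where "a = t * x - y" "b = t * y - z" "c = t * x - z" "p = x - y" "q = y - z"
    "r = x - z" "u = 1 - t" "a' = t * y - x" "b' = t * z - y"
  note defs = this
  \<comment> \<open>The terms in \<open>f12\<close>, \<open>f21\<close> and \<open>f121\<close>
    cancel outright; these relations among the differences kill the coefficients of
    \<open>f1\<close>, \<open>f2\<close> and \<open>f\<close>.\<close>
  have r: "r = p + q" and y: "q * x + p * z = y * r" and aa: "a * a' = u * u * x * y - t * p * p"
    and bb: "b * b' = u * u * y * z - t * q * q"
    unfolding defs by (simp_all add: algebra_simps)
  have "q * (a * (c * p * (b * f121 + u * y * f12) - u * x * q * (a' * f + u * y * f1))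
      + u * x * (b * p * (c * f21 + u * x * f2) + u * y * r * (a * f1 + u * x * f)))
    - p * (b * (c * q * (a * f121 + u * x * f21) - u * x * p * (b' * f + u * z * f2))
      + u * y * (a * q * (c * f12 + u * x * f1) + u * x * r * (b * f2 + u * y * f)))
    = q * a * u * u * x * y * (r - (p + q)) * f1 + p * b * u * u * x * ((q * x + p * z) - y * r) * f2
      + u * x * (u * u * x * y * r * q - q * q * (a * a') + p * p * (b * b') - u * u * y * r * (y * p)) * f"
    by (simp add: algebra_simps)
  moreover have "u * u * x * y * r * q - q * q * (a * a') + p * p * (b * b') - u * u * y * r * (y * p)
    = u * u * y * (x * q * (r - q) + p * (p * z - y * r))"
    unfolding aa bb by (simp add: algebra_simps)
  moreover have "x * q * (r - q) + p * (p * z - y * r) = p * ((q * x + p * z) - y * r)"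
    by (simp add: r algebra_simps)
  then have "x * q * (r - q) + p * (p * z - y * r) = 0"
    unfolding y by simp
  ultimately show ?thesis
    unfolding defs[symmetric] using r y by simp
qed

lemma DL_braid: "DL i (DL (Suc i) (DL i f)) = DL (Suc i) (DL i (DL (Suc i) f))"
proof -
  define x y z t where "x = xvar i" "y = xvar (Suc i)" "z = xvar (Suc (Suc i))" "t = scalar tK"
  define f1 f2 f12 f21 f121 where "f1 = sv i f" "f2 = sv (Suc i) f" "f12 = sv i f2" "f21 = sv (Suc i) f1"
    "f121 = sv i f21"
  note defs = x_y_z_t_def f1_f2_f12_f21_f121_def
  have 1: "(x - y) * DL i h = (t * x - y) * sv i h + (1 - t) * x * h" for h
    using DL_eq[of i h] by (simp add: defs scalar_minus)
  have 2: "(y - z) * DL (Suc i) h = (t * y - z) * sv (Suc i) h + (1 - t) * y * h" for h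
    using DL_eq[of "Suc i" h] by (simp add: defs scalar_minus)
  have s1: "sv i x = y" "sv i y = x" "sv i z = z" "sv i t = t" "sv i 1 = 1"
    and s2: "sv (Suc i) x = x" "sv (Suc i) y = z" "sv (Suc i) z = y" "sv (Suc i) t = t" "sv (Suc i) 1 = 1"
    by (simp_all add: defs sv_xvar)
  have 3: "(y - x) * sv i (DL i h) = (t * y - x) * h + (1 - t) * y * sv i h" for h
    using arg_cong[OF 1[of h], of "sv i"] by (simp add: msubst_add msubst_minus sv_mult s1)
  have 4: "(z - y) * sv (Suc i) (DL (Suc i) h) = (t * z - y) * h + (1 - t) * z * sv (Suc i) h" for h
    using arg_cong[OF 2[of h], of "sv (Suc i)"] by (simp add: msubst_add msubst_minus sv_mult s2)
  have 5: "(x - z) * sv (Suc i) (DL i h) = (t * x - z) * sv (Suc i) (sv i h) + (1 - t) * x * sv (Suc i) h" for h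
    using arg_cong[OF 1[of h], of "sv (Suc i)"] by (simp add: msubst_add msubst_minus sv_mult s2)
  have 6: "(x - z) * sv i (DL (Suc i) h) = (t * x - z) * sv i (sv (Suc i) h) + (1 - t) * x * sv i h" for h
    using arg_cong[OF 2[of h], of "sv i"] by (simp add: msubst_add msubst_minus sv_mult s1)
  have 7: "(y - z) * sv i (sv (Suc i) (DL i f)) = (t * y - z) * f121 + (1 - t) * y * f12"
    using arg_cong[OF 5[of f], of "sv i"] by (simp add: msubst_add msubst_minus sv_mult s1 f1_f2_f12_f21_f121_def)
  have 8: "(x - y) * sv (Suc i) (sv i (DL (Suc i) f)) = (t * x - y) * f121 + (1 - t) * x * f21"
    using arg_cong[OF 6[of f], of "sv (Suc i)"]
    by (simp add: msubst_add msubst_minus sv_mult s2 f1_f2_f12_f21_f121_def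
        sv_braid)
  define D where "D = (x - y) * (y - z) * (x - z)"
  have E1: "D * DL (Suc i) (DL i f) = (t * y - z) * (x - y) * ((t * x - z) * f21 + (1 - t) * x * f2)
    + (1 - t) * y * (x - z) * ((t * x - y) * f1 + (1 - t) * x * f)"
    using braid_step[OF 2[of "DL i f"] 5[of f] 1[of f]] unfolding D_def f1_f2_f12_f21_f121_def by (simp add: mult_ac)
  have E2: "D * sv i (DL (Suc i) (DL i f)) = (t * x - z) * (x - y) * ((t * y - z) * f121 + (1 - t) * y * f12)
    - (1 - t) * x * (y - z) * ((t * y - x) * f + (1 - t) * y * f1)"
    using braid_step[OF 6[of "DL i f"] 7 3[of f]] unfolding D_def f1_f2_f12_f21_f121_def by (simp add: algebra_simps)
  have F1: "D * DL i (DL (Suc i) f) = (t * x - y) * (y - z) * ((t * x - z) * f12 + (1 - t) * x * f1)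
    + (1 - t) * x * (x - z) * ((t * y - z) * f2 + (1 - t) * y * f)"
    using braid_step[OF 1[of "DL (Suc i) f"] 6[of f] 2[of f]] unfolding D_def f1_f2_f12_f21_f121_def by (simp add: mult_ac)
  have F2: "D * sv (Suc i) (DL i (DL (Suc i) f)) = (t * x - z) * (y - z) * ((t * x - y) * f121 + (1 - t) * x * f21)
    - (1 - t) * x * (x - y) * ((t * z - y) * f + (1 - t) * z * f2)"
    using braid_step[OF 5[of "DL (Suc i) f"] 8 4[of f]] unfolding D_def f1_f2_f12_f21_f121_def by (simp add: algebra_simps)
  \<comment> \<open>\<open>D\<close> clears the inner two operators on each side; the two further
    factors are the denominators of the outermost operators, \<open>T_i\<close> on the left and
    \<open>T_{i+1}\<close> on the right.\<close>
  have "(y - z) * (x - y) * D * DL i (DL (Suc i) (DL i f)) =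
    (y - z) * D * ((x - y) * DL i (DL (Suc i) (DL i f)))"
    by (simp only: mult_ac)
  also have "\<dots> = (y - z) * ((t * x - y) * (D * sv i (DL (Suc i) (DL i f))) + (1 - t) * x * (D * DL (Suc i) (DL i f)))"
    unfolding 1 by (simp only: distrib_left mult_ac)
  also have "\<dots> = (x - y) * ((t * y - z) * (D * sv (Suc i) (DL i (DL (Suc i) f))) + (1 - t) * y * (D * DL i (DL (Suc i) f)))"
    unfolding E1 E2 F1 F2 by (rule braid_identity)
  also have "\<dots> = (x - y) * D * ((y - z) * DL (Suc i) (DL i (DL (Suc i) f)))"
    unfolding 2 by (simp only: distrib_left mult_ac)
  also have "\<dots> = (y - z) * (x - y) * D * DL (Suc i) (DL i (DL (Suc i) f))"
    by (simp only: mult_ac)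
  finally show ?thesis
    using xvar_diff_nonzero[of i "Suc i"] xvar_diff_nonzero[of "Suc i" "Suc (Suc i)"] xvar_diff_nonzero[of i "Suc (Suc i)"]
    by (simp add: D_def x_y_z_t_def)
qed

section \<open>Inverses of the Demazure--Lusztig operators and their cross relations with the
  variables\<close>

lemma Fract_1_eq_0_iff: "Fract a 1 = 0 \<longleftrightarrow> a = 0"
  by (simp add: Zero_fract_def eq_fract)

lemma thalf_nonzero [simp]: "thalf \<noteq> 0"
  by (simp add: thalf_def Fract_1_eq_0_iff)

lemma const_qt_eq_0_iff [simp]: "const_qt c = 0 \<longleftrightarrow> c = 0"
  by (simp add: const_qt_def Fract_1_eq_0_iff)

lemma tK_nonzero [simp]: "tK \<noteq> 0"
  by (simp add: tK_def)

lemma qK_nonzero [simp]: "qK \<noteq> 0"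
  by (simp add: qK_def Fract_1_eq_0_iff)

text \<open>The inverse of \<open>T_i\<close>, solved from the quadratic relation.\<close>

definition DLi :: "nat \<Rightarrow> laurent \<Rightarrow> laurent" where
  "DLi i f = scalar (inverse tK) * (DL i f + scalar (tK - 1) * f)"

lemma scalar_inverse_cancel: "c \<noteq> 0 \<Longrightarrow> scalar (inverse c) * (scalar c * f) = f"
  "c \<noteq> 0 \<Longrightarrow> scalar c * (scalar (inverse c) * f) = f"
  by (simp_all add: mult.assoc[symmetric] scalar_mult[symmetric])

lemma DLi_add: "DLi i (f + g) = DLi i f + DLi i g"
  by (simp add: DLi_def DL_add algebra_simps)

lemma DLi_mult_symmetric: "sv i p = p \<Longrightarrow> DLi i (p * f) = p * DLi i f"
  by (simp add: DLi_def DL_mult_symmetric distrib_left mult.left_commute)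

lemma DLi_scalar: "DLi i (scalar a * f) = scalar a * DLi i f"
  by (rule DLi_mult_symmetric) simp

lemma DL_DLi [simp]: "DL i (DLi i f) = f"
proof -
  have "DL i (DLi i f) = scalar (inverse tK) * (DL i (DL i f) + scalar (tK - 1) * DL i f)"
    by (simp only: DLi_def DL_scalar DL_add)
  also have "\<dots> = scalar (inverse tK) * (scalar tK * f)"
    by (simp add: DL_quadratic scalar_minus algebra_simps)
  finally have "DL i (DLi i f) = scalar (inverse tK) * (scalar tK * f)" .
  then show ?thesis
    by (simp add: scalar_inverse_cancel)
qed

lemma DLi_DL [simp]: "DLi i (DL i f) = f"
proof -
  have "DLi i (DL i f) = scalar (inverse tK) * (scalar tK * f)"
    by (simp add: DLi_def DL_quadratic scalar_minus algebra_simps)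
  then show ?thesis
    by (simp add: scalar_inverse_cancel)
qed

lemma DL_far': "i + 1 < j \<or> j + 1 < i \<Longrightarrow> DL i (DL j f) = DL j (DL i f)"
  using DL_far[of i j f] DL_far[of j i f] by auto

lemma DL_DLi_far: "i + 1 < j \<or> j + 1 < i \<Longrightarrow> DL i (DLi j f) = DLi j (DL i f)"
  by (simp add: DLi_def DL_scalar DL_add DL_far'[of i j])

text \<open>The braid relation for \<open>g\<close>, where \<open>f = T_i T_{i+1} g\<close>.\<close>

lemma DLi_braid: "DLi (Suc i) (DLi i (DL (Suc i) f)) = DL i (DLi (Suc i) (DLi i f))"
proof -
  define g where "g = DLi (Suc i) (DLi i f)"
  have "f = DL i (DL (Suc i) g)"
    by (simp add: g_def)
  then have "DL (Suc i) f = DL i (DL (Suc i) (DL i g))"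
    by (simp add: DL_braid)
  then show ?thesis
    by (simp add: g_def)
qed

text \<open>A cross relation of the affine Hecke algebra, like \<open>DLi_xvar\<close>. A variable
  passing the operator exchanges \<open>T_i\<close> with its inverse; this turns the factors of one
  Cherednik operator into those of the next when \<open>x_1\<close> is moved through.\<close>

lemma DL_xvar_Suc: "DL i (xvar (Suc i) * f) = scalar tK * (xvar i * DLi i f)"
proof -
  define x y t s where "x = xvar i" "y = xvar (Suc i)" "t = scalar tK" "s = sv i f"
  have D: "(x - y) * DL i f = (t * x - y) * s + (1 - t) * x * f"
    using DL_eq[of i f] by (simp add: x_y_t_s_def scalar_minus)
  have "(x - y) * (x * (DL i f + (t - 1) * f)) = x * ((x - y) * DL i f) + (x - y) * (x * ((t - 1) * f))"
    by (simp add: algebra_simps)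
  also have "\<dots> = (t * x - y) * (x * s) + (1 - t) * x * (y * f)"
    unfolding D by (simp add: algebra_simps)
  finally have "DL i (y * f) = x * (DL i f + (t - 1) * f)"
    by (intro DL_unique) (simp add: x_y_t_s_def scalar_minus sv_mult)
  then show ?thesis
    by (simp add: DLi_def x_y_t_s_def mult.left_commute[of "xvar i"] scalar_inverse_cancel scalar_minus)
qed

lemma DLi_xvar: "DLi i (xvar i * f) = scalar (inverse tK) * (xvar (Suc i) * DL i f)"
proof -
  define x y t s where "x = xvar i" "y = xvar (Suc i)" "t = scalar tK" "s = sv i f"
  have D: "(x - y) * DL i f = (t * x - y) * s + (1 - t) * x * f"
    using DL_eq[of i f] by (simp add: x_y_t_s_def scalar_minus)
  have "(x - y) * (y * DL i f - (t - 1) * (x * f)) = y * ((x - y) * DL i f) - (x - y) * ((t - 1) * (x * f))"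
    by (simp add: algebra_simps)
  also have "\<dots> = (t * x - y) * (y * s) + (1 - t) * x * (x * f)"
    unfolding D by (simp add: algebra_simps)
  finally have "DL i (x * f) = y * DL i f - (t - 1) * (x * f)"
    by (intro DL_unique) (simp add: x_y_t_s_def scalar_minus sv_mult)
  then show ?thesis
    by (simp add: DLi_def x_y_t_s_def scalar_minus)
qed

lemma DLi_xvar_other: "j \<noteq> i \<Longrightarrow> j \<noteq> Suc i \<Longrightarrow> DLi i (xvar j * f) = xvar j * DLi i f"
  by (rule DLi_mult_symmetric) (simp add: sv_xvar)

section \<open>Cherednik operators\<close>

text \<open>Unlike the index map in (E1), this fixes indices outside \<open>{1..n}\<close>, so for
  \<open>n \<ge> 1\<close> it is a bijection of \<open>nat\<close>. On exponents in
  \<open>Zvec n\<close> both maps act alike.\<close>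

definition rot :: "nat \<Rightarrow> nat \<Rightarrow> nat" where
  "rot n i = (if i = n then 1 else if 1 \<le> i \<and> i < n then Suc i else i)"

definition irot :: "nat \<Rightarrow> nat \<Rightarrow> nat" where
  "irot n i = (if i = 1 then n else if 1 < i \<and> i \<le> n then i - 1 else i)"

definition Rq :: "nat \<Rightarrow> laurent \<Rightarrow> laurent" where
  "Rq n = msubst (\<lambda>i. if i = n then inverse qK else 1) (rot n)"

definition Rqi :: "nat \<Rightarrow> laurent \<Rightarrow> laurent" where
  "Rqi n = msubst (\<lambda>i. if i = 1 then qK else 1) (irot n)"

text \<open>\<open>up m i\<close> applies \<open>T_i\<close> first and \<open>T_{i+m-1}\<close>
  last; \<open>down\<close> uses the reverse order, as adjoints require.\<close>

fun up :: "nat \<Rightarrow> nat \<Rightarrow> laurent \<Rightarrow> laurent" where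
  "up 0 i f = f"
| "up (Suc m) i f = DL (i + m) (up m i f)"

fun upi :: "nat \<Rightarrow> nat \<Rightarrow> laurent \<Rightarrow> laurent" where
  "upi 0 i f = f"
| "upi (Suc m) i f = DLi (i + m) (upi m i f)"

fun down :: "nat \<Rightarrow> nat \<Rightarrow> laurent \<Rightarrow> laurent" where
  "down 0 i f = f"
| "down (Suc m) i f = down m i (DL (i + m) f)"

fun downi :: "nat \<Rightarrow> nat \<Rightarrow> laurent \<Rightarrow> laurent" where
  "downi 0 i f = f"
| "downi (Suc m) i f = downi m i (DLi (i + m) f)"

text \<open>As a product, \<open>T_{i-1} ... T_1 R T_{n-1}^{-1} ... T_i^{-1}\<close> with
  \<open>R\<close> the twisted rotation \<open>Rq\<close>. With this normalisation
  \<open>Y_{i+1} = T_i Y_i T_i\<close>.\<close>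

definition Yop :: "nat \<Rightarrow> nat \<Rightarrow> laurent \<Rightarrow> laurent" where
  "Yop n i f = up (i - 1) 1 (Rq n (upi (n - i) i f))"

text \<open>The adjoint of \<open>Yop\<close> with respect to the bilinear form \<open>(f, h) \<mapsto> ct(f h J)\<close>.\<close>

definition Ystar :: "nat \<Rightarrow> nat \<Rightarrow> laurent \<Rightarrow> laurent" where
  "Ystar n i f = downi (n - i) i (Rqi n (down (i - 1) 1 f))"

text \<open>The operator of (E1) without its scalar \<open>q^{\<mu>_n}\<close>.\<close>

definition Phi :: "nat \<Rightarrow> laurent \<Rightarrow> laurent" where
  "Phi n f = xvar 1 * Rq n f"

section \<open>Relations between the Cherednik operators, the \<open>T_i\<close> and the raising
  operator\<close>

lemma up_add: "up m i (f + g) = up m i f + up m i g"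
  by (induction m) (simp_all add: DL_add)

lemma up_scalar: "up m i (scalar a * f) = scalar a * up m i f"
  by (induction m) (simp_all add: DL_scalar)

lemma upi_add: "upi m i (f + g) = upi m i f + upi m i g"
  by (induction m) (simp_all add: DLi_add)

lemma upi_scalar: "upi m i (scalar a * f) = scalar a * upi m i f"
  by (induction m) (simp_all add: DLi_scalar)

lemma Rq_add: "Rq n (f + g) = Rq n f + Rq n g"
  by (simp add: Rq_def msubst_add)

lemma Rq_mult: "Rq n (f * g) = Rq n f * Rq n g"
  by (simp add: Rq_def msubst_mult)

lemma Rq_scalar: "Rq n (scalar a * f) = scalar a * Rq n f"
  by (simp add: Rq_mult) (simp add: Rq_def)

lemma Rqi_add: "Rqi n (f + g) = Rqi n f + Rqi n g"
  by (simp add: Rqi_def msubst_add)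

lemma Rqi_mult: "Rqi n (f * g) = Rqi n f * Rqi n g"
  by (simp add: Rqi_def msubst_mult)

lemma Rqi_scalar: "Rqi n (scalar a * f) = scalar a * Rqi n f"
  by (simp add: Rqi_mult) (simp add: Rqi_def)

lemma Yop_add: "Yop n i (f + g) = Yop n i f + Yop n i g"
  by (simp add: Yop_def up_add upi_add Rq_add)

lemma Yop_scalar: "Yop n i (scalar a * f) = scalar a * Yop n i f"
  by (simp add: Yop_def up_scalar upi_scalar Rq_scalar)

lemma up_rec: "up (Suc m) i f = up m (Suc i) (DL i f)"
  by (induction m) simp_all

lemma upi_rec: "upi (Suc m) i f = upi m (Suc i) (DLi i f)"
  by (induction m) simp_all

lemma rot_irot: "n \<ge> 1 \<Longrightarrow> rot n (irot n i) = i"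
  by (auto simp: rot_def irot_def)

lemma irot_rot: "n \<ge> 1 \<Longrightarrow> irot n (rot n i) = i"
  by (auto simp: rot_def irot_def)

lemma bij_rot: "n \<ge> 1 \<Longrightarrow> bij (rot n)"
  by (metis bijI' rot_irot irot_rot)

lemma inj_rot: "n \<ge> 1 \<Longrightarrow> inj (rot n)"
  using bij_rot bij_is_inj by blast

lemma inv_rot: "n \<ge> 1 \<Longrightarrow> inv (rot n) = irot n"
  by (rule inv_unique_comp) (simp_all add: fun_eq_iff rot_irot irot_rot)

lemma irot_eq_n: "n \<ge> 1 \<Longrightarrow> irot n i = n \<longleftrightarrow> i = 1"
  by (auto simp: irot_def)

lemma Rq_Rqi [simp]: "n \<ge> 1 \<Longrightarrow> Rq n (Rqi n f) = f"
proof -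
  assume n: "n \<ge> 1"
  then have "(\<lambda>i. (if i = 1 then qK else 1) * (if irot n i = n then inverse qK else 1)) = (\<lambda>_. 1)"
    and "rot n \<circ> irot n = (\<lambda>i. i)"
    using irot_eq_n[OF n] by (auto simp: fun_eq_iff rot_irot)
  then show ?thesis
    by (simp add: Rq_def Rqi_def msubst_msubst)
qed

lemma Rq_DL:
  assumes "1 \<le> j" "Suc j < n"
  shows "Rq n (DL j f) = DL (Suc j) (Rq n f)"
  unfolding Rq_def using assms by (intro msubst_DL inj_rot) (auto simp: rot_def)

lemma Rq_DLi:
  assumes "1 \<le> j" "Suc j < n"
  shows "Rq n (DLi j f) = DLi (Suc j) (Rq n f)"
  by (simp add: DLi_def Rq_scalar Rq_add Rq_DL[OF assms])

text \<open>One rotation would move \<open>T_{n-1}\<close> out of range. Two rotations send the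
  positions \<open>n - 1\<close>, \<open>n\<close> to \<open>1\<close>, \<open>2\<close>, and both
  variables then carry the same factor \<open>q^{-1}\<close>.\<close>

lemma Rq_Rq_DL:
  assumes "2 \<le> n"
  shows "Rq n (Rq n (DL (n - 1) f)) = DL 1 (Rq n (Rq n f))"
proof -
  let ?c = "\<lambda>i. if i = n then inverse qK else 1"
  have *: "Rq n (Rq n h) = msubst (\<lambda>i. ?c i * ?c (rot n i)) (rot n \<circ> rot n) h" for h
    by (simp add: Rq_def msubst_msubst)
  show ?thesis
    unfolding * using assms by (intro msubst_DL inj_compose inj_rot) (auto simp: rot_def)
qed

lemma Rq_Rq_DLi:
  assumes "2 \<le> n"
  shows "Rq n (Rq n (DLi (n - 1) f)) = DLi 1 (Rq n (Rq n f))"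
  by (simp add: DLi_def Rq_scalar Rq_add Rq_Rq_DL[OF assms] del: One_nat_def)

lemma DL_up_far: "(\<And>k. i \<le> k \<Longrightarrow> k < i + m \<Longrightarrow> j + 1 < k \<or> k + 1 < j) \<Longrightarrow> DL j (up m i f) = up m i (DL j f)"
proof (induction m)
  case (Suc m)
  then show ?case
    by (simp add: DL_far'[of j "i + m"])
qed simp

lemma DL_upi_far: "(\<And>k. i \<le> k \<Longrightarrow> k < i + m \<Longrightarrow> j + 1 < k \<or> k + 1 < j) \<Longrightarrow> DL j (upi m i f) = upi m i (DL j f)"
proof (induction m)
  case (Suc m)
  then show ?case
    by (simp add: DL_DLi_far[of j "i + m"])
qed simp

text \<open>\<open>T_j\<close> commutes with the factors until it meets \<open>T_{j+1} T_j\<close>;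
  there the braid relation turns it into a \<open>T_{j+1}\<close> on the right, which commutes with
  all remaining factors.\<close>

lemma DL_up_shift:
  assumes "i \<le> j" "Suc j < i + m"
  shows "DL j (up m i f) = up m i (DL (Suc j) f)"
  using assms
proof (induction m)
  case (Suc m)
  show ?case
  proof (cases "Suc j < i + m")
    case True
    with Suc show ?thesis
      by (simp add: DL_far'[of j "i + m"])
  next
    case False
    with Suc.prems have j: "Suc j = i + m" by simp
    then obtain m' where m': "m = Suc m'" "j = i + m'"
      using Suc.prems by (cases m) auto
    have "DL j (up (Suc m) i f) = DL j (DL (Suc j) (DL j (up m' i f)))"
      by (simp add: m')
    also have "\<dots> = DL (Suc j) (DL j (DL (Suc j) (up m' i f)))"
      by (rule DL_braid)
    also have "DL (Suc j) (up m' i f) = up m' i (DL (Suc j) f)"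
      by (rule DL_up_far) (simp add: m')
    finally show ?thesis
      by (simp add: m')
  qed
qed simp

lemma upi_DL_shift:
  assumes "i \<le> j" "Suc j < i + m"
  shows "upi m i (DL (Suc j) f) = DL j (upi m i f)"
  using assms
proof (induction m)
  case (Suc m)
  show ?case
  proof (cases "Suc j < i + m")
    case True
    with Suc show ?thesis
      by (simp add: DL_DLi_far)
  next
    case False
    with Suc.prems have j: "Suc j = i + m" by simp
    then obtain m' where m': "m = Suc m'" "j = i + m'"
      using Suc.prems by (cases m) auto
    have "upi (Suc m) i (DL (Suc j) f) = DLi (Suc j) (DLi j (upi m' i (DL (Suc j) f)))"
      by (simp add: m')
    also have "upi m' i (DL (Suc j) f) = DL (Suc j) (upi m' i f)"
      by (rule DL_upi_far[symmetric]) (simp add: m')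
    finally show ?thesis
      by (simp add: m' DLi_braid)
  qed
qed simp

text \<open>The inner \<open>T_i\<close> cancels the first inverse factor of \<open>Y_i\<close>, and
  the outer one prolongs the product on the left.\<close>

lemma Yop_Suc:
  assumes "1 \<le> i" "i < n"
  shows "DL i (Yop n i (DL i f)) = Yop n (Suc i) f"
proof -
  have "upi (n - i) i (DL i f) = upi (n - Suc i) (Suc i) f"
    using assms upi_rec[of "n - Suc i" i "DL i f"] by (simp add: Suc_diff_Suc)
  moreover have "DL i (up (i - 1) 1 g) = up i 1 g" for g
    using assms by (cases i) simp_all
  ultimately show ?thesis
    by (simp add: Yop_def)
qed

text \<open>The index of \<open>T_j\<close> is shifted once by one of the two products and once, in
  the opposite direction, by the rotation. For \<open>j < i\<close> the left product does this, for
  \<open>j > i\<close> the right one.\<close>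

lemma DL_Yop:
  assumes "1 \<le> i" "i \<le> n" "1 \<le> j" "j < n" "j \<noteq> i" "Suc j \<noteq> i"
  shows "DL j (Yop n i f) = Yop n i (DL j f)"
proof (cases "j < i")
  case True
  with assms have j: "Suc j < i" by simp
  have "DL j (Yop n i f) = up (i - 1) 1 (DL (Suc j) (Rq n (upi (n - i) i f)))"
    unfolding Yop_def using j assms by (intro DL_up_shift) auto
  also have "DL (Suc j) (Rq n (upi (n - i) i f)) = Rq n (DL j (upi (n - i) i f))"
    using j assms by (simp add: Rq_DL)
  also have "DL j (upi (n - i) i f) = upi (n - i) i (DL j f)"
    using j by (intro DL_upi_far) auto
  finally show ?thesis
    by (simp add: Yop_def)
next
  case False
  with assms obtain k where k: "j = Suc k" "i \<le> k" "1 \<le> k"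
    by (cases j) auto
  have "DL j (Yop n i f) = up (i - 1) 1 (DL j (Rq n (upi (n - i) i f)))"
    unfolding Yop_def using k assms by (intro DL_up_far) auto
  also have "DL j (Rq n (upi (n - i) i f)) = Rq n (DL k (upi (n - i) i f))"
    using k assms by (simp add: Rq_DL)
  also have "DL k (upi (n - i) i f) = upi (n - i) i (DL j f)"
    unfolding k using k assms by (intro upi_DL_shift[symmetric]) auto
  finally show ?thesis
    by (simp add: Yop_def)
qed

lemma Rq_xvar: "1 \<le> i \<Longrightarrow> i < n \<Longrightarrow> Rq n (xvar i) = xvar (Suc i)"
  and Rq_xvar_n: "Rq n (xvar n) = scalar (inverse qK) * xvar 1"
  by (simp_all add: Rq_def msubst_xvar rot_def)

lemma up_xvar_other: "j < i \<Longrightarrow> up m i (xvar j * f) = xvar j * up m i f"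
  by (induction m) (simp_all add: DL_xvar_other)

lemma upi_xvar_other: "j < i \<Longrightarrow> upi m i (xvar j * f) = xvar j * upi m i f"
  by (induction m) (simp_all add: DLi_xvar_other)

text \<open>Each cross relation raises the index of the variable by one, costs a factor
  \<open>t^{-1}\<close> and replaces an inverse operator by the operator itself.\<close>

lemma upi_xvar: "upi m i (xvar i * f) = scalar (inverse tK ^ m) * (xvar (i + m) * up m i f)"
proof (induction m)
  case (Suc m)
  then show ?case
    by (simp add: DLi_scalar DLi_xvar scalar_mult)
qed simp

lemma upi_Rq:
  assumes "1 \<le> i" "i + m < n"
  shows "upi m (Suc i) (Rq n f) = Rq n (upi m i f)"
  using assms by (induction m) (simp_all add: Rq_DLi)

lemma up_Rq:
  assumes "1 \<le> i" "i + m < n"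
  shows "up m (Suc i) (Rq n f) = Rq n (up m i f)"
  using assms by (induction m) (simp_all add: Rq_DL)

text \<open>\<open>Y_{i+1}\<close> has one inverse factor too few and one \<open>T_1\<close> too
  many. The variable, which arrives at \<open>T_1\<close> as \<open>x_2\<close>, turns it into
  \<open>t x_1 T_1^{-1}\<close>, and this inverse becomes the missing \<open>T_{n-1}^{-1}\<close>
  when moved back through two rotations.\<close>

lemma Yop_Suc_Phi:
  assumes "1 \<le> i" "i < n"
  shows "Yop n (Suc i) (Phi n f) = scalar tK * Phi n (Yop n i f)"
proof -
  define m where "m = n - Suc i"
  have m: "n - i = Suc m" "i + m = n - 1" "1 < n"
    using assms by (simp_all add: m_def)
  have "Yop n (Suc i) (Phi n f) = up i 1 (Rq n (xvar 1 * upi m (Suc i) (Rq n f)))"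
    using assms by (simp add: Yop_def Phi_def m_def upi_xvar_other)
  also have "\<dots> = up i 1 (xvar (Suc 1) * Rq n (Rq n (upi m i f)))"
    using assms m by (simp add: upi_Rq Rq_mult Rq_xvar)
  also have "\<dots> = up (i - 1) 2 (DL 1 (xvar (Suc 1) * Rq n (Rq n (upi m i f))))"
    using assms up_rec[of "i - 1" 1] by (simp add: numeral_2_eq_2)
  also have "\<dots> = scalar tK * (xvar 1 * up (i - 1) 2 (DLi 1 (Rq n (Rq n (upi m i f)))))"
    unfolding DL_xvar_Suc by (simp add: up_scalar up_xvar_other)
  also have "DLi 1 (Rq n (Rq n (upi m i f))) = Rq n (Rq n (upi (n - i) i f))"
    using m by (simp add: Rq_Rq_DLi[symmetric] del: One_nat_def)
  also have "up (i - 1) 2 (Rq n (Rq n (upi (n - i) i f))) = Rq n (up (i - 1) 1 (Rq n (upi (n - i) i f)))"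
    using assms up_Rq[of 1 "i - 1" n] by (simp add: numeral_2_eq_2)
  finally show ?thesis
    by (simp add: Phi_def Yop_def)
qed

text \<open>Moving \<open>x_1\<close> through all \<open>n - 1\<close> inverse factors makes it
  \<open>x_n\<close> and yields \<open>t^{-(n-1)}\<close>; the rotation then returns it as
  \<open>q^{-1} x_1\<close>.\<close>

lemma Yop_1_Phi:
  assumes "1 \<le> n"
  shows "Yop n 1 (Phi n f) = scalar (inverse qK * inverse tK ^ (n - 1)) * Phi n (Yop n n f)"
proof -
  have "Yop n 1 (Phi n f) = Rq n (upi (n - 1) 1 (xvar 1 * Rq n f))"
    by (simp add: Yop_def Phi_def)
  also have "\<dots> = Rq n (scalar (inverse tK ^ (n - 1)) * (xvar n * up (n - 1) 1 (Rq n f)))"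
    using assms upi_xvar[of "n - 1" 1] by simp
  also have "\<dots> = scalar (inverse tK ^ (n - 1)) * (Rq n (xvar n) * Rq n (up (n - 1) 1 (Rq n f)))"
    by (simp only: Rq_scalar) (simp only: Rq_mult)
  also have "\<dots> = scalar (inverse qK * inverse tK ^ (n - 1)) * (xvar 1 * Rq n (up (n - 1) 1 (Rq n f)))"
    by (simp only: Rq_xvar_n scalar_mult mult_ac)
  finally show ?thesis
    by (simp add: Phi_def Yop_def)
qed

section \<open>Action on monomials\<close>

lemma divided_diff_xmono:
  assumes "lookup \<nu> i - lookup \<nu> (Suc i) = int N"
  shows "divided_diff i (xmono \<nu>) = (\<Sum>k<N. xmono (\<nu> - single i 1 - zmul (int k) (aroot i)))"
  by (rule divided_diff_unique) (rule divided_diff_sum[OF assms])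

lemma divided_diff_sv: "divided_diff i (sv i f) = - divided_diff i f"
proof (rule divided_diff_unique)
  have "(xvar i - xvar (Suc i)) * (- divided_diff i f) = - ((xvar i - xvar (Suc i)) * divided_diff i f)"
    by simp
  also have "\<dots> = sv i f - sv i (sv i f)"
    unfolding divided_diff_eq by simp
  finally show "(xvar i - xvar (Suc i)) * (- divided_diff i f) = sv i f - sv i (sv i f)" .
qed

lemma DL_xmono_ge:
  assumes N: "lookup \<rho> i - lookup \<rho> (Suc i) = int N"
  shows "DL i (xmono \<rho>) = xmono (act (sw i) \<rho>) +
    scalar (1 - tK) * (\<Sum>k<N. xmono (\<rho> - zmul (int k) (aroot i)))"
proof -
  let ?S = "\<Sum>k<N. xmono (\<rho> - zmul (int k) (aroot i))"
  have "divided_diff i (xvar i * xmono \<rho>) = divided_diff i (xmono (single i 1 + \<rho>))"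
    by (simp add: xvar_def xmono_add)
  also have "\<dots> = (\<Sum>k<Suc N. xmono (\<rho> - zmul (int k) (aroot i)))"
    using N by (subst divided_diff_xmono[where N = "Suc N"]) (simp_all add: lookup_add lookup_single)
  also have "\<dots> = ?S + xmono (act (sw i) \<rho>)"
    using N by (simp add: act_adj_eq)
  finally have 1: "divided_diff i (xvar i * xmono \<rho>) = ?S + xmono (act (sw i) \<rho>)" .
  have "xvar i * xmono (\<rho> - single i 1 - zmul (int k) (aroot i)) = xmono (\<rho> - zmul (int k) (aroot i))" for k
    by (simp add: xvar_def xmono_add[symmetric])
  then have 2: "xvar i * divided_diff i (xmono \<rho>) = ?S"
    by (simp add: divided_diff_xmono[OF N] sum_distrib_left)
  show ?thesis
    unfolding DL_def 1 mult.assoc 2 by (simp add: scalar_minus algebra_simps)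
qed

text \<open>The sum covers only the interior of the string from \<rho> to its reflection, whereas in
  \<open>DL_xmono_ge\<close> it includes \<rho> itself when the string is nontrivial. The
  triangularity proof rests on this asymmetry.\<close>

lemma DL_xmono_less:
  assumes N: "lookup \<rho> (Suc i) - lookup \<rho> i = int (Suc N)"
  shows "DL i (xmono \<rho>) = scalar tK * xmono (act (sw i) \<rho>) -
    scalar (1 - tK) * (\<Sum>k<N. xmono (\<rho> + zmul (int (Suc k)) (aroot i)))"
proof -
  define \<kappa> where "\<kappa> = act (sw i) \<rho>"
  have \<rho>: "\<rho> = act (sw i) \<kappa>"
    by (simp add: \<kappa>_def)
  have \<kappa>N: "lookup \<kappa> i - lookup \<kappa> (Suc i) = int (Suc N)"
    using N by (simp add: \<kappa>_def lookup_act_transpose)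
  have \<kappa>\<rho>: "\<kappa> - zmul (int k) (aroot i) = \<rho> + zmul (int (Suc N) - int k) (aroot i)" for k
    unfolding \<rho> act_adj_eq \<kappa>N by (rule poly_mapping_eqI) (simp add: lookup_add lookup_minus algebra_simps)
  let ?F = "\<lambda>k. xmono (\<kappa> - zmul (int k) (aroot i))"
  let ?S = "\<Sum>k<N. ?F (Suc k)"
  have "xvar i * xmono \<rho> = sv i (xmono (single (Suc i) 1 + \<kappa>))"
    by (simp add: \<rho> xvar_def msubst_xmono act_add xmono_add[symmetric])
  then have "divided_diff i (xvar i * xmono \<rho>) = - divided_diff i (xmono (single (Suc i) 1 + \<kappa>))"
    by (simp add: divided_diff_sv)
  also have "divided_diff i (xmono (single (Suc i) 1 + \<kappa>)) =
      (\<Sum>k<N. xmono (single (Suc i) 1 + \<kappa> - single i 1 - zmul (int k) (aroot i)))"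
    using \<kappa>N by (intro divided_diff_xmono) (simp add: lookup_add lookup_single)
  also have "\<dots> = ?S"
    by (intro sum.cong refl arg_cong[of _ _ xmono] poly_mapping_eqI)
      (simp add: lookup_add lookup_minus lookup_aroot lookup_single when_def algebra_simps)
  finally have 1: "divided_diff i (xvar i * xmono \<rho>) = - ?S" .
  have "xvar i * xmono (\<kappa> - single i 1 - zmul (int k) (aroot i)) = ?F k" for k
    by (simp add: xvar_def xmono_add[symmetric])
  then have "xvar i * divided_diff i (xmono \<kappa>) = (\<Sum>k<Suc N. ?F k)"
    by (simp only: divided_diff_xmono[OF \<kappa>N] sum_distrib_left)
  also have "\<dots> = xmono \<kappa> + ?S"
    by (subst sum.lessThan_Suc_shift) (simp add: zmul_simps)
  finally have 2: "xvar i * divided_diff i (xmono \<kappa>) = xmono \<kappa> + ?S" .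
  have "xmono \<rho> = sv i (xmono \<kappa>)"
    by (simp add: \<rho> msubst_xmono)
  then have 3: "xvar i * divided_diff i (xmono \<rho>) = - (xmono \<kappa> + ?S)"
    by (simp add: divided_diff_sv 2)
  have "?S = (\<Sum>k<N. xmono (\<rho> + zmul (int (Suc k)) (aroot i)))"
    by (rule sum.reindex_bij_witness[where i = "\<lambda>k. N - Suc k" and j = "\<lambda>k. N - Suc k"])
      (auto simp del: of_nat_Suc simp: \<kappa>\<rho> intro!: arg_cong[of _ _ xmono] arg_cong[of _ _ "\<lambda>k. _ + zmul k _"])
  then show ?thesis
    unfolding DL_def 1 mult.assoc 3 \<kappa>_def[symmetric] by (simp add: scalar_minus algebra_simps)
qed

section \<open>Partial sums and decreasing rearrangements\<close>

definition psum :: "nat \<Rightarrow> expo \<Rightarrow> int" where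
  "psum i \<nu> = (\<Sum>j=1..i. lookup \<nu> j)"

lemma lookup_act_permutes: "p permutes S \<Longrightarrow> lookup (act p \<nu>) j = lookup \<nu> (inv p j)"
  by (simp add: lookup_act permutes_bij)

lemma lookup_act_permutes': "p permutes S \<Longrightarrow> lookup (act p \<nu>) (p j) = lookup \<nu> j"
  by (simp add: lookup_act_eq permutes_inj)

lemma Zvec_iff: "\<nu> \<in> Zvec n \<longleftrightarrow> (\<forall>j. j \<notin> {1..n} \<longrightarrow> lookup \<nu> j = 0)"
  by (auto simp: Zvec_def in_keys_iff)

lemma act_Zvec: "p permutes {1..n} \<Longrightarrow> \<nu> \<in> Zvec n \<Longrightarrow> act p \<nu> \<in> Zvec n"
  using permutes_not_in[OF permutes_inv, of p "{1..n}"] by (simp add: Zvec_iff lookup_act_permutes del: One_nat_def)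

lemma act_permutes_inv: "p permutes S \<Longrightarrow> act p \<nu> = \<mu> \<Longrightarrow> act (inv p) \<mu> = \<nu>"
  by (auto simp: act_act permutes_inv_o)

lemma sum_act_permutes:
  assumes "p permutes {1..n}"
  shows "(\<Sum>j\<in>B. F (lookup (act p \<nu>) j)) = (\<Sum>j\<in>inv p ` B. F (lookup \<nu> j))"
  using assms permutes_inj_on[OF permutes_inv[OF assms], of B]
  by (simp add: sum.reindex lookup_act_permutes)

lemma sum_act_permutes_all:
  assumes "p permutes {1..n}"
  shows "(\<Sum>j=1..n. F (lookup (act p \<nu>) j)) = (\<Sum>j=1..n. F (lookup \<nu> j))"
  using sum_act_permutes[OF assms, of F \<nu> "{1..n}"] permutes_image[OF permutes_inv[OF assms]] by simp

text \<open>For \<open>i = card B\<close>, the entries of \<open>B\<close> beyond position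
  \<open>i\<close> are at most \<nu> at \<open>i\<close>, the entries of \<open>{1..i}\<close>
  missing from \<open>B\<close> are at least that, and there are equally many of both.\<close>

lemma sum_le_psum_decreasing:
  assumes dec: "decreasing n \<nu>" and B: "B \<subseteq> {1..n}"
  shows "(\<Sum>j\<in>B. lookup \<nu> j) \<le> psum (card B) \<nu>"
proof -
  define i A where "i = card B" "A = {1..i}"
  have fin: "finite B" "finite A"
    using B finite_subset by (auto simp: i_A_def)
  have "i \<le> n"
    using card_mono[OF _ B] by (simp add: i_A_def)
  have card: "card (B - A) = card (A - B)"
    using fin by (simp add: card_Diff_subset_Int Int_commute) (simp add: i_A_def)
  have "(\<Sum>j\<in>B - A. lookup \<nu> j) \<le> of_nat (card (B - A)) * lookup \<nu> i"
  proof (rule sum_bounded_above)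
    fix j assume "j \<in> B - A"
    then have j: "j \<in> B" "i < j" "1 \<le> j" "j \<le> n"
      using B by (auto simp: i_A_def)
    then have "1 \<le> i"
      using fin by (auto simp: i_A_def Suc_le_eq card_gt_0_iff)
    then show "lookup \<nu> j \<le> lookup \<nu> i"
      using dec j unfolding decreasing_def by auto
  qed
  also have "\<dots> = of_nat (card (A - B)) * lookup \<nu> i"
    by (simp add: card)
  also have "\<dots> \<le> (\<Sum>j\<in>A - B. lookup \<nu> j)"
  proof (rule sum_bounded_below)
    fix j assume "j \<in> A - B"
    then show "lookup \<nu> i \<le> lookup \<nu> j"
      using dec \<open>i \<le> n\<close> unfolding decreasing_def i_A_def by auto
  qed
  finally show ?thesis
    using sum.Int_Diff[OF fin(1), of "lookup \<nu>" A] sum.Int_Diff[OF fin(2), of "lookup \<nu>" B]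
    by (simp add: psum_def i_A_def Int_commute)
qed

lemma psum_Suc: "psum (Suc i) \<nu> = psum i \<nu> + lookup \<nu> (Suc i)"
  by (simp add: psum_def)

lemma psum_0 [simp]: "psum 0 \<nu> = 0"
  by (simp add: psum_def)

lemma eq_if_psum_eq:
  assumes "\<And>i. i \<le> n \<Longrightarrow> psum i \<nu> = psum i \<mu>" and "j \<in> {1..n}"
  shows "lookup \<nu> j = lookup \<mu> j"
  using assms(1)[of j] assms(1)[of "j - 1"] assms(2) psum_Suc[of "j - 1" \<nu>] psum_Suc[of "j - 1" \<mu>]
  by auto

lemma psum_act_decreasing_le:
  assumes "decreasing n \<nu>" "p permutes {1..n}" "i \<le> n"
  shows "psum i (act p \<nu>) \<le> psum i \<nu>"
proof -
  have "psum i (act p \<nu>) = (\<Sum>j\<in>inv p ` {1..i}. lookup \<nu> j)"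
    unfolding psum_def using sum_act_permutes[OF assms(2), of "\<lambda>x. x"] by simp
  also have "\<dots> \<le> psum (card (inv p ` {1..i})) \<nu>"
    using assms permutes_image[OF permutes_inv[OF assms(2)]]
    by (intro sum_le_psum_decreasing) auto
  also have "card (inv p ` {1..i}) = i"
    using permutes_inj_on[OF permutes_inv[OF assms(2)]] by (simp add: card_image)
  finally show ?thesis .
qed

text \<open>The bound on partial sums, used for \<open>p\<close> and for its inverse, makes all
  partial sums agree.\<close>

lemma decreasing_rearrangement_unique:
  assumes dec: "decreasing n \<nu>" "decreasing n (act p \<nu>)" and p: "p permutes {1..n}"
  shows "act p \<nu> = \<nu>"
proof (rule poly_mapping_eqI)
  fix j
  have "psum i (act p \<nu>) = psum i \<nu>" if "i \<le> n" for i
  proof (rule antisym)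
    show "psum i (act p \<nu>) \<le> psum i \<nu>"
      by (rule psum_act_decreasing_le) (use assms that in auto)
    have "psum i (act (inv p) (act p \<nu>)) \<le> psum i (act p \<nu>)"
      by (rule psum_act_decreasing_le) (use assms that permutes_inv in auto)
    then show "psum i \<nu> \<le> psum i (act p \<nu>)"
      using act_permutes_inv[OF p refl] by simp
  qed
  then show "lookup (act p \<nu>) j = lookup \<nu> j"
  proof (cases "j \<in> {1..n}")
    case False
    then show ?thesis
      using p by (metis lookup_act_permutes permutes_inv permutes_not_in)
  qed (metis eq_if_psum_eq)
qed

text \<open>A rearrangement maximising the sum \<open>F\<close> with strictly decreasing weights is
  decreasing: exchanging an ascent would increase \<open>F\<close>.\<close>

lemma decreasing_rearrangement_exists:
  "\<exists>w. w permutes {1..n} \<and> decreasing n (act w \<mu>)"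
proof -
  define F where "F w = (\<Sum>k=1..n. (int n - int k) * lookup (act w \<mu>) k)" for w
  let ?S = "{w. w permutes {1..n}}"
  have "finite ?S" "?S \<noteq> {}"
    by (auto simp: finite_permutations intro: permutes_id)
  then obtain w where w: "w permutes {1..n}" and max: "F w = Max (F ` ?S)"
    using obtains_MAX by (metis mem_Collect_eq)
  have "decreasing n (act w \<mu>)"
    unfolding decreasing_def
  proof (intro allI impI, rule ccontr)
    fix i j :: nat
    let ?\<nu> = "act w \<mu>" and ?\<tau> = "transpose i j"
    assume ij: "1 \<le> i \<and> i \<le> j \<and> j \<le> n" and "\<not> lookup ?\<nu> j \<le> lookup ?\<nu> i"
    then have less: "lookup ?\<nu> i < lookup ?\<nu> j" "i < j"
      by (auto simp: le_less)
    have "?\<tau> \<circ> w permutes {1..n}"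
      using ij w by (auto intro!: permutes_compose permutes_swap_id)
    moreover have "F (?\<tau> \<circ> w) > F w"
    proof -
      let ?c = "\<lambda>k. int n - int k"
      have split: "(\<Sum>k=1..n. h k) = h i + h j + (\<Sum>k\<in>{1..n} - {i, j}. h k)" for h :: "nat \<Rightarrow> int"
      proof -
        have "{1..n} = insert i (insert j ({1..n} - {i, j}))"
          using ij by auto
        then have "(\<Sum>k=1..n. h k) = (\<Sum>k\<in>insert i (insert j ({1..n} - {i, j})). h k)"
          by simp
        then show ?thesis
          using less by simp
      qed
      have "F (?\<tau> \<circ> w) = (\<Sum>k=1..n. ?c k * lookup ?\<nu> (?\<tau> k))"
        by (simp add: F_def act_act[symmetric] lookup_act_transpose)
      also have "\<dots> = ?c i * lookup ?\<nu> j + ?c j * lookup ?\<nu> i + (\<Sum>k\<in>{1..n} - {i, j}. ?c k * lookup ?\<nu> k)"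
        unfolding split by (auto intro!: sum.cong)
      finally have "F (?\<tau> \<circ> w) - F w = (int j - int i) * (lookup ?\<nu> j - lookup ?\<nu> i)"
        unfolding F_def split by (simp add: algebra_simps)
      also have "\<dots> > 0"
        using less by simp
      finally show ?thesis by simp
    qed
    ultimately show False
      using max \<open>finite ?S\<close> by (metis Max_ge finite_imageI imageI linorder_not_le mem_Collect_eq)
  qed
  with w show ?thesis by blast
qed

lemma dec_rearr_eqI:
  assumes "w permutes {1..n}" "decreasing n (act w \<mu>)"
  shows "dec_rearr n \<mu> = act w \<mu>"
  unfolding dec_rearr_def
proof (rule the_equality)
  fix \<nu> assume "(\<exists>w. w permutes {1..n} \<and> \<nu> = act w \<mu>) \<and> decreasing n \<nu>"
  then obtain v where v: "v permutes {1..n}" "\<nu> = act v \<mu>" "decreasing n \<nu>"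
    by blast
  have "inv w permutes {1..n}"
    using assms permutes_inv by blast
  then have "v \<circ> inv w permutes {1..n}"
    using v permutes_compose by blast
  moreover have "act (v \<circ> inv w) (act w \<mu>) = \<nu>"
    using v act_permutes_inv[OF assms(1) refl, of \<mu>] by (simp add: act_act[symmetric])
  ultimately show "\<nu> = act w \<mu>"
    using decreasing_rearrangement_unique[of n "act w \<mu>" "v \<circ> inv w"] assms v by simp
qed (use assms in blast)

lemma dec_rearr:
  obtains w where "w permutes {1..n}" "dec_rearr n \<mu> = act w \<mu>" "decreasing n (dec_rearr n \<mu>)"
  using decreasing_rearrangement_exists dec_rearr_eqI by metis

lemma dec_rearr_act:
  assumes "p permutes {1..n}"
  shows "dec_rearr n (act p \<mu>) = dec_rearr n \<mu>"
proof -
  obtain w where w: "w permutes {1..n}" "dec_rearr n \<mu> = act w \<mu>" "decreasing n (dec_rearr n \<mu>)"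
    by (rule dec_rearr)
  have "act (w \<circ> inv p) (act p \<mu>) = act w \<mu>"
    using act_permutes_inv[OF assms refl, of \<mu>] by (simp add: act_act[symmetric])
  then show ?thesis
    using dec_rearr_eqI[of "w \<circ> inv p" n "act p \<mu>"] w assms permutes_inv permutes_compose by metis
qed

lemma dec_rearr_Zvec: "\<mu> \<in> Zvec n \<Longrightarrow> dec_rearr n \<mu> \<in> Zvec n"
  by (metis dec_rearr act_Zvec)

lemma psum_n_dec_rearr: "psum n (dec_rearr n \<mu>) = psum n \<mu>"
  unfolding psum_def using sum_act_permutes_all[where F = "\<lambda>x. x"] by (metis dec_rearr)

lemma sum_le_psum_dec_rearr:
  assumes "B \<subseteq> {1..n}"
  shows "(\<Sum>j\<in>B. lookup \<mu> j) \<le> psum (card B) (dec_rearr n \<mu>)"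
proof -
  obtain w where w: "w permutes {1..n}" "dec_rearr n \<mu> = act w \<mu>" "decreasing n (dec_rearr n \<mu>)"
    by (rule dec_rearr)
  have "(\<Sum>j\<in>w ` B. lookup (act w \<mu>) j) = (\<Sum>j\<in>B. lookup \<mu> j)"
    using sum_act_permutes[OF w(1), of "\<lambda>x. x" \<mu> "w ` B"] permutes_inverses[OF w(1)]
    by (simp add: image_image)
  moreover have "(\<Sum>j\<in>w ` B. lookup (act w \<mu>) j) \<le> psum (card (w ` B)) (act w \<mu>)"
    using assms w permutes_image[OF w(1)] by (intro sum_le_psum_decreasing) auto
  moreover have "card (w ` B) = card B"
    using permutes_inj_on[OF w(1)] by (simp add: card_image)
  ultimately show ?thesis
    using w by simp
qed

text \<open>With \<open>sum_le_psum_dec_rearr\<close> this says that the partial sums of the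
  rearrangement are the maximal sums over subsets of given size, so dominance can be tested without
  sorting.\<close>

lemma psum_dec_rearr_obtain:
  assumes "i \<le> n"
  obtains B where "B \<subseteq> {1..n}" "card B = i" "psum i (dec_rearr n \<mu>) = (\<Sum>j\<in>B. lookup \<mu> j)"
proof -
  obtain w where w: "w permutes {1..n}" "dec_rearr n \<mu> = act w \<mu>"
    by (rule dec_rearr)
  show ?thesis
  proof
    show "inv w ` {1..i} \<subseteq> {1..n}"
      using assms permutes_image[OF permutes_inv[OF w(1)]] by auto
    show "card (inv w ` {1..i}) = i"
      using permutes_inj_on[OF permutes_inv[OF w(1)]] by (simp add: card_image)
    show "psum i (dec_rearr n \<mu>) = (\<Sum>j\<in>inv w ` {1..i}. lookup \<mu> j)"
      using sum_act_permutes[OF w(1), of "\<lambda>x. x"] by (simp add: w psum_def)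
  qed
qed

section \<open>Bruhat order and minimal length representatives\<close>

text \<open>An inversion of the new permutation is mapped by the transposition if this preserves the
  order of the pair, and kept otherwise. This injects the new inversions into those of
  \<open>w\<close> and misses the pair \<open>(i, j)\<close>.\<close>

lemma perm_length_swap_less:
  assumes ij: "1 \<le> i" "i < j" "j \<le> n" and w: "w i > w j"
  shows "perm_length n (w \<circ> transpose i j) < perm_length n w"
proof -
  let ?\<tau> = "transpose i j" and ?w' = "w \<circ> transpose i j"
  define I where "I v = {(k, l). 1 \<le> k \<and> k < l \<and> l \<le> n \<and> v k > v l}" for v :: "nat \<Rightarrow> nat"
  define \<phi> where "\<phi> = (\<lambda>(k, l). if ?\<tau> k < ?\<tau> l then (?\<tau> k, ?\<tau> l) else (k, l))"
  have fin: "finite (I w)"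
    by (rule finite_subset[of _ "{1..n} \<times> {1..n}"]) (auto simp: I_def)
  have img: "\<phi> ` I ?w' \<subseteq> I w - {(i, j)}"
  proof
    fix p assume "p \<in> \<phi> ` I ?w'"
    then obtain k l where kl: "1 \<le> k" "k < l" "l \<le> n" "w (?\<tau> k) > w (?\<tau> l)" and p: "p = \<phi> (k, l)"
      by (auto simp: I_def)
    show "p \<in> I w - {(i, j)}"
    proof (cases "?\<tau> k < ?\<tau> l")
      case True
      then have "p = (?\<tau> k, ?\<tau> l)"
        by (simp add: p \<phi>_def)
      moreover have "1 \<le> ?\<tau> k" "?\<tau> l \<le> n"
        using kl ij by (auto simp: transpose_def)
      moreover have "(?\<tau> k, ?\<tau> l) \<noteq> (i, j)"
        using kl ij by (auto simp: transpose_def split: if_splits)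
      ultimately show ?thesis
        using True kl by (simp add: I_def)
    next
      case False
      then have p: "p = (k, l)"
        by (simp add: p \<phi>_def)
      have "(k, l) \<noteq> (i, j)"
        using kl w by auto
      moreover have "w k > w l"
        using False kl ij w by (auto simp: transpose_def split: if_splits)
      ultimately show ?thesis
        using kl by (auto simp: p I_def)
    qed
  qed
  have "inj_on \<phi> (I ?w')"
  proof (rule inj_onI)
    fix p p' assume p: "p \<in> I ?w'" "p' \<in> I ?w'" "\<phi> p = \<phi> p'"
    obtain k l k' l' where [simp]: "p = (k, l)" "p' = (k', l')"
      by (cases p; cases p')
    have "k < l" "k' < l'"
      using p by (auto simp: I_def)
    have inv: "?\<tau> x = y \<longleftrightarrow> x = ?\<tau> y" for x y
      by (metis transpose_involutory)
    show "p = p'"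
      using p(3) \<open>k < l\<close> \<open>k' < l'\<close>
      by (auto simp: \<phi>_def inv split: if_splits)
  qed
  then have "card (I ?w') = card (\<phi> ` I ?w')"
    by (simp add: card_image)
  also have "\<dots> \<le> card (I w - {(i, j)})"
    using fin img by (intro card_mono) auto
  also have "\<dots> < card (I w)"
    using fin ij w by (intro card_Diff1_less) (auto simp: I_def)
  finally show ?thesis
    by (simp add: perm_length_def I_def)
qed

lemma bruhat_less_swap:
  assumes "1 \<le> i" "i < j" "j \<le> n" "w i > w j"
  shows "bruhat_less n (w \<circ> transpose i j) w"
proof -
  have "w = w \<circ> transpose i j \<circ> transpose i j"
    by (simp add: comp_assoc)
  then have "bruhat_step n (w \<circ> transpose i j) w"
    unfolding bruhat_step_def using assms perm_length_swap_less[OF assms] by blast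
  then show ?thesis
    by (auto simp: bruhat_less_def)
qed

lemma bruhat_less_trans: "bruhat_less n u v \<Longrightarrow> bruhat_less n v w \<Longrightarrow> bruhat_less n u w"
  unfolding bruhat_less_def by (rule tranclp_trans)

lemma bruhat_less_length: "bruhat_less n u w \<Longrightarrow> perm_length n u < perm_length n w"
  unfolding bruhat_less_def by (induction rule: tranclp_induct) (auto simp: bruhat_step_def)

text \<open>Singles out one element in each left coset of the stabiliser of \<nu>, the one
  increasing on its level sets; by the next two lemmas it is the least element of the coset in
  Bruhat order.\<close>

definition block_increasing :: "nat \<Rightarrow> expo \<Rightarrow> (nat \<Rightarrow> nat) \<Rightarrow> bool" where
  "block_increasing n \<nu> w \<longleftrightarrow>
    (\<forall>i j. 1 \<le> i \<and> i < j \<and> j \<le> n \<and> lookup \<nu> i = lookup \<nu> j \<longrightarrow> w i < w j)"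

text \<open>\<open>v\<close> preserves the level sets of \<nu>. If \<open>i\<close> is the least
  point it moves and \<open>v m = i\<close>, then \<open>m\<close> and \<open>v i\<close> both
  exceed \<open>i\<close>, and \<open>w i < w m = w' i < w' (v i) = w i\<close> is absurd.\<close>

lemma block_increasing_unique:
  assumes w: "w permutes {1..n}" "block_increasing n \<nu> w"
    and w': "w' permutes {1..n}" "block_increasing n \<nu> w'"
    and eq: "act w \<nu> = act w' \<nu>"
  shows "w = w'"
proof -
  define v where "v = inv w' \<circ> w"
  have v: "v permutes {1..n}"
    unfolding v_def using w(1) w'(1) permutes_inv permutes_compose by blast
  have wv: "w' (v i) = w i" for i
    using permutes_inverses[OF w'(1)] by (simp add: v_def)
  have \<nu>v: "lookup \<nu> (v i) = lookup \<nu> i" for i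
    using lookup_act_permutes'[OF w'(1), of \<nu> "v i"] lookup_act_permutes'[OF w(1), of \<nu> i]
    by (simp add: wv eq)
  have "v i = i" for i
  proof (induction i rule: less_induct)
    case (less i)
    show ?case
    proof (cases "i \<in> {1..n}")
      case True
      show ?thesis
      proof (rule ccontr)
        assume "v i \<noteq> i"
        obtain m where m: "v m = i"
          using v by (metis permutes_surj surjD)
        have "m \<noteq> i"
          using m \<open>v i \<noteq> i\<close> by blast
        then have "i < m"
          using m less.IH[of m] by (metis linorder_neqE_nat)
        have "i < v i"
          using \<open>v i \<noteq> i\<close> less.IH[of "v i"] permutes_inj[OF v] by (metis injD linorder_neqE_nat)
        have "m \<in> {1..n}" "v i \<in> {1..n}"
          using True m permutes_in_image[OF v] by metis+
        then have "w i < w m" "w' i < w' (v i)"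
          using w(2) w'(2) True \<open>i < m\<close> \<open>i < v i\<close> \<nu>v[of m] \<nu>v[of i] m
          unfolding block_increasing_def by auto
        then show False
          using wv[of m] wv[of i] m by simp
      qed
    next
      case False
      then show ?thesis
        using v permutes_not_in by metis
    qed
  qed
  then show ?thesis
    using wv by (metis ext)
qed

text \<open>Removing an inversion between equal entries leaves the rearranged exponent unchanged and
  goes down in Bruhat order; the length bounds the descent.\<close>

lemma bruhat_block_increasing:
  assumes "w permutes {1..n}"
  shows "\<exists>v. v permutes {1..n} \<and> block_increasing n \<nu> v \<and> act v \<nu> = act w \<nu> \<and> (v = w \<or> bruhat_less n v w)"
  using assms
proof (induction "perm_length n w" arbitrary: w rule: less_induct)
  case less
  show ?case
  proof (cases "block_increasing n \<nu> w")
    case True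
    with less.prems show ?thesis by blast
  next
    case False
    then obtain i j where ij: "1 \<le> i" "i < j" "j \<le> n" "lookup \<nu> i = lookup \<nu> j" "\<not> w i < w j"
      by (auto simp: block_increasing_def)
    then have w: "w i > w j"
      using inj_eq[OF permutes_inj[OF less.prems], of i j] by linarith
    let ?w = "w \<circ> transpose i j"
    have "?w permutes {1..n}"
      using less.prems ij by (auto intro!: permutes_compose permutes_swap_id)
    from less.hyps[OF perm_length_swap_less[of i j n w] this] ij w obtain v where
      "v permutes {1..n}" "block_increasing n \<nu> v" "act v \<nu> = act ?w \<nu>" "v = ?w \<or> bruhat_less n v ?w"
      by blast
    moreover have "act ?w \<nu> = act w \<nu>"
    proof -
      have "act (transpose i j) \<nu> = \<nu>"
        by (rule poly_mapping_eqI) (use ij in \<open>auto simp: lookup_act_transpose transpose_def\<close>)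
      then show ?thesis
        by (simp add: act_act[symmetric])
    qed
    ultimately show ?thesis
      using bruhat_less_swap[of i j n w] ij w bruhat_less_trans by metis
  qed
qed

lemma zperm:
  shows zperm_permutes: "zperm n \<mu> permutes {1..n}"
    and act_zperm: "act (zperm n \<mu>) (dec_rearr n \<mu>) = \<mu>"
    and zperm_least: "w permutes {1..n} \<Longrightarrow> act w (dec_rearr n \<mu>) = \<mu> \<Longrightarrow> perm_length n (zperm n \<mu>) \<le> perm_length n w"
proof -
  let ?P = "\<lambda>w. w permutes {1..n} \<and> \<mu> = act w (dec_rearr n \<mu>)"
  obtain u where "u permutes {1..n}" "dec_rearr n \<mu> = act u \<mu>"
    by (rule dec_rearr)
  then have "?P (inv u)"
    using permutes_inv act_permutes_inv by metis
  from arg_min_nat_lemma[of ?P, OF this, of "perm_length n"]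
  have *: "?P (zperm n \<mu>)" "\<forall>y. ?P y \<longrightarrow> perm_length n (zperm n \<mu>) \<le> perm_length n y"
    unfolding zperm_def by blast+
  show "zperm n \<mu> permutes {1..n}" "act (zperm n \<mu>) (dec_rearr n \<mu>) = \<mu>"
    using *(1) by auto
  show "w permutes {1..n} \<Longrightarrow> act w (dec_rearr n \<mu>) = \<mu> \<Longrightarrow> perm_length n (zperm n \<mu>) \<le> perm_length n w"
    using *(2) by auto
qed

text \<open>Upgrades minimal length to least in Bruhat order: \<open>zperm\<close> and the element
  found below \<open>w\<close> are both the block increasing representative.\<close>

lemma zperm_bruhat:
  assumes "w permutes {1..n}" "act w (dec_rearr n \<mu>) = \<mu>"
  shows "zperm n \<mu> = w \<or> bruhat_less n (zperm n \<mu>) w"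
proof -
  let ?\<nu> = "dec_rearr n \<mu>"
  obtain z where z: "z permutes {1..n}" "block_increasing n ?\<nu> z" "act z ?\<nu> = \<mu>"
    "z = zperm n \<mu> \<or> bruhat_less n z (zperm n \<mu>)"
    using bruhat_block_increasing[OF zperm_permutes] act_zperm by metis
  then have "z = zperm n \<mu>"
    using zperm_least bruhat_less_length by (metis linorder_not_le)
  moreover obtain v where "v permutes {1..n}" "block_increasing n ?\<nu> v" "act v ?\<nu> = \<mu>" "v = w \<or> bruhat_less n v w"
    using bruhat_block_increasing[OF assms(1)] assms(2) by metis
  ultimately show ?thesis
    using block_increasing_unique z by metis
qed

section \<open>The order DBlex\<close>

text \<open>Swapping the values \<open>a\<close> and \<open>b\<close> of
  \<open>zperm n \<kappa>\<close> amounts to swapping two positions \<open>i < j\<close> that form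
  an inversion, hence goes down. The minimal permutation of the new exponent is at or below the
  result.\<close>

lemma DBlex_less_swap:
  assumes ab: "1 \<le> a" "a < b" "b \<le> n" and less: "lookup \<kappa> a < lookup \<kappa> b"
  shows "DBlex_less n (act (transpose a b) \<kappa>) \<kappa>"
proof -
  let ?\<tau> = "transpose a b" and ?z = "zperm n \<kappa>" and ?\<nu> = "dec_rearr n \<kappa>"
  have \<tau>: "?\<tau> permutes {1..n}"
    using ab by (intro permutes_swap_id) auto
  have dr: "dec_rearr n (act ?\<tau> \<kappa>) = ?\<nu>"
    by (rule dec_rearr_act[OF \<tau>])
  have z: "?z permutes {1..n}" "act ?z ?\<nu> = \<kappa>"
    by (rule zperm_permutes act_zperm)+
  define i j where "i = inv ?z b" "j = inv ?z a"
  have zij: "?z i = b" "?z j = a"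
    using permutes_inverses[OF z(1)] by (simp_all add: i_j_def)
  have ij: "i \<in> {1..n}" "j \<in> {1..n}"
    using permutes_in_image[OF z(1)] zij ab by (metis atLeastAtMost_iff le_trans less_imp_le)+
  have "lookup ?\<nu> j < lookup ?\<nu> i"
    using less lookup_act_permutes'[OF z(1), of ?\<nu>] z(2) zij by metis
  moreover have "decreasing n ?\<nu>"
    by (metis dec_rearr)
  ultimately have "i < j"
    using ij unfolding decreasing_def by (metis atLeastAtMost_iff linorder_not_le)
  have w: "?z \<circ> transpose i j = ?\<tau> \<circ> ?z"
  proof
    fix k
    have "?z k = b \<longleftrightarrow> k = i" "?z k = a \<longleftrightarrow> k = j"
      using zij permutes_inj[OF z(1)] by (metis injD)+
    then show "(?z \<circ> transpose i j) k = (?\<tau> \<circ> ?z) k"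
      using zij by (auto simp: transpose_def)
  qed
  have "bruhat_less n (?z \<circ> transpose i j) ?z"
    using ij \<open>i < j\<close> zij ab by (intro bruhat_less_swap) auto
  moreover have "zperm n (act ?\<tau> \<kappa>) = ?z \<circ> transpose i j \<or> bruhat_less n (zperm n (act ?\<tau> \<kappa>)) (?z \<circ> transpose i j)"
  proof (rule zperm_bruhat)
    show "?z \<circ> transpose i j permutes {1..n}"
      unfolding w using z \<tau> by (auto intro: permutes_compose)
    show "act (?z \<circ> transpose i j) (dec_rearr n (act ?\<tau> \<kappa>)) = act ?\<tau> \<kappa>"
      unfolding dr w using z by (simp add: act_act[symmetric])
  qed
  ultimately have "bruhat_less n (zperm n (act ?\<tau> \<kappa>)) ?z"
    using bruhat_less_trans by metis
  then show ?thesis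
    by (simp add: DBlex_less_def dr)
qed

text \<open>Two entries of fixed sum move strictly inside the interval they span. If
  \<open>B\<close> contains just one of \<open>a\<close>, \<open>b\<close>, its new value is at most
  the larger of the two old ones, so the sum over \<open>B\<close> is bounded by the old sum over
  \<open>B\<close> or over \<open>B\<close> with this element exchanged.\<close>

lemma DBlex_less_interior:
  assumes ab: "a \<in> {1..n}" "b \<in> {1..n}" "a \<noteq> b"
    and off: "\<And>j. j \<noteq> a \<Longrightarrow> j \<noteq> b \<Longrightarrow> lookup \<kappa>' j = lookup \<kappa> j"
    and tot: "lookup \<kappa>' a + lookup \<kappa>' b = lookup \<kappa> a + lookup \<kappa> b"
    and less: "lookup \<kappa> a < lookup \<kappa>' a" "lookup \<kappa>' a < lookup \<kappa> b"
  shows "DBlex_less n \<kappa>' \<kappa>"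
proof -
  have le: "(\<Sum>j\<in>B. lookup \<kappa>' j) \<le> psum (card B) (dec_rearr n \<kappa>)" if B: "B \<subseteq> {1..n}" for B
  proof -
    have finB: "finite B"
      using B finite_subset by auto
    have both: "(\<Sum>j\<in>C. lookup \<kappa>' j) = (\<Sum>j\<in>C. lookup \<kappa> j)" if "a \<notin> C" "b \<notin> C" for C
      using that by (intro sum.cong refl off) auto
    have one: ?thesis if xy: "x \<in> B" "y \<notin> B" "{x, y} = {a, b}" for x y
    proof -
      define C where "C = B - {x}"
      have C: "B = insert x C" "x \<notin> C" "y \<notin> C" "finite C"
        using xy finB by (auto simp: C_def)
      have "x \<in> {1..n}" "y \<in> {1..n}"
        using xy(3) ab by auto
      have "(\<Sum>j\<in>B. lookup \<kappa>' j) = lookup \<kappa>' x + (\<Sum>j\<in>C. lookup \<kappa> j)"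
      proof -
        have "a \<notin> C" "b \<notin> C"
          using C xy(3) by (auto simp: doubleton_eq_iff)
        then show ?thesis
          unfolding C(1) using C both by simp
      qed
      also have "\<dots> \<le> max (lookup \<kappa> x) (lookup \<kappa> y) + (\<Sum>j\<in>C. lookup \<kappa> j)"
        using xy(3) less tot by (auto simp: doubleton_eq_iff)
      also have "\<dots> = max (\<Sum>j\<in>insert x C. lookup \<kappa> j) (\<Sum>j\<in>insert y C. lookup \<kappa> j)"
        using C by (simp add: max_def)
      also have "\<dots> \<le> psum (card B) (dec_rearr n \<kappa>)"
      proof (rule max.boundedI)
        have "card (insert x C) = card B" "card (insert y C) = card B"
          using C by simp_all
        moreover have "insert x C \<subseteq> {1..n}" "insert y C \<subseteq> {1..n}"
          using \<open>y \<in> {1..n}\<close> B C by auto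
        ultimately show "(\<Sum>j\<in>insert x C. lookup \<kappa> j) \<le> psum (card B) (dec_rearr n \<kappa>)"
          "(\<Sum>j\<in>insert y C. lookup \<kappa> j) \<le> psum (card B) (dec_rearr n \<kappa>)"
          by (metis sum_le_psum_dec_rearr)+
      qed
      finally show ?thesis .
    qed
    consider "a \<in> B" "b \<in> B" | "a \<notin> B" "b \<notin> B" | "a \<in> B" "b \<notin> B" | "b \<in> B" "a \<notin> B"
      by blast
    then show ?thesis
    proof cases
      case 1
      define C where "C = B - {a, b}"
      have C: "B = insert a (insert b C)" "a \<notin> C" "b \<notin> C" "finite C"
        using 1 finB by (auto simp: C_def)
      have "(\<Sum>j\<in>B. lookup \<kappa>' j) = (\<Sum>j\<in>B. lookup \<kappa> j)"
        unfolding C(1) using C ab tot by (simp add: both)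
      then show ?thesis
        using sum_le_psum_dec_rearr[OF B, of \<kappa>] by simp
    next
      case 2
      then show ?thesis
        using both sum_le_psum_dec_rearr[OF B, of \<kappa>] by simp
    qed (use one in blast)+
  qed
  have "dom_le n (dec_rearr n \<kappa>') (dec_rearr n \<kappa>)"
    unfolding dom_le_def psum_def[symmetric]
  proof
    fix i assume "i \<in> {1..n}"
    then obtain B where "B \<subseteq> {1..n}" "card B = i" "psum i (dec_rearr n \<kappa>') = (\<Sum>j\<in>B. lookup \<kappa>' j)"
      using psum_dec_rearr_obtain[of i n \<kappa>'] by auto
    then show "psum i (dec_rearr n \<kappa>') \<le> psum i (dec_rearr n \<kappa>)"
      using le by metis
  qed
  moreover have "dec_rearr n \<kappa>' \<noteq> dec_rearr n \<kappa>"
  proof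
    \<comment> \<open>The sum of squares is invariant under rearrangement, but it drops here by
      twice the product that appears below.\<close>
    define sq where "sq \<nu> = (\<Sum>j=1..n. (lookup \<nu> j)\<^sup>2)" for \<nu> :: expo
    have sq: "sq (dec_rearr n \<nu>) = sq \<nu>" for \<nu>
      unfolding sq_def using sum_act_permutes_all[where F = "\<lambda>x. x\<^sup>2"] by (metis dec_rearr)
    assume "dec_rearr n \<kappa>' = dec_rearr n \<kappa>"
    then have "sq \<kappa>' = sq \<kappa>"
      using sq by metis
    define C where "C = {1..n} - {a, b}"
    have C: "{1..n} = insert a (insert b C)" "a \<notin> C" "b \<notin> C" "finite C"
      using ab by (auto simp: C_def)
    have "(\<Sum>j\<in>C. (lookup \<kappa>' j)\<^sup>2) = (\<Sum>j\<in>C. (lookup \<kappa> j)\<^sup>2)"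
      using C by (intro sum.cong refl arg_cong[of _ _ "\<lambda>x. x\<^sup>2"] off) auto
    then have "(lookup \<kappa>' a)\<^sup>2 + (lookup \<kappa>' b)\<^sup>2 = (lookup \<kappa> a)\<^sup>2 + (lookup \<kappa> b)\<^sup>2"
      using \<open>sq \<kappa>' = sq \<kappa>\<close> C ab unfolding sq_def C(1) by simp
    moreover have "lookup \<kappa>' b = lookup \<kappa> a + lookup \<kappa> b - lookup \<kappa>' a"
      using tot by simp
    ultimately have "(lookup \<kappa>' a - lookup \<kappa> a) * (lookup \<kappa> b - lookup \<kappa>' a) = 0"
      by (simp add: power2_eq_square algebra_simps)
    then show False
      using less by simp
  qed
  ultimately show ?thesis
    by (simp add: DBlex_less_def)
qed

lemma dom_le_trans: "dom_le n \<kappa> \<mu> \<Longrightarrow> dom_le n \<mu> \<nu> \<Longrightarrow> dom_le n \<kappa> \<nu>"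
  unfolding dom_le_def by (meson order_trans)

lemma dom_le_antisym:
  assumes "dom_le n \<kappa> \<mu>" "dom_le n \<mu> \<kappa>" "\<kappa> \<in> Zvec n" "\<mu> \<in> Zvec n"
  shows "\<kappa> = \<mu>"
proof (rule poly_mapping_eqI)
  fix j
  have "psum i \<kappa> = psum i \<mu>" if "i \<le> n" for i
    using assms(1,2) that unfolding dom_le_def psum_def[symmetric]
    by (cases "i = 0") (auto intro!: antisym)
  then show "lookup \<kappa> j = lookup \<mu> j"
    using assms(3,4) eq_if_psum_eq[of n \<kappa> \<mu> j] by (cases "j \<in> {1..n}") (auto simp: Zvec_iff)
qed

lemma DBlex_less_trans:
  assumes "DBlex_less n \<kappa> \<mu>" "DBlex_less n \<mu> \<nu>" "\<kappa> \<in> Zvec n" "\<mu> \<in> Zvec n" "\<nu> \<in> Zvec n"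
  shows "DBlex_less n \<kappa> \<nu>"
proof -
  let ?d = "dec_rearr n"
  consider "dom_le n (?d \<kappa>) (?d \<mu>)" "?d \<kappa> \<noteq> ?d \<mu>" "dom_le n (?d \<mu>) (?d \<nu>)"
    | "dom_le n (?d \<kappa>) (?d \<nu>)" "?d \<kappa> \<noteq> ?d \<nu>"
    | "?d \<kappa> = ?d \<nu>" "bruhat_less n (zperm n \<kappa>) (zperm n \<nu>)"
    using assms(1,2) bruhat_less_trans[of n "zperm n \<kappa>" "zperm n \<mu>" "zperm n \<nu>"]
    unfolding DBlex_less_def dom_le_def by (elim disjE conjE) auto
  then show ?thesis
  proof cases
    case 1
    then have "?d \<kappa> \<noteq> ?d \<nu>"
      using dom_le_antisym dec_rearr_Zvec assms(3,4) by metis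
    with 1 show ?thesis
      using dom_le_trans unfolding DBlex_less_def by blast
  qed (simp_all add: DBlex_less_def)
qed

lemma DBlex_less_irrefl: "\<not> DBlex_less n \<mu> \<mu>"
  using bruhat_less_length by (auto simp: DBlex_less_def)

text \<open>Subtracting \<open>1\<close> from all entries gives a smaller exponent in
  \<open>DBlex_less\<close>, so for \<open>n \<ge> 1\<close> that order is not well-founded; at
  fixed degree it is.\<close>

definition prec :: "nat \<Rightarrow> expo \<Rightarrow> expo \<Rightarrow> bool" where
  "prec n \<nu> \<mu> \<longleftrightarrow> \<nu> \<in> Zvec n \<and> \<mu> \<in> Zvec n \<and> DBlex_less n \<nu> \<mu> \<and> psum n \<nu> = psum n \<mu>"

lemma prec_trans: "prec n \<kappa> \<mu> \<Longrightarrow> prec n \<mu> \<nu> \<Longrightarrow> prec n \<kappa> \<nu>"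
  unfolding prec_def using DBlex_less_trans by metis

lemma prec_irrefl: "\<not> prec n \<mu> \<mu>"
  by (simp add: prec_def DBlex_less_irrefl)

text \<open>Sum of the partial sums of the decreasing rearrangement, normalised to be nonnegative; it is
  strictly monotone in the dominance order of a fixed degree.\<close>

definition dom_rank :: "nat \<Rightarrow> expo \<Rightarrow> int" where
  "dom_rank n \<nu> = (\<Sum>i=1..n. int n * psum i (dec_rearr n \<nu>) - int i * psum n \<nu>)"

text \<open>The mean of the first \<open>i\<close> entries is at least the overall mean, as one sees
  by comparing both parts with the entry at \<open>i\<close>. It makes \<open>dom_rank\<close>
  nonnegative.\<close>

lemma psum_decreasing_average:
  assumes dec: "decreasing n \<nu>" and i: "i \<in> {1..n}"
  shows "int i * psum n \<nu> \<le> int n * psum i \<nu>"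
proof -
  let ?c = "lookup \<nu> i"
  have "of_nat (card {1..i}) * ?c \<le> (\<Sum>j\<in>{1..i}. lookup \<nu> j)"
    using dec i unfolding decreasing_def by (intro sum_bounded_below) auto
  then have 1: "int i * ?c \<le> psum i \<nu>"
    by (simp add: psum_def)
  have "(\<Sum>j\<in>{Suc i..n}. lookup \<nu> j) \<le> of_nat (card {Suc i..n}) * ?c"
    using dec i unfolding decreasing_def by (intro sum_bounded_above) auto
  moreover have "psum n \<nu> = psum i \<nu> + (\<Sum>j\<in>{Suc i..n}. lookup \<nu> j)"
  proof -
    have "{1..n} = {1..i} \<union> {Suc i..n}"
      using i by auto
    then have "psum n \<nu> = (\<Sum>j\<in>{1..i} \<union> {Suc i..n}. lookup \<nu> j)"
      by (simp add: psum_def)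
    also have "\<dots> = psum i \<nu> + (\<Sum>j\<in>{Suc i..n}. lookup \<nu> j)"
      unfolding psum_def by (rule sum.union_disjoint) auto
    finally show ?thesis .
  qed
  ultimately have 2: "psum n \<nu> - psum i \<nu> \<le> int (n - i) * ?c"
    by simp
  have "int i * (psum n \<nu> - psum i \<nu>) \<le> int i * (int (n - i) * ?c)"
    using 2 by (rule mult_left_mono) simp
  also have "\<dots> = int (n - i) * (int i * ?c)"
    by simp
  also have "\<dots> \<le> int (n - i) * psum i \<nu>"
    using 1 by (rule mult_left_mono) simp
  finally show ?thesis
    using i by (simp add: of_nat_diff algebra_simps)
qed

lemma dom_rank_nonneg: "dom_rank n \<nu> \<ge> 0"
  unfolding dom_rank_def
proof (rule sum_nonneg)
  fix i assume "i \<in> {1..n}"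
  then show "0 \<le> int n * psum i (dec_rearr n \<nu>) - int i * psum n \<nu>"
    using psum_decreasing_average[of n "dec_rearr n \<nu>" i] dec_rearr[of n \<nu>]
    by (metis diff_ge_0_iff_ge psum_n_dec_rearr)
qed

lemma prec_measure:
  assumes "prec n \<nu> \<mu>"
  shows "dom_rank n \<nu> < dom_rank n \<mu> \<or>
    dom_rank n \<nu> = dom_rank n \<mu> \<and> perm_length n (zperm n \<nu>) < perm_length n (zperm n \<mu>)"
proof (cases "dec_rearr n \<nu> = dec_rearr n \<mu>")
  case True
  then show ?thesis
    using assms bruhat_less_length by (auto simp: prec_def DBlex_less_def dom_rank_def)
next
  case False
  then have dom: "dom_le n (dec_rearr n \<nu>) (dec_rearr n \<mu>)" and deg: "psum n \<nu> = psum n \<mu>"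
    and Z: "dec_rearr n \<nu> \<in> Zvec n" "dec_rearr n \<mu> \<in> Zvec n"
    using assms dec_rearr_Zvec by (auto simp: prec_def DBlex_less_def)
  have le: "psum i (dec_rearr n \<nu>) \<le> psum i (dec_rearr n \<mu>)" if "i \<in> {1..n}" for i
    using dom that unfolding dom_le_def psum_def[symmetric] by blast
  have "\<exists>i\<in>{1..n}. psum i (dec_rearr n \<nu>) < psum i (dec_rearr n \<mu>)"
  proof (rule ccontr)
    assume "\<not> ?thesis"
    then have "dom_le n (dec_rearr n \<mu>) (dec_rearr n \<nu>)"
      unfolding dom_le_def psum_def[symmetric] by force
    then show False
      using dom_le_antisym dom Z False by blast
  qed
  then obtain i where i: "i \<in> {1..n}" "psum i (dec_rearr n \<nu>) < psum i (dec_rearr n \<mu>)"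
    by blast
  have "dom_rank n \<nu> < dom_rank n \<mu>"
    unfolding dom_rank_def deg
  proof (rule sum_strict_mono_ex1)
    show "\<forall>x\<in>{1..n}. int n * psum x (dec_rearr n \<nu>) - int x * psum n \<mu> \<le> int n * psum x (dec_rearr n \<mu>) - int x * psum n \<mu>"
      using le by (simp add: mult_left_mono)
    show "\<exists>a\<in>{1..n}. int n * psum a (dec_rearr n \<nu>) - int a * psum n \<mu> < int n * psum a (dec_rearr n \<mu>) - int a * psum n \<mu>"
      using i by (intro bexI[of _ i]) auto
  qed simp
  then show ?thesis ..
qed

lemma wf_prec: "wf {(\<nu>, \<mu>). prec n \<nu> \<mu>}"
proof (rule wf_subset)
  show "wf (measures [\<lambda>\<nu>. nat (dom_rank n \<nu>), \<lambda>\<nu>. perm_length n (zperm n \<nu>)])"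
    by simp
  show "{(\<nu>, \<mu>). prec n \<nu> \<mu>} \<subseteq> measures [\<lambda>\<nu>. nat (dom_rank n \<nu>), \<lambda>\<nu>. perm_length n (zperm n \<nu>)]"
  proof (clarify, simp only: in_measures)
    fix \<nu> \<mu> assume "prec n \<nu> \<mu>"
    from prec_measure[OF this]
    show "nat (dom_rank n \<nu>) < nat (dom_rank n \<mu>) \<or> nat (dom_rank n \<nu>) = nat (dom_rank n \<mu>) \<and>
      (perm_length n (zperm n \<nu>) < perm_length n (zperm n \<mu>) \<or>
       perm_length n (zperm n \<nu>) = perm_length n (zperm n \<mu>) \<and> False)"
      using dom_rank_nonneg[of n \<nu>] by auto
  qed
qed

lemma finite_prec_maximal:
  assumes "finite S" "\<kappa> \<in> S"
  obtains \<nu> where "\<nu> \<in> S" "\<nu> = \<kappa> \<or> prec n \<kappa> \<nu>" "\<And>\<mu>. \<mu> \<in> S \<Longrightarrow> \<not> prec n \<nu> \<mu>"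
proof -
  let ?T = "{\<nu> \<in> S. \<nu> = \<kappa> \<or> prec n \<kappa> \<nu>}"
  have "\<exists>m\<in>?T. \<forall>x\<in>?T. x \<noteq> m \<longrightarrow> \<not> prec n m x"
  proof (rule Finite_Set.bex_max_element)
    show "finite ?T" "?T \<noteq> {}"
      using assms by auto
    show "asymp_on ?T (prec n)"
      by (rule asymp_onI) (use prec_trans prec_irrefl in blast)
    show "transp_on ?T (prec n)"
      by (rule transp_onI) (use prec_trans in blast)
  qed
  then obtain m where m: "m \<in> S" "m = \<kappa> \<or> prec n \<kappa> m" "\<And>x. x \<in> ?T \<Longrightarrow> x \<noteq> m \<Longrightarrow> \<not> prec n m x"
    by blast
  show ?thesis
  proof
    show "m \<in> S" "m = \<kappa> \<or> prec n \<kappa> m"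
      by (rule m)+
    fix \<mu> assume "\<mu> \<in> S"
    show "\<not> prec n m \<mu>"
    proof
      assume "prec n m \<mu>"
      then have "prec n \<kappa> \<mu>"
        using m(2) prec_trans by blast
      then show False
        using m(3)[of \<mu>] \<open>\<mu> \<in> S\<close> \<open>prec n m \<mu>\<close> prec_irrefl by blast
    qed
  qed
qed

text \<open>Exponents of pure powers of \<open>q\<close> have the form
  \<open>single 0 (int r)\<close> and have to keep this shape.\<close>

declare single_of_nat [simp del]

section \<open>The group ring acting on formal functions\<close>

type_synonym gring = "expo \<Rightarrow>\<^sub>0 tfield"

text \<open>Only \<open>g\<close> has finite support. Functions of unrestricted support cannot be
  multiplied with each other, but they form a module under this action
  (\<open>conv_mult\<close>).\<close>

definition conv :: "gring \<Rightarrow> (expo \<Rightarrow> tfield) \<Rightarrow> expo \<Rightarrow> tfield" where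
  "conv g X \<nu> = (\<Sum>\<beta>\<in>keys g. lookup g \<beta> * X (\<nu> - \<beta>))"

lemma conv_single: "conv (single \<beta> c) X \<nu> = c * X (\<nu> - \<beta>)"
  by (cases "c = 0") (simp_all add: conv_def)

lemma conv_add: "conv (g + h) X \<nu> = conv g X \<nu> + conv h X \<nu>"
  unfolding conv_def by (rule sum_keys_add[where \<phi> = "\<lambda>\<beta> a. a * X (\<nu> - \<beta>)"]) (simp add: distrib_right)

lemma conv_zero [simp]: "conv 0 X \<nu> = 0"
  by (simp add: conv_def)

lemma conv_one [simp]: "conv 1 X \<nu> = X \<nu>"
  using conv_single[of 0 1 X \<nu>] by simp

lemma conv_minus: "conv (g - h) X \<nu> = conv g X \<nu> - conv h X \<nu>"
  by (rule additive_minus[of "\<lambda>g. conv g X \<nu>"]) (rule conv_add)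

lemma conv_fun_add: "conv g (\<lambda>\<nu>. X \<nu> + Y \<nu>) \<nu> = conv g X \<nu> + conv g Y \<nu>"
  by (simp add: conv_def distrib_left sum.distrib)

lemma conv_fun_minus: "conv g (\<lambda>\<nu>. X \<nu> - Y \<nu>) \<nu> = conv g X \<nu> - conv g Y \<nu>"
  by (simp add: conv_def right_diff_distrib sum_subtractf)

lemma conv_shift: "conv g (\<lambda>\<nu>. X (\<nu> + \<beta>)) \<nu> = conv g X (\<nu> + \<beta>)"
  by (simp add: conv_def algebra_simps)

lemma conv_mult: "conv (g * h) X \<nu> = conv g (conv h X) \<nu>"
proof (induction g rule: poly_mapping_linear_induct)
  case (single k c)
  show ?case
  proof (induction h rule: poly_mapping_linear_induct)
    case (single l b)
    then show ?case
      by (simp add: mult_single conv_single algebra_simps)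
  qed (simp_all add: conv_add conv_single algebra_simps)
qed (simp_all add: conv_add algebra_simps)

definition delta :: "expo \<Rightarrow> tfield" where
  "delta \<nu> = (if \<nu> = 0 then 1 else 0)"

lemma conv_delta: "conv g delta \<nu> = lookup g \<nu>"
  by (induction g rule: poly_mapping_linear_induct)
    (auto simp: conv_add conv_single lookup_add lookup_single delta_def when_def)

definition push :: "(expo \<Rightarrow> expo) \<Rightarrow> gring \<Rightarrow> gring" where
  "push A g = (\<Sum>\<beta>\<in>keys g. single (A \<beta>) (lookup g \<beta>))"

lemma push_single: "push A (single \<beta> c) = single (A \<beta>) c"
  by (cases "c = 0") (simp_all add: push_def)

lemma push_add: "push A (g + h) = push A g + push A h"
  unfolding push_def by (rule sum_keys_add[where \<phi> = "\<lambda>\<beta> a. single (A \<beta>) a"]) (rule single_add)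

lemma push_zero [simp]: "push A 0 = 0"
  by (simp add: push_def)

lemma push_minus: "push A (g - h) = push A g - push A h"
  by (rule additive_minus) (rule push_add)

context
  fixes A :: "expo \<Rightarrow> expo"
  assumes A: "\<And>\<mu> \<nu>. A (\<mu> + \<nu>) = A \<mu> + A \<nu>"
begin

lemma push_mult: "push A (g * h) = push A g * push A h"
proof (induction g rule: poly_mapping_linear_induct)
  case (single k c)
  show ?case
  proof (induction h rule: poly_mapping_linear_induct)
    case (single l b)
    then show ?case
      by (simp add: mult_single push_single A)
  qed (simp_all add: push_add algebra_simps)
qed (simp_all add: push_add algebra_simps)

lemma push_one: "push A 1 = 1"
  using push_single[of A 0 1] additive_zero[OF A] by simp

lemma push_prod: "push A (prod f I) = (\<Prod>x\<in>I. push A (f x))"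
  by (induction I rule: infinite_finite_induct) (simp_all add: push_one push_mult)

lemma conv_push: "conv (push A g) X (A \<nu>) = conv g (\<lambda>\<nu>. X (A \<nu>)) \<nu>"
  by (induction g rule: poly_mapping_linear_induct)
    (simp_all add: push_add push_single conv_add conv_single additive_minus[OF A])

lemma lookup_push:
  assumes "inj A"
  shows "lookup (push A g) (A \<nu>) = lookup g \<nu>"
proof -
  have "A \<nu> = 0 \<longleftrightarrow> \<nu> = 0" for \<nu>
    using inj_eq[OF assms, of \<nu> 0] additive_zero[OF A] by simp
  then have "(\<lambda>\<nu>. delta (A \<nu>)) = delta"
    by (simp add: delta_def fun_eq_iff)
  then show ?thesis
    using conv_push[of g delta \<nu>] by (simp add: conv_delta)
qed

end

definition unipotent :: "expo set \<Rightarrow> gring \<Rightarrow> bool" where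
  "unipotent S g \<longleftrightarrow> keys (g - 1) \<subseteq> S"

lemma unipotent_one [simp]: "unipotent S 1"
  by (simp add: unipotent_def)

lemma unipotent_mult:
  assumes S: "\<And>\<beta> \<gamma>. \<beta> \<in> S \<Longrightarrow> \<gamma> \<in> S \<Longrightarrow> \<beta> + \<gamma> \<in> S" and g: "unipotent S g" and h: "unipotent S h"
  shows "unipotent S (g * h)"
proof -
  have *: "g * h - 1 = (g - 1) * (h - 1) + ((g - 1) + (h - 1))"
    by (simp add: algebra_simps)
  have "keys ((g - 1) * (h - 1)) \<subseteq> S"
    using keys_mult[of "g - 1" "h - 1"] g h S by (fastforce simp: unipotent_def)
  moreover have "keys ((g - 1) + (h - 1)) \<subseteq> S"
    using keys_add[of "g - 1" "h - 1"] g h unfolding unipotent_def by blast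
  ultimately show ?thesis
    using keys_add[of "(g - 1) * (h - 1)" "(g - 1) + (h - 1)"] unfolding unipotent_def * by blast
qed

lemma unipotent_prod:
  assumes "\<And>\<beta> \<gamma>. \<beta> \<in> S \<Longrightarrow> \<gamma> \<in> S \<Longrightarrow> \<beta> + \<gamma> \<in> S" and "\<And>x. x \<in> I \<Longrightarrow> unipotent S (f x)"
  shows "unipotent S (prod f I)"
  using assms(2) by (induction I rule: infinite_finite_induct) (auto intro: unipotent_mult[OF assms(1)])

lemma conv_unipotent: "conv g X \<nu> = X \<nu> + conv (g - 1) X \<nu>"
  by (simp add: conv_minus)

text \<open>A unipotent element acts injectively on functions whose support is bounded below in the
  grading \<open>h\<close>.\<close>

lemma conv_injective:
  fixes h :: "expo \<Rightarrow> int"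
  assumes h: "\<And>\<mu> \<nu>. h (\<mu> - \<nu>) = h \<mu> - h \<nu>" and bound: "\<And>\<nu>. X \<nu> \<noteq> 0 \<Longrightarrow> c \<le> h \<nu>"
    and *: "\<And>\<nu>. X \<nu> \<noteq> 0 \<Longrightarrow> \<exists>g. unipotent {\<beta>. h \<beta> > 0} g \<and> conv g X \<nu> = 0"
  shows "X \<nu> = 0"
proof (induction "nat (h \<nu> - c)" arbitrary: \<nu> rule: less_induct)
  case less
  show ?case
  proof (rule ccontr)
    assume nz: "X \<nu> \<noteq> 0"
    then obtain g where g: "keys (g - 1) \<subseteq> {\<beta>. h \<beta> > 0}" "conv g X \<nu> = 0"
      using * by (auto simp: unipotent_def)
    have "X (\<nu> - \<beta>) = 0" if "\<beta> \<in> keys (g - 1)" for \<beta>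
    proof (rule ccontr)
      assume *: "X (\<nu> - \<beta>) \<noteq> 0"
      have "h (\<nu> - \<beta>) < h \<nu>"
        using that g h by auto
      with bound[OF *] have "X (\<nu> - \<beta>) = 0"
        by (intro less) auto
      with * show False ..
    qed
    then have "conv (g - 1) X \<nu> = 0"
      by (simp add: conv_def)
    then show False
      using g conv_unipotent[of g X \<nu>] nz by simp
  qed
qed

section \<open>Truncations of the kernel\<close>

definition msum :: "nat \<Rightarrow> expo \<Rightarrow> int" where
  "msum l \<nu> = (\<Sum>i\<le>l. lookup \<nu> i)"

text \<open>The total degree in \<open>y_0, ..., y_{n-1}\<close>, that is, the power of
  \<open>h\<close> belonging to an exponent.\<close>

definition hdeg :: "nat \<Rightarrow> expo \<Rightarrow> int" where
  "hdeg n \<nu> = (\<Sum>l<n. msum l \<nu>)"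

lemma msum_add: "msum l (\<mu> + \<nu>) = msum l \<mu> + msum l \<nu>"
  and msum_minus: "msum l (\<mu> - \<nu>) = msum l \<mu> - msum l \<nu>"
  and msum_zero [simp]: "msum l 0 = 0"
  by (simp_all add: msum_def lookup_add lookup_minus sum.distrib sum_subtractf)

lemma hdeg_add: "hdeg n (\<mu> + \<nu>) = hdeg n \<mu> + hdeg n \<nu>"
  and hdeg_minus: "hdeg n (\<mu> - \<nu>) = hdeg n \<mu> - hdeg n \<nu>"
  and hdeg_zero [simp]: "hdeg n 0 = 0"
  by (simp_all add: hdeg_def msum_add msum_minus sum.distrib sum_subtractf)

lemma msum_single: "msum l (single i a) = (if i \<le> l then a else 0)"
proof (cases "i \<le> l")
  case True
  then have "msum l (single i a) = (\<Sum>j\<in>{i}. a)"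
    unfolding msum_def by (intro sum.mono_neutral_cong_right) (auto simp: lookup_single when_def)
  with True show ?thesis by simp
next
  case False
  then show ?thesis
    unfolding msum_def by (intro trans[OF sum.neutral]) (auto simp: lookup_single when_def)
qed

text \<open>Exponents with index \<open>0\<close> standing for \<open>q\<close>: \<open>rb i j r\<close> is that of \<open>q\<^sup>r x\<^sub>i x\<^sub>j\<^sup>-\<^sup>1\<close> and
  \<open>cb i j r\<close> that of \<open>q\<^sup>r q x\<^sub>i\<^sup>-\<^sup>1 x\<^sub>j\<close>; \<open>msum l\<close> is the exponent of \<open>y\<^sub>l\<close>.\<close>

definition rb :: "nat \<Rightarrow> nat \<Rightarrow> nat \<Rightarrow> expo" where
  "rb i j r = single i 1 - single j 1 + single 0 (int r)"

definition cb :: "nat \<Rightarrow> nat \<Rightarrow> nat \<Rightarrow> expo" where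
  "cb i j r = single j 1 - single i 1 + single 0 (int r + 1)"

definition pairs :: "nat \<Rightarrow> (nat \<times> nat) set" where
  "pairs n = {(i, j). 1 \<le> i \<and> i < j \<and> j \<le> n}"

lemma finite_pairs [simp]: "finite (pairs n)"
  by (rule finite_subset[of _ "{1..n} \<times> {1..n}"]) (auto simp: pairs_def)

lemma msum_rb: "i < j \<Longrightarrow> msum l (rb i j r) = (if i \<le> l \<and> l < j then 1 else 0) + int r"
  by (auto simp: rb_def msum_add msum_minus msum_single)

lemma msum_cb: "i < j \<Longrightarrow> msum l (cb i j r) = int r + 1 - (if i \<le> l \<and> l < j then 1 else 0)"
  by (auto simp: cb_def msum_add msum_minus msum_single)

lemma sum_indicator_interval:
  assumes "i < j" "j \<le> n"
  shows "(\<Sum>l<n. if i \<le> l \<and> l < j then 1 else 0 :: int) = int (j - i)"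
proof -
  have "(\<Sum>l<n. if i \<le> l \<and> l < j then 1 else 0 :: int) = (\<Sum>l\<in>{i..<j}. 1)"
    using assms by (intro sum.mono_neutral_cong_right) auto
  then show ?thesis by simp
qed

lemma hdeg_rb: "i < j \<Longrightarrow> j \<le> n \<Longrightarrow> hdeg n (rb i j r) = int (j - i + n * r)"
  by (simp add: hdeg_def msum_rb sum.distrib sum_indicator_interval)

lemma hdeg_cb: "i < j \<Longrightarrow> j \<le> n \<Longrightarrow> hdeg n (cb i j r) = int (n - (j - i) + n * r)"
  by (simp add: hdeg_def msum_cb sum.distrib sum_subtractf sum_indicator_interval of_nat_diff algebra_simps)

lemma hdeg_rb_nonneg: "i < j \<Longrightarrow> j \<le> n \<Longrightarrow> 0 \<le> hdeg n (rb i j r)"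
  and hdeg_cb_nonneg: "i < j \<Longrightarrow> j \<le> n \<Longrightarrow> 0 \<le> hdeg n (cb i j r)"
  by (simp_all only: hdeg_rb hdeg_cb of_nat_0_le_iff)

definition fac :: "tfield \<Rightarrow> expo \<Rightarrow> gring" where
  "fac c \<beta> = 1 - single \<beta> c"

text \<open>The numerator (\<open>c = 1\<close>) or denominator (\<open>c = t\<close>) of the kernel
  with finitely many factors. The cut-offs may vary with the pair, so that one extra factor can be
  taken for a simple root.\<close>

definition trunc :: "nat \<Rightarrow> tfield \<Rightarrow> (nat \<times> nat \<Rightarrow> nat) \<Rightarrow> (nat \<times> nat \<Rightarrow> nat) \<Rightarrow> gring" where
  "trunc n c a b = (\<Prod>(i, j)\<in>pairs n.
     (\<Prod>r<a (i, j). fac c (rb i j r)) * (\<Prod>r<b (i, j). fac c (cb i j r)))"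

lemma conv_fac: "conv (fac c \<beta>) X \<nu> = X \<nu> - c * X (\<nu> - \<beta>)"
  by (simp add: fac_def conv_minus conv_single)

lemma unipotent_fac: "\<beta> \<in> S \<Longrightarrow> unipotent S (fac c \<beta>)"
  using keys_uminus_eq[of "single \<beta> c"] by (auto simp: unipotent_def fac_def)

definition drop0 :: "expo \<Rightarrow> expo" where
  "drop0 \<nu> = \<nu> - single 0 (lookup \<nu> 0)"

definition gfac :: "nat \<Rightarrow> tfield \<Rightarrow> expo \<Rightarrow> graded_series" where
  "gfac n c \<beta> = 1 - gterm (fps_const c * fps_X ^ nat (lookup \<beta> 0)) (drop0 \<beta>) (nat (hdeg n \<beta>))"

definition gtrunc :: "nat \<Rightarrow> tfield \<Rightarrow> (nat \<times> nat \<Rightarrow> nat) \<Rightarrow> (nat \<times> nat \<Rightarrow> nat) \<Rightarrow> graded_series" where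
  "gtrunc n c a b = (\<Prod>(i, j)\<in>pairs n.
     (\<Prod>r<a (i, j). gfac n c (rb i j r)) * (\<Prod>r<b (i, j). gfac n c (cb i j r)))"

text \<open>The power of \<open>h\<close> is determined by the exponents, up to the offset \<open>s\<close>; offsets \<open>s \<noteq> 0\<close>
  serve to show that nothing else occurs in the kernel.\<close>

definition gcoeff :: "nat \<Rightarrow> int \<Rightarrow> graded_series \<Rightarrow> expo \<Rightarrow> tfield" where
  "gcoeff n s A \<nu> = (if lookup \<nu> 0 \<ge> 0 \<and> hdeg n \<nu> + s \<ge> 0
     then fps_nth (lookup (fps_nth A (nat (hdeg n \<nu> + s))) (drop0 \<nu>)) (nat (lookup \<nu> 0)) else 0)"

text \<open>Translates multiplication in the graded ring into the group ring action on coefficients.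
  Quantifying over \<open>A\<close> makes the notion closed under products.\<close>

definition represents :: "nat \<Rightarrow> gring \<Rightarrow> graded_series \<Rightarrow> bool" where
  "represents n g B \<longleftrightarrow> (\<forall>s A \<nu>. gcoeff n s (A * B) \<nu> = conv g (gcoeff n s A) \<nu>)"

lemma represents_1: "represents n 1 1"
  by (simp add: represents_def)

lemma represents_mult: "represents n g B \<Longrightarrow> represents n h C \<Longrightarrow> represents n (g * h) (B * C)"
  unfolding represents_def
  by (metis (no_types, lifting) conv_mult ext mult.assoc mult.commute)

lemma represents_prod:
  "(\<And>x. x \<in> I \<Longrightarrow> represents n (f x) (F x)) \<Longrightarrow> represents n (prod f I) (prod F I)"
  by (induction I rule: infinite_finite_induct) (auto intro: represents_1 represents_mult)

lemma gcoeff_gterm: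
  assumes "lookup \<beta> 0 \<ge> 0" "hdeg n \<beta> \<ge> 0"
  shows "gcoeff n s (A * gterm (fps_const c * fps_X ^ nat (lookup \<beta> 0)) (drop0 \<beta>) (nat (hdeg n \<beta>))) \<nu>
    = c * gcoeff n s A (\<nu> - \<beta>)"
proof -
  define k d where "k = nat (lookup \<beta> 0)" "d = nat (hdeg n \<beta>)"
  have kd: "lookup \<beta> 0 = int k" "hdeg n \<beta> = int d"
    using assms by (simp_all add: k_d_def)
  have drop: "drop0 (\<nu> - \<beta>) = drop0 \<nu> - drop0 \<beta>"
    by (simp add: drop0_def lookup_minus single_diff)
  have 1: "fps_nth (A * gterm C \<mu> d) e = (if e < d then 0 else fps_nth A (e - d) * single \<mu> C)" for C \<mu> e
    unfolding gterm_def mult.assoc[symmetric] fps_X_power_mult_right_nth by simp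
  have 2: "lookup (x * single \<mu> C) \<kappa> = C * lookup x (\<kappa> - \<mu>)" for x :: "expo \<Rightarrow>\<^sub>0 tfield fps" and \<mu> \<kappa> C
    by (metis lookup_single_mult mult.commute)
  have 3: "fps_nth (fps_const c * fps_X ^ k * z) m = (if m < k then 0 else c * fps_nth z (m - k))" for z m
    unfolding mult.assoc by (simp add: fps_X_power_mult_nth)
  show ?thesis
    unfolding gcoeff_def kd k_d_def(1)[symmetric] drop hdeg_minus lookup_minus
    by (simp add: k_d_def(1)[symmetric] k_d_def(2)[symmetric] kd 1 2 3 nat_diff_distrib' le_diff_conv not_less)
      (auto simp: 2 3 kd nat_diff_distrib algebra_simps)
qed

lemma gcoeff_minus: "gcoeff n s (A - B) \<nu> = gcoeff n s A \<nu> - gcoeff n s B \<nu>"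
  by (simp add: gcoeff_def lookup_minus)

lemma represents_gfac:
  assumes "lookup \<beta> 0 \<ge> 0" "hdeg n \<beta> \<ge> 0"
  shows "represents n (fac c \<beta>) (gfac n c \<beta>)"
  by (simp add: represents_def gfac_def right_diff_distrib gcoeff_minus gcoeff_gterm[OF assms] conv_fac)

lemma lookup_rb_0: "1 \<le> i \<Longrightarrow> i < j \<Longrightarrow> lookup (rb i j r) 0 = int r"
  and lookup_cb_0: "1 \<le> i \<Longrightarrow> i < j \<Longrightarrow> lookup (cb i j r) 0 = int r + 1"
  by (auto simp: rb_def cb_def lookup_add lookup_minus lookup_single when_def)

lemma represents_trunc: "represents n (trunc n c a b) (gtrunc n c a b)"
  unfolding trunc_def gtrunc_def
  by (intro represents_prod; clarsimp simp: pairs_def)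
    (intro represents_mult represents_prod represents_gfac; simp add: lookup_rb_0 lookup_cb_0 hdeg_rb_nonneg hdeg_cb_nonneg)

section \<open>Congruence modulo powers of h and the defining equation of the kernel\<close>

definition eqm :: "nat \<Rightarrow> 'a::comm_ring_1 fps \<Rightarrow> 'a fps \<Rightarrow> bool" where
  "eqm M A B \<longleftrightarrow> (\<forall>d<M. fps_nth A d = fps_nth B d)"

lemma eqm_refl [simp]: "eqm M A A"
  by (simp add: eqm_def)

lemma eqm_sym: "eqm M A B \<Longrightarrow> eqm M B A"
  by (simp add: eqm_def)

lemma eqm_trans: "eqm M A B \<Longrightarrow> eqm M B C \<Longrightarrow> eqm M A C"
  by (simp add: eqm_def)

lemma eqm_mult: "eqm M A B \<Longrightarrow> eqm M C D \<Longrightarrow> eqm M (A * C) (B * D)"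
  unfolding eqm_def fps_mult_nth by (auto intro!: sum.cong)

lemma eqm_prod: "(\<And>x. x \<in> I \<Longrightarrow> eqm M (f x) (g x)) \<Longrightarrow> eqm M (prod f I) (prod g I)"
  by (induction I rule: infinite_finite_induct) (auto intro: eqm_mult)

lemma gterm_mult: "gterm c \<nu> d * gterm c' \<nu>' d' = gterm (c * c') (\<nu> + \<nu>') (d + d')"
proof -
  have "gterm c \<nu> d * gterm c' \<nu>' d' = (fps_const (single \<nu> c) * fps_const (single \<nu>' c')) * (fps_X ^ d * fps_X ^ d')"
    unfolding gterm_def by (simp only: mult_ac)
  then show ?thesis
    by (simp add: gterm_def mult_single power_add)
qed

lemma gterm_one: "gterm 1 0 0 = 1"
  by (simp add: gterm_def)

lemma gq_power: "gq n ^ r = gterm (fps_X ^ r) 0 (n * r)"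
  by (induction r) (simp_all add: gq_def gterm_mult gterm_one algebra_simps)

lemma eqm_one_minus_gterm: "M \<le> d \<Longrightarrow> eqm M (1 - gterm c \<nu> d) 1"
  unfolding eqm_def gterm_def by (simp add: fps_X_power_mult_right_nth)

text \<open>The factor with index \<open>r\<close> is \<open>1\<close> modulo \<open>h^r\<close>, as
  \<open>n \<ge> 1\<close>. So the partial products stabilise in every degree, which also gives the
  existence of the limit.\<close>

lemma eqm_qpoch:
  assumes n: "n \<ge> 1" and d: "d \<ge> 1" and N: "M \<le> N"
  shows "eqm M (qpoch n (gterm c \<nu> d)) (\<Prod>r<N. 1 - gq n ^ r * gterm c \<nu> d)"
proof -
  define f where "f N = (\<Prod>r<N. 1 - gq n ^ r * gterm c \<nu> d)" for N
  have f: "eqm M (f N) (f M)" if "M \<le> N" for M N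
    using that
  proof (induction N rule: dec_induct)
    case (step N)
    have "N \<le> n * N"
      using n by simp
    then have "M \<le> n * N + d"
      using step by linarith
    then have "eqm M (1 - gq n ^ N * gterm c \<nu> d) 1"
      by (simp add: gq_power gterm_mult eqm_one_minus_gterm)
    from eqm_mult[OF step.IH this] show ?case
      by (simp add: f_def)
  qed simp
  define Q where "Q = Abs_fps (\<lambda>d. fps_nth (f (Suc d)) d)"
  have Q: "fps_nth (f N) e = fps_nth Q e" if "e < N" for N e
    using f[of "Suc e" N] that by (simp add: Q_def eqm_def)
  have "f \<longlonglongrightarrow> Q"
  proof (rule tendsto_fpsI)
    fix e
    show "eventually (\<lambda>N. fps_nth (f N) e = fps_nth Q e) sequentially"
      using eventually_gt_at_top[of e] by eventually_elim (rule Q)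
  qed
  then have "qpoch n (gterm c \<nu> d) = Q"
    unfolding qpoch_def f_def[symmetric] by (rule limI)
  then show ?thesis
    using Q N by (auto simp: eqm_def f_def)
qed

lemma gq_power_rb:
  assumes "1 \<le> i" "i < j" "j \<le> n"
  shows "1 - gq n ^ r * (gterm (fps_const c) 0 0 * gx_ratio i j) = gfac n c (rb i j r)"
proof -
  have "nat (hdeg n (rb i j r)) = n * r + (j - i)"
    using assms by (simp add: hdeg_rb add.commute del: of_nat_add of_nat_mult)
  moreover have "drop0 (rb i j r) = single i 1 - single j 1"
    using assms by (simp add: drop0_def lookup_rb_0) (simp add: rb_def)
  ultimately show ?thesis
    using assms by (simp add: gfac_def gx_ratio_def gq_power gterm_mult lookup_rb_0 mult.commute)
qed

lemma gq_power_cb: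
  assumes "1 \<le> i" "i < j" "j \<le> n"
  shows "1 - gq n ^ r * (gterm (fps_const c) 0 0 * gqx_ratio n i j) = gfac n c (cb i j r)"
proof -
  have "nat (hdeg n (cb i j r)) = n * r + (n - (j - i))"
    using assms by (simp add: hdeg_cb add.commute del: of_nat_add of_nat_mult of_nat_diff)
  moreover have "drop0 (cb i j r) = single j 1 - single i 1"
    using assms by (simp add: drop0_def lookup_cb_0) (simp add: cb_def)
  moreover have "nat (int r + 1) = Suc r"
    by simp
  ultimately show ?thesis
    using assms by (simp add: gfac_def gqx_ratio_def gq_power gterm_mult lookup_cb_0 mult_ac)
qed

definition gprod :: "nat \<Rightarrow> tfield \<Rightarrow> graded_series" where
  "gprod n c = (\<Prod>(i, j)\<in>pairs n. qpoch n (gterm (fps_const c) 0 0 * gx_ratio i j) *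
     qpoch n (gterm (fps_const c) 0 0 * gqx_ratio n i j))"

lemma eqm_gprod:
  assumes n: "n \<ge> 1" and ab: "\<And>p. M \<le> a p" "\<And>p. M \<le> b p"
  shows "eqm M (gprod n c) (gtrunc n c a b)"
  unfolding gprod_def gtrunc_def
proof (rule eqm_prod, clarify, rule eqm_mult)
  fix i j assume "(i, j) \<in> pairs n"
  then have ij: "1 \<le> i" "i < j" "j \<le> n"
    by (auto simp: pairs_def)
  have "eqm M (qpoch n (gterm (fps_const c) 0 0 * gx_ratio i j))
    (\<Prod>r<a (i, j). 1 - gq n ^ r * (gterm (fps_const c) 0 0 * gx_ratio i j))"
    unfolding gx_ratio_def gterm_mult by (rule eqm_qpoch) (use n ab ij in auto)
  then show "eqm M (qpoch n (gterm (fps_const c) 0 0 * gx_ratio i j)) (\<Prod>r<a (i, j). gfac n c (rb i j r))"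
    by (simp only: gq_power_rb[OF ij])
  have "eqm M (qpoch n (gterm (fps_const c) 0 0 * gqx_ratio n i j))
    (\<Prod>r<b (i, j). 1 - gq n ^ r * (gterm (fps_const c) 0 0 * gqx_ratio n i j))"
    unfolding gqx_ratio_def gterm_mult by (rule eqm_qpoch) (use n ab ij in auto)
  then show "eqm M (qpoch n (gterm (fps_const c) 0 0 * gqx_ratio n i j)) (\<Prod>r<b (i, j). gfac n c (cb i j r))"
    by (simp only: gq_power_cb[OF ij])
qed

abbreviation tt :: tfield where "tt \<equiv> thalf\<^sup>2"

text \<open>All factors of the denominator involve \<open>h\<close> to a positive power. It is thus
  \<open>1\<close> modulo \<open>h\<close> and invertible, and the quotient defining
  \<open>kernel\<close> exists and is unique.\<close>

lemma kernel_eq: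
  assumes n: "n \<ge> 1"
  shows "kernel n * gprod n tt = gprod n 1"
proof -
  have "eqm 1 (gprod n tt) (gtrunc n tt (\<lambda>_. 1) (\<lambda>_. 1))"
    by (rule eqm_gprod[OF n]) auto
  moreover have "eqm 1 (gtrunc n tt (\<lambda>_. 1) (\<lambda>_. 1)) (\<Prod>p\<in>pairs n. 1)"
    unfolding gtrunc_def
  proof (rule eqm_prod, clarify)
    fix i j assume "(i, j) \<in> pairs n"
    then have ij: "1 \<le> i" "i < j" "j \<le> n"
      by (auto simp: pairs_def)
    have "eqm 1 ((\<Prod>r<1. gfac n tt (rb i j r)) * (\<Prod>r<1. gfac n tt (cb i j r))) (1 * 1)"
      unfolding gfac_def lessThan_Suc One_nat_def using ij
      by (intro eqm_mult) (auto intro!: eqm_one_minus_gterm simp: hdeg_rb hdeg_cb)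
    then show "eqm 1 ((\<Prod>r<1. gfac n tt (rb i j r)) * (\<Prod>r<1. gfac n tt (cb i j r))) 1"
      by simp
  qed
  ultimately have "eqm 1 (gprod n tt) 1"
    using eqm_trans by fastforce
  then have "fps_nth (gprod n tt) 0 * 1 = 1"
    by (simp add: eqm_def)
  then have inv: "gprod n tt * fps_right_inverse (gprod n tt) 1 = 1"
    by (rule fps_right_inverse)
  let ?R = "fps_right_inverse (gprod n tt) 1"
  have 1: "(\<Prod>(i, j) | 1 \<le> i \<and> i < j \<and> j \<le> n. qpoch n (gtpar * gx_ratio i j) * qpoch n (gtpar * gqx_ratio n i j))
    = gprod n tt"
    by (simp add: gprod_def gtpar_def pairs_def)
  have 2: "(\<Prod>(i, j) | 1 \<le> i \<and> i < j \<and> j \<le> n. qpoch n (gx_ratio i j) * qpoch n (gqx_ratio n i j)) = gprod n 1"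
    by (simp add: gprod_def pairs_def gterm_one)
  show ?thesis
    unfolding kernel_def 1 2
  proof (rule theI)
    show "gprod n 1 * ?R * gprod n tt = gprod n 1"
      using inv by (simp add: mult.assoc mult.commute)
    fix J assume "J * gprod n tt = gprod n 1"
    then have "J * (gprod n tt * ?R) = gprod n 1 * ?R"
      by (simp add: mult.assoc[symmetric])
    then show "J = gprod n 1 * ?R"
      by (simp add: inv)
  qed
qed

lemma gcoeff_cong: "eqm M A B \<Longrightarrow> hdeg n \<nu> + s < int M \<Longrightarrow> gcoeff n s A \<nu> = gcoeff n s B \<nu>"
  by (auto simp: gcoeff_def eqm_def nat_less_iff)

lemma gcoeff_one: "gcoeff n s 1 \<nu> = (if s = 0 then delta \<nu> else 0)"
proof (cases "\<nu> = 0")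
  case True
  then show ?thesis
    by (auto simp: gcoeff_def delta_def drop0_def)
next
  case False
  have "fps_nth (lookup (fps_nth 1 (nat (hdeg n \<nu> + s))) (drop0 \<nu>)) (nat (lookup \<nu> 0)) = (0 :: tfield)"
    if "lookup \<nu> 0 \<ge> 0"
  proof (cases "drop0 \<nu> = 0")
    case True
    then have "\<nu> = single 0 (lookup \<nu> 0)"
      by (simp add: drop0_def)
    then have "lookup \<nu> 0 \<noteq> 0"
      using False by (metis single_zero)
    then show ?thesis
      using that by (auto simp: lookup_one when_def)
  qed (auto simp: lookup_one when_def)
  then have "gcoeff n s 1 \<nu> = 0"
    unfolding gcoeff_def by (metis (full_types))
  with False show ?thesis
    by (simp add: delta_def)
qed

text \<open>The equation \<open>kernel_eq\<close> read off below degree \<open>M\<close>, where full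
  products and truncations agree. The numerator has no coefficients at an offset
  \<open>s \<noteq> 0\<close>.\<close>

lemma conv_gcoeff_kernel:
  assumes n: "n \<ge> 1" and ab: "\<And>p. M \<le> a p" "\<And>p. M \<le> b p" and M: "hdeg n \<nu> + s < int M"
  shows "conv (trunc n tt a b) (gcoeff n s (kernel n)) \<nu> = (if s = 0 then lookup (trunc n 1 a b) \<nu> else 0)"
proof -
  have "conv (trunc n tt a b) (gcoeff n s (kernel n)) \<nu> = gcoeff n s (kernel n * gtrunc n tt a b) \<nu>"
    using represents_trunc[of n tt a b] by (simp add: represents_def)
  also have "\<dots> = gcoeff n s (kernel n * gprod n tt) \<nu>"
    using ab M by (intro gcoeff_cong[where M = M] eqm_mult eqm_sym[OF eqm_gprod[OF n]]) auto
  also have "\<dots> = gcoeff n s (1 * gtrunc n 1 a b) \<nu>"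
    unfolding kernel_eq[OF n] using ab M by (intro gcoeff_cong[where M = M]) (auto intro: eqm_gprod[OF n])
  also have "\<dots> = conv (trunc n 1 a b) (\<lambda>\<nu>. if s = 0 then delta \<nu> else 0) \<nu>"
  proof -
    have "gcoeff n s 1 = (\<lambda>\<nu>. if s = 0 then delta \<nu> else 0)"
      by (rule ext) (rule gcoeff_one)
    then show ?thesis
      using represents_trunc[of n 1 a b] unfolding represents_def by metis
  qed
  also have "\<dots> = (if s = 0 then lookup (trunc n 1 a b) \<nu> else 0)"
    by (cases "s = 0") (simp_all add: conv_delta, simp add: conv_def)
  finally show ?thesis .
qed

section \<open>Symmetries of the kernel\<close>

definition lat :: "nat \<Rightarrow> expo set" where
  "lat n = {\<nu>. (\<forall>i>n. lookup \<nu> i = 0) \<and> (\<Sum>i=1..n. lookup \<nu> i) = 0}"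

text \<open>On the lattice, \<open>msum l\<close> is the exponent of \<open>y_l\<close>, so these
  are the exponents of monomials in the \<open>y_l\<close>, the only ones that can occur in the
  kernel.\<close>

definition cone :: "nat \<Rightarrow> expo set" where
  "cone n = {\<nu> \<in> lat n. \<forall>l<n. msum l \<nu> \<ge> 0}"

lemma lat_add: "\<mu> \<in> lat n \<Longrightarrow> \<nu> \<in> lat n \<Longrightarrow> \<mu> + \<nu> \<in> lat n"
  by (simp add: lat_def lookup_add sum.distrib)

lemma cone_add: "\<mu> \<in> cone n \<Longrightarrow> \<nu> \<in> cone n \<Longrightarrow> \<mu> + \<nu> \<in> cone n"
  by (simp add: cone_def lat_add msum_add)

lemma zero_cone [simp]: "0 \<in> cone n"
  by (simp add: cone_def lat_def)

lemma sum_lookup_single_0: "(\<Sum>l=1..n. lookup (single 0 (a::int)) l) = 0" for n :: nat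
  by (rule sum.neutral) (auto simp: lookup_single when_def)

lemma rb_lat: "1 \<le> i \<Longrightarrow> i < j \<Longrightarrow> j \<le> n \<Longrightarrow> rb i j r \<in> lat n"
  and cb_lat: "1 \<le> i \<Longrightarrow> i < j \<Longrightarrow> j \<le> n \<Longrightarrow> cb i j r \<in> lat n"
  unfolding lat_def rb_def cb_def
  by (simp_all add: lookup_add lookup_minus sum.distrib sum_subtractf sum_lookup_single_0
      del: One_nat_def) (auto simp: lookup_single when_def)

lemma rb_cone: "1 \<le> i \<Longrightarrow> i < j \<Longrightarrow> j \<le> n \<Longrightarrow> rb i j r \<in> cone n"
  and cb_cone: "1 \<le> i \<Longrightarrow> i < j \<Longrightarrow> j \<le> n \<Longrightarrow> cb i j r \<in> cone n"
  by (simp_all add: cone_def rb_lat cb_lat msum_rb msum_cb)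

definition cone_pos :: "nat \<Rightarrow> expo set" where
  "cone_pos n = {\<nu> \<in> cone n. hdeg n \<nu> > 0}"

lemma cone_pos_add: "\<mu> \<in> cone_pos n \<Longrightarrow> \<nu> \<in> cone_pos n \<Longrightarrow> \<mu> + \<nu> \<in> cone_pos n"
  by (simp add: cone_pos_def cone_add hdeg_add)

lemma rb_cone_pos: "1 \<le> i \<Longrightarrow> i < j \<Longrightarrow> j \<le> n \<Longrightarrow> rb i j r \<in> cone_pos n"
  and cb_cone_pos: "1 \<le> i \<Longrightarrow> i < j \<Longrightarrow> j \<le> n \<Longrightarrow> cb i j r \<in> cone_pos n"
  by (simp_all only: cone_pos_def rb_cone cb_cone hdeg_rb hdeg_cb mem_Collect_eq of_nat_0_less_iff) simp_all

lemma unipotent_trunc: "unipotent (cone_pos n) (trunc n c a b)"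
  unfolding trunc_def
  by (intro unipotent_prod cone_pos_add; clarsimp simp: pairs_def)
    (intro unipotent_mult unipotent_prod unipotent_fac cone_pos_add rb_cone_pos cb_cone_pos; simp)

lemma unipotent_mono: "unipotent S g \<Longrightarrow> S \<subseteq> T \<Longrightarrow> unipotent T g"
  by (auto simp: unipotent_def)

lemma unipotent_trunc_hdeg: "unipotent {\<beta>. hdeg n \<beta> > 0} (trunc n c a b)"
  using unipotent_trunc by (rule unipotent_mono) (auto simp: cone_pos_def)

lemma lookup_trunc_not_cone: "\<nu> \<notin> cone n \<Longrightarrow> lookup (trunc n c a b) \<nu> = 0"
proof -
  assume \<nu>: "\<nu> \<notin> cone n"
  let ?g = "trunc n c a b"
  have "\<nu> \<notin> keys (?g - 1)"
    using unipotent_trunc[of n c a b] \<nu> by (auto simp: unipotent_def cone_pos_def)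
  moreover have "\<nu> \<noteq> 0"
    using \<nu> by auto
  ultimately show ?thesis
    by (auto simp: in_keys_iff lookup_minus lookup_one when_def)
qed

abbreviation jc :: "nat \<Rightarrow> expo \<Rightarrow> tfield" where
  "jc n \<equiv> gcoeff n 0 (kernel n)"

lemma gcoeff_bound: "gcoeff n s A \<nu> \<noteq> 0 \<Longrightarrow> - s \<le> hdeg n \<nu>"
  by (auto simp: gcoeff_def split: if_splits)

context
  fixes n :: nat
  assumes n: "n \<ge> 1"
begin

lemma conv_jc:
  assumes "\<And>p. M \<le> a p" "\<And>p. M \<le> b p" "hdeg n \<nu> < int M"
  shows "conv (trunc n tt a b) (jc n) \<nu> = lookup (trunc n 1 a b) \<nu>"
  using conv_gcoeff_kernel[OF n, of M a b \<nu> 0] assms by simp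

text \<open>At each exponent a long enough truncated denominator annihilates the misplaced
  coefficients, so they vanish by injectivity. The power of \<open>h\<close> is thus a function of
  the exponent, and setting \<open>h = 1\<close> merges nothing.\<close>

lemma gcoeff_kernel_offset:
  assumes s: "s \<noteq> 0"
  shows "gcoeff n s (kernel n) \<nu> = 0"
proof (rule conv_injective[where h = "hdeg n" and c = "- s"])
  show "hdeg n (\<mu> - \<nu>) = hdeg n \<mu> - hdeg n \<nu>" for \<mu> \<nu>
    by (rule hdeg_minus)
  show "- s \<le> hdeg n \<nu>" if "gcoeff n s (kernel n) \<nu> \<noteq> 0" for \<nu>
    using that by (rule gcoeff_bound)
  fix \<nu>
  let ?M = "\<lambda>_. nat (hdeg n \<nu> + s) + 1"
  have "conv (trunc n tt ?M ?M) (gcoeff n s (kernel n)) \<nu> = 0"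
    using conv_gcoeff_kernel[OF n, of "nat (hdeg n \<nu> + s) + 1" ?M ?M \<nu> s] s by simp
  then show "\<exists>g. unipotent {\<beta>. hdeg n \<beta> > 0} g \<and> conv g (gcoeff n s (kernel n)) \<nu> = 0"
    using unipotent_trunc_hdeg by blast
qed

text \<open>\<open>X\<close> is the part of the kernel outside the cone. Truncations are supported
  in the cone, which is closed under addition, so outside it they act on \<open>X\<close> as on the
  kernel and give zero there.\<close>

lemma jc_not_cone:
  assumes "\<nu> \<notin> cone n"
  shows "jc n \<nu> = 0"
proof -
  define X where "X \<nu> = (if \<nu> \<in> cone n then 0 else jc n \<nu>)" for \<nu>
  have "X \<nu> = 0"
  proof (rule conv_injective[where h = "hdeg n" and c = 0])
    show "hdeg n (\<mu> - \<nu>) = hdeg n \<mu> - hdeg n \<nu>" for \<mu> \<nu>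
      by (rule hdeg_minus)
    show "0 \<le> hdeg n \<nu>" if "X \<nu> \<noteq> 0" for \<nu>
      using that gcoeff_bound[of n 0] by (auto simp: X_def split: if_splits)
    fix \<nu> assume "X \<nu> \<noteq> 0"
    then have \<nu>: "\<nu> \<notin> cone n"
      by (auto simp: X_def)
    let ?M = "\<lambda>_. nat (hdeg n \<nu>) + 1"
    let ?g = "trunc n tt ?M ?M"
    have "X (\<nu> - \<beta>) = jc n (\<nu> - \<beta>)" if "\<beta> \<in> keys ?g" for \<beta>
    proof -
      have "\<beta> \<in> cone n"
        using that lookup_trunc_not_cone by (metis in_keys_iff)
      then have "\<nu> - \<beta> \<notin> cone n"
        using cone_add[of "\<nu> - \<beta>" n \<beta>] \<nu> by auto
      then show ?thesis
        by (simp add: X_def)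
    qed
    then have "conv ?g X \<nu> = conv ?g (jc n) \<nu>"
      by (simp add: conv_def)
    also have "\<dots> = 0"
      using \<nu> by (subst conv_jc[of "nat (hdeg n \<nu>) + 1"]) (auto simp: lookup_trunc_not_cone)
    finally show "\<exists>g. unipotent {\<beta>. hdeg n \<beta> > 0} g \<and> conv g X \<nu> = 0"
      using unipotent_trunc_hdeg by blast
  qed
  then show ?thesis
    using assms by (simp add: X_def)
qed

lemma jc_zero: "jc n 0 = 1"
proof -
  let ?g = "\<lambda>c. trunc n c (\<lambda>_. 1) (\<lambda>_. 1)"
  have "keys (?g c - 1) \<subseteq> {\<beta>. hdeg n \<beta> > 0}" for c
    using unipotent_trunc_hdeg by (simp add: unipotent_def)
  then have *: "\<beta> \<in> keys (?g c - 1) \<Longrightarrow> hdeg n \<beta> > 0" for c \<beta>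
    by blast
  have "jc n (0 - \<beta>) = 0" if "\<beta> \<in> keys (?g tt - 1)" for \<beta>
    using *[OF that] by (auto simp: gcoeff_def hdeg_minus[of n 0, simplified])
  then have "conv (?g tt - 1) (jc n) 0 = 0"
    by (simp add: conv_def)
  then have "conv (?g tt) (jc n) 0 = jc n 0"
    using conv_unipotent[of "?g tt" "jc n" 0] by simp
  moreover have "conv (?g tt) (jc n) 0 = lookup (?g 1) 0"
    by (rule conv_jc[of 1]) auto
  moreover have "lookup (?g 1 - 1) 0 = 0"
    using *[of 0 1] by (metis hdeg_zero in_keys_iff less_irrefl)
  then have "lookup (?g 1) 0 = 1"
    by (simp add: lookup_minus)
  ultimately show ?thesis
    by simp
qed

text \<open>The substitution \<open>x\<^sub>i \<mapsto> x\<^bsub>i+1\<^esub>\<close>, \<open>x\<^sub>n \<mapsto> q\<^sup>-\<^sup>1 x\<^sub>1\<close> on exponents; it rotates \<open>y\<^sub>0, \<dots>, y\<^bsub>n-1\<^esub>\<close>.\<close>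

definition pihat :: "expo \<Rightarrow> expo" where
  "pihat \<nu> = act (rot n) \<nu> - single 0 (lookup \<nu> n)"

lemma pihat_add: "pihat (\<mu> + \<nu>) = pihat \<mu> + pihat \<nu>"
  by (simp add: pihat_def act_add lookup_add single_add)

lemma lookup_act_rot: "lookup (act (rot n) \<nu>) j = lookup \<nu> (irot n j)"
  by (simp add: lookup_act bij_rot[OF n] inv_rot[OF n])

lemma lookup_pihat: "lookup (pihat \<nu>) j = lookup \<nu> (irot n j) - (if j = 0 then lookup \<nu> n else 0)"
  by (simp add: pihat_def lookup_minus lookup_act_rot lookup_single when_def)

lemma irot_simps: "irot n 0 = 0" "irot n 1 = n" "1 \<le> i \<Longrightarrow> i < n \<Longrightarrow> irot n (Suc i) = i" "i > n \<Longrightarrow> irot n i = i"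
  using n by (auto simp: irot_def)

lemma inj_pihat: "inj pihat"
proof (rule injI)
  fix \<mu> \<nu> assume "pihat \<mu> = pihat \<nu>"
  then have *: "lookup \<mu> (irot n j) - (if j = 0 then lookup \<mu> n else 0) =
    lookup \<nu> (irot n j) - (if j = 0 then lookup \<nu> n else 0)" for j
    by (metis lookup_pihat)
  have "lookup \<mu> n = lookup \<nu> n"
    using *[of 1] irot_simps(2) by simp
  then have "lookup \<mu> (irot n j) = lookup \<nu> (irot n j)" for j
    using *[of j] by (simp split: if_splits)
  then show "\<mu> = \<nu>"
    by (metis irot_rot[OF n] poly_mapping_eqI)
qed

lemma msum_eq: "msum l \<nu> = lookup \<nu> 0 + (\<Sum>i=1..l. lookup \<nu> i)"
  by (simp add: msum_def atMost_atLeast0 sum.atLeast_Suc_atMost)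

lemma sum_pihat: "l < n \<Longrightarrow> (\<Sum>i=1..Suc l. lookup (pihat \<nu>) i) = lookup \<nu> n + (\<Sum>i=1..l. lookup \<nu> i)"
proof (induction l)
  case 0
  then show ?case
    using irot_simps(2) by (simp add: lookup_pihat)
next
  case (Suc l)
  have "lookup (pihat \<nu>) (Suc (Suc l)) = lookup \<nu> (Suc l)"
    using irot_simps(3)[of "Suc l"] Suc.prems by (simp add: lookup_pihat)
  then show ?case
    using Suc by simp
qed

lemma pihat_lat: "pihat \<nu> \<in> lat n \<longleftrightarrow> \<nu> \<in> lat n"
proof -
  obtain m where m: "n = Suc m"
    using n by (cases n) auto
  have "(\<Sum>i=1..n. lookup (pihat \<nu>) i) = (\<Sum>i=1..n. lookup \<nu> i)"
    using sum_pihat[of m \<nu>] by (simp add: m)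
  moreover have "lookup (pihat \<nu>) i = lookup \<nu> i" if "i > n" for i
    using that irot_simps(4) by (simp add: lookup_pihat)
  ultimately show ?thesis
    by (simp add: lat_def)
qed

lemma msum_pihat: "l < n \<Longrightarrow> msum l (pihat \<nu>) = (if l = 0 then msum 0 \<nu> - lookup \<nu> n else msum (l - 1) \<nu>)"
proof (cases l)
  case 0
  then show ?thesis
    by (simp add: msum_def lookup_pihat irot_simps)
next
  case (Suc k)
  assume "l < n"
  with Suc show ?thesis
    using sum_pihat[of k \<nu>] by (simp add: msum_eq lookup_pihat irot_simps)
qed

text \<open>On the lattice the exponents of the \<open>y_l\<close> are permuted cyclically; total
  degree zero is what identifies the last of them with the new first one.\<close>

lemma hdeg_pihat:
  assumes "\<nu> \<in> lat n"
  shows "hdeg n (pihat \<nu>) = hdeg n \<nu>"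
proof -
  obtain m where m: "n = Suc m"
    using n by (cases n) auto
  have "(\<Sum>i=1..n. lookup \<nu> i) = 0"
    using assms by (simp add: lat_def)
  then have "msum m \<nu> = lookup \<nu> 0 - lookup \<nu> n"
    by (simp add: msum_eq m)
  moreover have "msum (Suc l) (pihat \<nu>) = msum l \<nu>" if "l < m" for l
    using msum_pihat[of "Suc l" \<nu>] that m by simp
  then have "(\<Sum>l<m. msum (Suc l) (pihat \<nu>)) = (\<Sum>l<m. msum l \<nu>)"
    by (intro sum.cong) auto
  moreover have "msum 0 (pihat \<nu>) = lookup \<nu> 0 - lookup \<nu> n"
    using n by (subst msum_pihat) (simp_all add: msum_def)
  moreover have "hdeg n (pihat \<nu>) = msum 0 (pihat \<nu>) + (\<Sum>l<m. msum (Suc l) (pihat \<nu>))"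
    unfolding hdeg_def by (rule sum.lessThan_Suc_shift[of "\<lambda>l. msum l (pihat \<nu>)" m, folded m])
  moreover have "hdeg n \<nu> = (\<Sum>l<m. msum l \<nu>) + msum m \<nu>"
    by (simp add: hdeg_def m)
  ultimately show ?thesis
    by simp
qed

text \<open>The pairs are permuted by \<theta>. A pair \<open>(i, n)\<close> wraps around to
  \<open>(1, i + 1)\<close>, and there the families \<open>rb\<close> and \<open>cb\<close> exchange
  roles, which is harmless because all cut-offs are equal.\<close>

lemma push_pihat_trunc: "push pihat (trunc n c (\<lambda>_. M) (\<lambda>_. M)) = trunc n c (\<lambda>_. M) (\<lambda>_. M)"
proof -
  define F where "F = (\<lambda>(i, j). (\<Prod>r<M. fac c (rb i j r)) * (\<Prod>r<M. fac c (cb i j r)))"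
  define \<theta> where "\<theta> = (\<lambda>(i, j). if j < n then (Suc i, Suc j) else (1, Suc i))"
  define \<theta>' where "\<theta>' = (\<lambda>(k, l). if k = 1 then (l - 1, n) else (k - 1, l - 1))"
  have fac: "push pihat (fac c \<beta>) = fac c (pihat \<beta>)" for \<beta>
    by (simp add: fac_def push_minus push_one[OF pihat_add] push_single)
  have rot: "rot n i = Suc i" if "1 \<le> i" "i < n" for i
    using that by (simp add: rot_def)
  have pi: "pihat (single i 1 - single j 1 + single 0 k) =
      single (rot n i) 1 - single (rot n j) 1 + single 0 (k - (if i = n then 1 else 0) + (if j = n then 1 else 0))"
    if "1 \<le> i" "1 \<le> j" for i j k
  proof -
    have "rot n 0 = 0"
      using n by (simp add: rot_def)
    then have "act (rot n) (single i 1 - single j 1 + single 0 k) = single (rot n i) 1 - single (rot n j) 1 + single 0 k"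
      by (simp add: act_add act_minus)
    moreover have "lookup (single i 1 - single j 1 + single 0 k) n = (if i = n then 1 else 0) - (if j = n then 1 else 0)"
      using n by (simp add: lookup_add lookup_minus lookup_single when_def)
    ultimately show ?thesis
      unfolding pihat_def by (simp only:) (cases "i = n"; cases "j = n"; simp add: single_add single_diff single_uminus)
  qed
  have step: "push pihat (F p) = F (\<theta> p)" if p: "p \<in> pairs n" for p
  proof -
    obtain i j where [simp]: "p = (i, j)" and ij: "1 \<le> i" "i < j" "j \<le> n"
      using p by (auto simp: pairs_def)
    show ?thesis
    proof (cases "j < n")
      case True
      then have "pihat (rb i j r) = rb (Suc i) (Suc j) r" "pihat (cb i j r) = cb (Suc i) (Suc j) r" for r
        using ij unfolding rb_def cb_def by (subst pi; simp add: rot)+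
      with True show ?thesis
        by (simp add: F_def \<theta>_def push_mult[OF pihat_add] push_prod[OF pihat_add] fac)
    next
      case False
      then have j: "j = n" using ij by simp
      have "rot n n = 1"
        by (simp add: rot_def)
      then have "pihat (rb i j r) = cb 1 (Suc i) r" "pihat (cb i j r) = rb 1 (Suc i) r" for r
        using ij unfolding rb_def cb_def j by (subst pi; simp add: rot add.commute)+
      with False show ?thesis
        by (simp add: F_def \<theta>_def push_mult[OF pihat_add] push_prod[OF pihat_add] fac mult.commute)
    qed
  qed
  have "push pihat (\<Prod>p\<in>pairs n. F p) = (\<Prod>p\<in>pairs n. F (\<theta> p))"
    by (simp add: push_prod[OF pihat_add] step)
  also have "\<dots> = (\<Prod>p\<in>pairs n. F p)"
    by (rule prod.reindex_bij_witness[where i = \<theta>' and j = \<theta>])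
      (auto simp: pairs_def \<theta>_def \<theta>'_def split: if_splits)
  finally show ?thesis
    by (simp add: trunc_def F_def case_prod_unfold)
qed

text \<open>The kernel and its rotation satisfy the same truncated equations, so their difference is
  annihilated by unipotent elements. Off the lattice both vanish; on it \<open>hdeg\<close> is
  invariant.\<close>

lemma jc_pihat: "jc n (pihat \<nu>) = jc n \<nu>"
proof -
  define X where "X \<nu> = jc n (pihat \<nu>) - jc n \<nu>" for \<nu>
  have X: "\<nu> \<in> lat n" if "X \<nu> \<noteq> 0" for \<nu>
    using that jc_not_cone pihat_lat[of \<nu>] by (auto simp: X_def cone_def)
  have "X \<nu> = 0"
  proof (rule conv_injective[where h = "hdeg n" and c = 0])
    show "hdeg n (\<mu> - \<nu>) = hdeg n \<mu> - hdeg n \<nu>" for \<mu> \<nu>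
      by (rule hdeg_minus)
    show "0 \<le> hdeg n \<nu>" if "X \<nu> \<noteq> 0" for \<nu>
    proof -
      have "jc n (pihat \<nu>) \<noteq> 0 \<or> jc n \<nu> \<noteq> 0"
        using that by (auto simp: X_def)
      then show ?thesis
        using gcoeff_bound[of n 0] hdeg_pihat[OF X[OF that]] by fastforce
    qed
    fix \<nu> assume "X \<nu> \<noteq> 0"
    note \<nu> = X[OF this]
    define M where "M = nat (hdeg n \<nu>) + 1"
    let ?g = "\<lambda>c. trunc n c (\<lambda>_. M) (\<lambda>_. M)"
    have "conv (?g tt) X \<nu> = conv (?g tt) (\<lambda>\<nu>. jc n (pihat \<nu>)) \<nu> - conv (?g tt) (jc n) \<nu>"
      unfolding X_def by (rule conv_fun_minus)
    also have "conv (?g tt) (\<lambda>\<nu>. jc n (pihat \<nu>)) \<nu> = conv (?g tt) (jc n) (pihat \<nu>)"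
      using conv_push[OF pihat_add, of "?g tt" "jc n" \<nu>] by (simp add: push_pihat_trunc)
    also have "\<dots> = lookup (?g 1) (pihat \<nu>)"
      by (rule conv_jc[of M]) (simp_all add: M_def hdeg_pihat[OF \<nu>])
    also have "\<dots> = lookup (?g 1) \<nu>"
      using lookup_push[OF pihat_add inj_pihat, of "?g 1" \<nu>] by (simp add: push_pihat_trunc)
    also have "conv (?g tt) (jc n) \<nu> = lookup (?g 1) \<nu>"
      by (rule conv_jc[of M]) (simp_all add: M_def)
    finally have "conv (?g tt) X \<nu> = 0"
      by simp
    then show "\<exists>g. unipotent {\<beta>. hdeg n \<beta> > 0} g \<and> conv g X \<nu> = 0"
      using unipotent_trunc_hdeg by blast
  qed
  then show ?thesis
    by (simp add: X_def)
qed

text \<open>The degree in all \<open>y\<^sub>l\<close> except \<open>y\<^sub>i\<close>; unlike \<open>hdeg\<close> it is invariant under \<open>s\<^sub>i\<close>.\<close>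

definition edeg :: "nat \<Rightarrow> expo \<Rightarrow> int" where
  "edeg i \<nu> = (\<Sum>l\<in>{..<n} - {i}. msum l \<nu>)"

lemma edeg_add: "edeg i (\<mu> + \<nu>) = edeg i \<mu> + edeg i \<nu>"
  and edeg_minus: "edeg i (\<mu> - \<nu>) = edeg i \<mu> - edeg i \<nu>"
  by (simp_all add: edeg_def msum_add msum_minus sum.distrib sum_subtractf)

lemma msum_act_sw:
  assumes "1 \<le> i" "l \<noteq> i"
  shows "msum l (act (sw i) \<nu>) = msum l \<nu>"
proof -
  have "msum l (act (sw i) \<nu>) = (\<Sum>k\<in>{..l}. lookup \<nu> (sw i k))"
    by (simp add: msum_def lookup_act_transpose)
  also have "\<dots> = (\<Sum>k\<in>{..l}. lookup \<nu> k)"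
    using assms by (intro sum.reindex_bij_witness[where i = "sw i" and j = "sw i"])
      (auto simp: transpose_def split: if_splits)
  finally show ?thesis
    by (simp add: msum_def)
qed

lemma edeg_act_sw: "1 \<le> i \<Longrightarrow> edeg i (act (sw i) \<nu>) = edeg i \<nu>"
  unfolding edeg_def by (rule sum.cong) (auto simp: msum_act_sw)

lemma edeg_aroot: "edeg i (aroot i) = 0"
  unfolding edeg_def by (rule sum.neutral) (auto simp: aroot_def msum_minus msum_single)

lemma edeg_pos:
  assumes "\<beta> \<in> cone n" "l < n" "l \<noteq> i" "msum l \<beta> > 0"
  shows "edeg i \<beta> > 0"
  unfolding edeg_def using assms by (intro sum_pos2[where i = l]) (auto simp: cone_def)

text \<open>The truncation without the simple root itself. Its \<open>rb\<close> factors for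
  \<open>(i, i + 1)\<close> start one step later, so that \<open>s_i\<close> exchanges them with the
  \<open>cb\<close> factors, while it permutes the other pairs.\<close>

definition symfac :: "nat \<Rightarrow> tfield \<Rightarrow> nat \<Rightarrow> gring" where
  "symfac i c M = (\<Prod>r<M. fac c (rb i (Suc i) (Suc r))) * (\<Prod>r<M. fac c (cb i (Suc i) r)) *
    (\<Prod>(k, l)\<in>pairs n - {(i, Suc i)}. (\<Prod>r<M. fac c (rb k l r)) * (\<Prod>r<M. fac c (cb k l r)))"

context
  fixes i :: nat
  assumes i: "1 \<le> i" "i < n"
begin

text \<open>One more factor is taken for the pair \<open>(i, i + 1)\<close>, so that
  \<open>M\<close> factors of each kind remain after splitting off the simple root.\<close>

lemma trunc_symfac:
  "trunc n c (\<lambda>p. if p = (i, Suc i) then Suc M else M) (\<lambda>_. M) = fac c (aroot i) * symfac i c M"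
proof -
  let ?a = "\<lambda>p. if p = (i, Suc i) then Suc M else M"
  let ?F = "\<lambda>(k, l). (\<Prod>r<?a (k, l). fac c (rb k l r)) * (\<Prod>r<M. fac c (cb k l r))"
  let ?G = "\<lambda>(k, l). (\<Prod>r<M. fac c (rb k l r)) * (\<Prod>r<M. fac c (cb k l r))"
  have p: "(i, Suc i) \<in> pairs n"
    using i by (auto simp: pairs_def)
  have "trunc n c ?a (\<lambda>_. M) = ?F (i, Suc i) * prod ?F (pairs n - {(i, Suc i)})"
    unfolding trunc_def using p by (subst prod.remove[OF finite_pairs p]) simp
  also have "prod ?F (pairs n - {(i, Suc i)}) = prod ?G (pairs n - {(i, Suc i)})"
  proof (rule prod.cong[OF refl])
    show "?F p = ?G p" if "p \<in> pairs n - {(i, Suc i)}" for p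
      using that by (cases p) auto
  qed
  also have "?F (i, Suc i) = fac c (rb i (Suc i) 0) * (\<Prod>r<M. fac c (rb i (Suc i) (Suc r))) * (\<Prod>r<M. fac c (cb i (Suc i) r))"
    by (simp add: prod.lessThan_Suc_shift del: prod.lessThan_Suc)
  also have "rb i (Suc i) 0 = aroot i"
    by (simp add: rb_def aroot_def)
  finally show ?thesis
    by (simp add: symfac_def mult.assoc)
qed

lemma push_symfac: "push (act (sw i)) (symfac i c M) = symfac i c M"
proof -
  let ?A = "act (sw i)"
  note A = act_add[of "sw i"]
  let ?G = "\<lambda>(k, l). (\<Prod>r<M. fac c (rb k l r)) * (\<Prod>r<M. fac c (cb k l r))"
  let ?S = "pairs n - {(i, Suc i)}"
  have fac: "push ?A (fac c \<beta>) = fac c (?A \<beta>)" for \<beta>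
    by (simp add: fac_def push_minus push_one[OF A] push_single)
  have 0: "sw i 0 = 0"
    using i by (simp add: transpose_def)
  have rb: "?A (rb k l r) = rb (sw i k) (sw i l) r" and cb: "?A (cb k l r) = cb (sw i k) (sw i l) r" for k l r
    by (simp_all add: rb_def cb_def act_add act_minus 0)
  have "?A (rb i (Suc i) (Suc r)) = cb i (Suc i) r" for r
    unfolding rb by (simp add: cb_def rb_def add.commute)
  moreover from this have "?A (cb i (Suc i) r) = rb i (Suc i) (Suc r)" for r
    by (metis act_transpose_transpose)
  moreover have "push ?A (prod ?G ?S) = prod ?G ?S"
  proof -
    have "push ?A (prod ?G ?S) = (\<Prod>p\<in>?S. ?G (sw i (fst p), sw i (snd p)))"
      unfolding push_prod[OF A]
      by (rule prod.cong) (auto simp: push_mult[OF A] push_prod[OF A] fac rb cb)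
    also have "\<dots> = prod ?G ?S"
      by (rule prod.reindex_bij_witness[where i = "\<lambda>p. (sw i (fst p), sw i (snd p))" and j = "\<lambda>p. (sw i (fst p), sw i (snd p))"])
        (use i in \<open>auto simp: pairs_def transpose_def split: if_splits\<close>)
    finally show ?thesis .
  qed
  ultimately show ?thesis
    by (simp add: symfac_def push_mult[OF A] push_prod[OF A] fac mult.commute)
qed

text \<open>Every remaining factor involves some \<open>y_l\<close> with
  \<open>l \<noteq> i\<close>: \<open>y_0\<close> for the \<open>cb\<close> and the shifted
  \<open>rb\<close> factors, and \<open>y_k\<close> or \<open>y_{i+1}\<close> for the
  others.\<close>

lemma unipotent_symfac: "unipotent {\<beta>. edeg i \<beta> > 0} (symfac i c M)"
proof -
  have add: "\<beta> + \<gamma> \<in> {\<beta>. edeg i \<beta> > 0}" if "\<beta> \<in> {\<beta>. edeg i \<beta> > 0}" "\<gamma> \<in> {\<beta>. edeg i \<beta> > 0}" for \<beta> \<gamma>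
    using that by (simp add: edeg_add)
  have cb: "edeg i (cb k l r) > 0" if "(k, l) \<in> pairs n" for k l r
    using that i by (intro edeg_pos[where l = 0]) (auto simp: pairs_def cb_cone msum_cb)
  have rb1: "edeg i (rb i (Suc i) (Suc r)) > 0" for r
    using i by (intro edeg_pos[where l = 0]) (auto simp: rb_cone msum_rb)
  have rb2: "edeg i (rb k l r) > 0" if "(k, l) \<in> pairs n" "(k, l) \<noteq> (i, Suc i)" for k l r
  proof (cases "k = i")
    case True
    with that show ?thesis
      by (intro edeg_pos[where l = "Suc i"]) (auto simp: pairs_def rb_cone msum_rb)
  next
    case False
    with that show ?thesis
      by (intro edeg_pos[where l = k]) (auto simp: pairs_def rb_cone msum_rb)
  qed
  have p: "(i, Suc i) \<in> pairs n"
    using i by (auto simp: pairs_def)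
  show ?thesis
    unfolding symfac_def
  proof (intro unipotent_mult[OF add] unipotent_prod[OF add] unipotent_fac)
    fix p assume p: "p \<in> pairs n - {(i, Suc i)}"
    show "unipotent {\<beta>. edeg i \<beta> > 0}
      (case p of (k, l) \<Rightarrow> (\<Prod>r<M. fac c (rb k l r)) * (\<Prod>r<M. fac c (cb k l r)))"
      using p by (cases p) (auto intro!: unipotent_mult[OF add] unipotent_prod[OF add] unipotent_fac simp: cb rb2)
  qed (use rb1 cb[OF p] in auto)
qed

text \<open>Formally \<open>m = (1 - t y_i) J\<close> is \<open>1 - y_i\<close> times an
  \<open>s_i\<close>-invariant quotient, and \<open>s_i\<close> multiplies \<open>1 - y_i\<close> by
  \<open>- y_i^{-1}\<close>. Coefficientwise this says that \<open>X\<close>, the sum of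
  \<open>s_i m\<close> and \<open>y_i^{-1} m\<close>, vanishes.\<close>

lemma jc_sw: "jc n (act (sw i) \<nu>) - tt * jc n (act (sw i) \<nu> - aroot i) + jc n (\<nu> + aroot i) - tt * jc n \<nu> = 0"
proof -
  let ?A = "act (sw i)" and ?\<alpha> = "aroot i"
  note A = act_add[of "sw i"]
  have inj: "inj ?A"
    by (rule injI) (metis act_transpose_transpose)
  have A\<alpha>: "?A ?\<alpha> = - ?\<alpha>"
    by (simp add: aroot_def act_minus)
  define m where "m = conv (fac tt ?\<alpha>) (jc n)"
  have m: "m \<nu> = jc n \<nu> - tt * jc n (\<nu> - ?\<alpha>)" for \<nu>
    by (simp add: m_def conv_fac)
  define X where "X \<nu> = m (?A \<nu>) + m (\<nu> + ?\<alpha>)" for \<nu>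
  have medeg: "0 \<le> edeg i \<nu>" if "m \<nu> \<noteq> 0" for \<nu>
  proof -
    have "jc n \<nu> \<noteq> 0 \<or> jc n (\<nu> - ?\<alpha>) \<noteq> 0"
      using that by (auto simp: m)
    then have "\<nu> \<in> cone n \<or> \<nu> - ?\<alpha> \<in> cone n"
      using jc_not_cone by blast
    then have "0 \<le> edeg i \<nu> \<or> 0 \<le> edeg i (\<nu> - ?\<alpha>)"
      unfolding edeg_def cone_def by (fastforce intro: sum_nonneg)
    then show ?thesis
      by (simp add: edeg_minus edeg_aroot)
  qed
  have "X \<nu> = 0"
  proof (rule conv_injective[where h = "edeg i" and c = 0])
    show "edeg i (\<mu> - \<nu>) = edeg i \<mu> - edeg i \<nu>" for \<mu> \<nu>
      by (rule edeg_minus)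
    show "0 \<le> edeg i \<nu>" if "X \<nu> \<noteq> 0" for \<nu>
    proof -
      have "m (?A \<nu>) \<noteq> 0 \<or> m (\<nu> + ?\<alpha>) \<noteq> 0"
        using that by (auto simp: X_def)
      then show ?thesis
        using medeg edeg_act_sw[OF i(1), of \<nu>] edeg_add[of i \<nu> ?\<alpha>] edeg_aroot by fastforce
    qed
    fix \<nu>
    define M where "M = nat (max (hdeg n (?A \<nu>)) (hdeg n (\<nu> + ?\<alpha>))) + 1"
    have M: "hdeg n (?A \<nu>) < int M" "hdeg n (\<nu> + ?\<alpha>) < int M"
      by (auto simp: M_def)
    let ?a = "\<lambda>p. if p = (i, Suc i) then Suc M else M"
    let ?P = "\<lambda>c. symfac i c M"
    have Pm: "conv (?P tt) m \<kappa> = lookup (?P 1) \<kappa> - lookup (?P 1) (\<kappa> - ?\<alpha>)" if "hdeg n \<kappa> < int M" for \<kappa>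
    proof -
      have "conv (?P tt) m \<kappa> = conv (trunc n tt ?a (\<lambda>_. M)) (jc n) \<kappa>"
        unfolding trunc_symfac m_def conv_mult[symmetric] by (simp add: mult.commute)
      also have "\<dots> = lookup (fac 1 ?\<alpha> * ?P 1) \<kappa>"
        unfolding trunc_symfac[symmetric] using that by (intro conv_jc[of M]) auto
      also have "\<dots> = conv (fac 1 ?\<alpha>) (lookup (?P 1)) \<kappa>"
      proof -
        have "lookup (?P 1) = conv (?P 1) delta"
          by (simp add: fun_eq_iff conv_delta)
        then show ?thesis
          by (simp add: conv_mult[symmetric] conv_delta)
      qed
      finally show ?thesis
        by (simp add: conv_fac)
    qed
    have p: "lookup (?P 1) (?A \<kappa>) = lookup (?P 1) \<kappa>" for \<kappa>
      using lookup_push[OF A inj, of "?P 1" \<kappa>] by (simp add: push_symfac)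
    have "conv (?P tt) X \<nu> = conv (?P tt) (\<lambda>\<nu>. m (?A \<nu>)) \<nu> + conv (?P tt) (\<lambda>\<nu>. m (\<nu> + ?\<alpha>)) \<nu>"
      unfolding X_def by (rule conv_fun_add)
    also have "conv (?P tt) (\<lambda>\<nu>. m (?A \<nu>)) \<nu> = conv (?P tt) m (?A \<nu>)"
      using conv_push[OF A, of "?P tt" m \<nu>] by (simp add: push_symfac)
    also have "\<dots> = lookup (?P 1) \<nu> - lookup (?P 1) (?A \<nu> - ?\<alpha>)"
      unfolding Pm[OF M(1)] p ..
    also have "?A \<nu> - ?\<alpha> = ?A (\<nu> + ?\<alpha>)"
      by (simp add: act_add A\<alpha>)
    also have "conv (?P tt) (\<lambda>\<nu>. m (\<nu> + ?\<alpha>)) \<nu> = conv (?P tt) m (\<nu> + ?\<alpha>)"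
      by (rule conv_shift)
    also have "\<dots> = lookup (?P 1) (\<nu> + ?\<alpha>) - lookup (?P 1) \<nu>"
      unfolding Pm[OF M(2)] by simp
    finally have "conv (?P tt) X \<nu> = 0"
      by (simp add: p)
    then show "\<exists>g. unipotent {\<beta>. edeg i \<beta> > 0} g \<and> conv g X \<nu> = 0"
      using unipotent_symfac by blast
  qed
  then show ?thesis
    by (simp add: X_def m algebra_simps)
qed

end

section \<open>Coefficients of the kernel\<close>

text \<open>By homogeneity at most one power of \<open>h\<close> contributes to each power of
  \<open>q\<close>, so the series over \<open>d\<close> is eventually constant in every
  coefficient.\<close>

lemma kernel_coeff_nth:
  assumes \<mu>: "lookup \<mu> 0 = 0"
  shows "fps_nth (kernel_coeff n \<mu>) k = jc n (\<mu> + single 0 (int k))"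
proof -
  define K where "K = Abs_fps (\<lambda>k. jc n (\<mu> + single 0 (int k)))"
  have zero: "fps_nth (lookup (fps_nth (kernel n) d) \<mu>) k = 0" if d: "int d \<noteq> hdeg n (\<mu> + single 0 (int k))" for d k
  proof -
    let ?\<nu> = "\<mu> + single 0 (int k)"
    let ?s = "int d - hdeg n ?\<nu>"
    have "gcoeff n ?s (kernel n) ?\<nu> = 0"
      using d by (intro gcoeff_kernel_offset) simp
    then show ?thesis
      by (simp add: gcoeff_def drop0_def lookup_add \<mu>)
  qed
  have "(\<lambda>d. lookup (fps_nth (kernel n) d) \<mu>) sums K"
    unfolding sums_def
  proof (rule tendsto_fpsI)
    fix k
    let ?\<nu> = "\<mu> + single 0 (int k)"
    show "eventually (\<lambda>N. fps_nth (\<Sum>d<N. lookup (fps_nth (kernel n) d) \<mu>) k = fps_nth K k) sequentially"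
      using eventually_gt_at_top[of "nat (hdeg n ?\<nu>)"]
    proof eventually_elim
      case (elim N)
      have "fps_nth (\<Sum>d<N. lookup (fps_nth (kernel n) d) \<mu>) k
          = (\<Sum>d<N. fps_nth (lookup (fps_nth (kernel n) d) \<mu>) k)"
        by (rule fps_sum_nth)
      also have "\<dots> = fps_nth K k"
      proof (cases "hdeg n ?\<nu> \<ge> 0")
        case True
        then have "fps_nth (lookup (fps_nth (kernel n) d) \<mu>) k = 0" if "d \<noteq> nat (hdeg n ?\<nu>)" for d
          using that by (intro zero) auto
        then have "(\<Sum>d<N. fps_nth (lookup (fps_nth (kernel n) d) \<mu>) k)
            = (\<Sum>d\<in>{nat (hdeg n ?\<nu>)}. fps_nth (lookup (fps_nth (kernel n) d) \<mu>) k)"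
          using elim True by (intro sum.mono_neutral_right) auto
        also have "\<dots> = fps_nth K k"
          using True by (simp add: K_def gcoeff_def drop0_def lookup_add \<mu>)
        finally show ?thesis .
      next
        case False
        then have "fps_nth (lookup (fps_nth (kernel n) d) \<mu>) k = 0" for d
          by (intro zero) auto
        then show ?thesis
          using False by (simp add: K_def gcoeff_def)
      qed
      finally show ?case .
    qed
  qed
  then have "kernel_coeff n \<mu> = K"
    unfolding kernel_coeff_def by (rule sums_unique[symmetric])
  then show ?thesis
    by (simp add: K_def)
qed

lemma fls_nth_kernel_coeff:
  assumes "lookup \<mu> 0 = 0"
  shows "fls_nth (fps_to_fls (kernel_coeff n \<mu>)) z = jc n (\<mu> + single 0 z)"
  using assms by (simp add: kernel_coeff_nth) (simp add: gcoeff_def lookup_add)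

end

section \<open>Coefficients as Laurent series in \<open>q\<close>\<close>

lemma to_qseries_Fract:
  "b \<noteq> 0 \<Longrightarrow> to_qseries (Fract a b) = fps_to_fls (fps_of_poly a) / fps_to_fls (fps_of_poly b)"
  unfolding to_qseries_def
  by (rule fract_lift_Fract) (simp_all add: fps_of_poly_mult fls_times_fps_to_fls)

lemma to_qseries_mult: "to_qseries (x * y) = to_qseries x * to_qseries y"
  by (cases x rule: Fract_cases; cases y rule: Fract_cases)
    (simp add: to_qseries_Fract fps_of_poly_mult fls_times_fps_to_fls)

lemma to_qseries_add: "to_qseries (x + y) = to_qseries x + to_qseries y"
proof (cases x rule: Fract_cases)
  case x: (Fract a b)
  show ?thesis
  proof (cases y rule: Fract_cases)
    case y: (Fract c d)
    have "fps_to_fls (fps_of_poly b) \<noteq> 0" "fps_to_fls (fps_of_poly d) \<noteq> 0"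
      using x y by simp_all
    then show ?thesis
      using x y by (simp add: to_qseries_Fract fps_of_poly_mult fps_of_poly_add fls_times_fps_to_fls
          add_frac_eq)
  qed
qed

lemma to_qseries_const: "to_qseries (const_qt c) = fls_const c"
  by (simp add: const_qt_def to_qseries_Fract fps_of_poly_const)

lemma to_qseries_0 [simp]: "to_qseries 0 = 0"
  by (rule additive_zero) (rule to_qseries_add)

lemma to_qseries_1 [simp]: "to_qseries 1 = 1"
  by (simp add: One_fract_def to_qseries_Fract)

lemma to_qseries_eq_0_iff [simp]: "to_qseries x = 0 \<longleftrightarrow> x = 0"
  by (cases x rule: Fract_cases) (auto simp: to_qseries_Fract Zero_fract_def eq_fract)

lemma to_qseries_minus: "to_qseries (x - y) = to_qseries x - to_qseries y"
  by (rule additive_minus) (rule to_qseries_add)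

lemma to_qseries_inverse: "to_qseries (inverse x) = inverse (to_qseries x)"
proof (cases "x = 0")
  case False
  then have "to_qseries x * to_qseries (inverse x) = 1"
    by (simp add: to_qseries_mult[symmetric])
  then show ?thesis
    using False by (simp add: field_simps inverse_eq_divide)
qed simp

lemma to_qseries_power: "to_qseries (x ^ k) = to_qseries x ^ k"
  by (induction k) (simp_all add: to_qseries_mult)

lemma to_qseries_power_int: "to_qseries (x powi k) = to_qseries x powi k"
  by (simp add: power_int_def to_qseries_power to_qseries_inverse)

lemma to_qseries_qK: "to_qseries qK = fls_X"
proof -
  have "fps_of_poly [:0, 1:] = (fps_X :: tfield fps)"
    using fps_of_poly_monom[of 1 1] by (simp add: monom_altdef)
  then show ?thesis
    by (simp add: qK_def to_qseries_Fract)
qed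

lemma to_qseries_tK: "to_qseries tK = fls_const tt"
  by (simp add: tK_def to_qseries_power to_qseries_const fls_const_power)

section \<open>Laurent polynomials in the variables \<open>x\<^sub>1, \<dots>, x\<^sub>n\<close>\<close>

lemma Zvec_add: "\<mu> \<in> Zvec n \<Longrightarrow> \<nu> \<in> Zvec n \<Longrightarrow> \<mu> + \<nu> \<in> Zvec n"
  and Zvec_minus: "\<mu> \<in> Zvec n \<Longrightarrow> \<nu> \<in> Zvec n \<Longrightarrow> \<mu> - \<nu> \<in> Zvec n"
  and Zvec_uminus: "\<nu> \<in> Zvec n \<Longrightarrow> - \<nu> \<in> Zvec n"
  and Zvec_zmul: "\<nu> \<in> Zvec n \<Longrightarrow> zmul k \<nu> \<in> Zvec n"
  and Zvec_zero [simp]: "0 \<in> Zvec n"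
  by (simp_all add: Zvec_iff lookup_add lookup_minus)

lemma Zvec_single: "1 \<le> i \<Longrightarrow> i \<le> n \<Longrightarrow> single i a \<in> Zvec n"
  by (auto simp: Zvec_iff lookup_single when_def)

lemma Zvec_aroot: "1 \<le> i \<Longrightarrow> i < n \<Longrightarrow> aroot i \<in> Zvec n"
  by (simp add: aroot_def Zvec_minus Zvec_single)

lemma Zvec_lookup_0: "\<nu> \<in> Zvec n \<Longrightarrow> lookup \<nu> 0 = 0"
  by (simp add: Zvec_iff)

lemma sw_permutes: "1 \<le> i \<Longrightarrow> i < n \<Longrightarrow> sw i permutes {1..n}"
  by (intro permutes_swap_id) auto

lemma Zvec_act_sw: "1 \<le> i \<Longrightarrow> i < n \<Longrightarrow> \<nu> \<in> Zvec n \<Longrightarrow> act (sw i) \<nu> \<in> Zvec n"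
  by (rule act_Zvec[OF sw_permutes])

lemma Laurents_add: "f \<in> Laurents n \<Longrightarrow> g \<in> Laurents n \<Longrightarrow> f + g \<in> Laurents n"
  using keys_add[of f g] by (auto simp: Laurents_def)

lemma Laurents_zero [simp]: "0 \<in> Laurents n"
  by (simp add: Laurents_def)

lemma Laurents_uminus: "f \<in> Laurents n \<Longrightarrow> - f \<in> Laurents n"
  by (simp add: Laurents_def keys_uminus_eq)

lemma Laurents_minus: "f \<in> Laurents n \<Longrightarrow> g \<in> Laurents n \<Longrightarrow> f - g \<in> Laurents n"
  using Laurents_add[of f n "- g"] by (simp add: Laurents_uminus)

lemma Laurents_mult: "f \<in> Laurents n \<Longrightarrow> g \<in> Laurents n \<Longrightarrow> f * g \<in> Laurents n"
  using keys_mult[of f g] Zvec_add by (fastforce simp: Laurents_def)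

lemma Laurents_scalar: "f \<in> Laurents n \<Longrightarrow> scalar a * f \<in> Laurents n"
  by (rule Laurents_mult) (simp_all add: Laurents_def scalar_def)

lemma Laurents_xmono: "\<nu> \<in> Zvec n \<Longrightarrow> xmono \<nu> \<in> Laurents n"
  by (simp add: Laurents_def xmono_def)

lemma Laurents_xvar: "1 \<le> i \<Longrightarrow> i \<le> n \<Longrightarrow> xvar i \<in> Laurents n"
  by (simp add: xvar_def Laurents_xmono Zvec_single)

lemma Laurents_sum: "(\<And>x. x \<in> I \<Longrightarrow> F x \<in> Laurents n) \<Longrightarrow> sum F I \<in> Laurents n"
  by (induction I rule: infinite_finite_induct) (auto intro: Laurents_add)

lemma Laurents_induct [consumes 1, case_names zero mono add scale]:
  assumes f: "f \<in> Laurents n" and "P 0" and mono: "\<And>\<nu>. \<nu> \<in> Zvec n \<Longrightarrow> P (xmono \<nu>)"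
    and add: "\<And>f g. f \<in> Laurents n \<Longrightarrow> g \<in> Laurents n \<Longrightarrow> P f \<Longrightarrow> P g \<Longrightarrow> P (f + g)"
    and scale: "\<And>a f. f \<in> Laurents n \<Longrightarrow> P f \<Longrightarrow> P (scalar a * f)"
  shows "P f"
proof -
  have "(\<Sum>k\<in>A. single k (lookup f k)) \<in> Laurents n \<and> P (\<Sum>k\<in>A. single k (lookup f k))"
    if "finite A" "A \<subseteq> Zvec n" for A
    using that
  proof (induction A)
    case (insert k A)
    then have "single k (lookup f k) \<in> Laurents n" "P (single k (lookup f k))"
      unfolding single_eq_scalar_xmono by (auto intro: Laurents_scalar Laurents_xmono scale mono)
    with insert show ?case
      by (auto intro: Laurents_add add)
  qed (use assms in auto)
  from this[of "keys f"] show ?thesis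
    using f poly_mapping_sum_single[of f] by (simp add: Laurents_def)
qed

lemma Laurents_msubst:
  assumes "f \<in> Laurents n" and "\<And>\<nu>. \<nu> \<in> Zvec n \<Longrightarrow> act w \<nu> \<in> Zvec n"
  shows "msubst c w f \<in> Laurents n"
  unfolding msubst_def using assms by (intro Laurents_sum) (auto simp: Laurents_def)

lemma Laurents_sv: "1 \<le> i \<Longrightarrow> i < n \<Longrightarrow> f \<in> Laurents n \<Longrightarrow> sv i f \<in> Laurents n"
  by (rule Laurents_msubst) (auto intro: Zvec_act_sw)

lemma Laurents_divided_diff_mono:
  assumes i: "1 \<le> i" "i < n" and \<nu>: "\<nu> \<in> Zvec n" and le: "lookup \<nu> (Suc i) \<le> lookup \<nu> i"
  shows "divided_diff i (xmono \<nu>) \<in> Laurents n"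
proof -
  have "lookup \<nu> i - lookup \<nu> (Suc i) = int (nat (lookup \<nu> i - lookup \<nu> (Suc i)))"
    using le by simp
  from divided_diff_xmono[OF this] show ?thesis
    using i \<nu> by (auto intro!: Laurents_sum Laurents_xmono Zvec_minus Zvec_single Zvec_zmul Zvec_aroot)
qed

lemma divided_diff_add: "divided_diff i (f + g) = divided_diff i f + divided_diff i g"
proof (rule divided_diff_unique)
  show "(xvar i - xvar (Suc i)) * (divided_diff i f + divided_diff i g) = f + g - sv i (f + g)"
    unfolding distrib_left divided_diff_eq msubst_add by simp
qed

lemma divided_diff_scalar: "divided_diff i (scalar a * f) = scalar a * divided_diff i f"
proof (rule divided_diff_unique)
  have "(xvar i - xvar (Suc i)) * (scalar a * divided_diff i f) = scalar a * ((xvar i - xvar (Suc i)) * divided_diff i f)"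
    by (simp only: mult_ac)
  then show "(xvar i - xvar (Suc i)) * (scalar a * divided_diff i f) = scalar a * f - sv i (scalar a * f)"
    unfolding divided_diff_eq by (simp add: sv_mult right_diff_distrib)
qed

lemma divided_diff_zero [simp]: "divided_diff i 0 = 0"
  by (rule additive_zero) (rule divided_diff_add)

lemma Laurents_divided_diff:
  assumes f: "f \<in> Laurents n" and i: "1 \<le> i" "i < n"
  shows "divided_diff i f \<in> Laurents n"
  using f
proof (induction f rule: Laurents_induct)
  case (mono \<nu>)
  show ?case
  proof (cases "lookup \<nu> (Suc i) \<le> lookup \<nu> i")
    case False
    then have "divided_diff i (xmono (act (sw i) \<nu>)) \<in> Laurents n"
      using i mono by (intro Laurents_divided_diff_mono Zvec_act_sw) (auto simp: lookup_act_transpose)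
    moreover have "xmono \<nu> = sv i (xmono (act (sw i) \<nu>))"
      by (simp add: msubst_xmono)
    ultimately show ?thesis
      by (simp only: divided_diff_sv Laurents_uminus)
  qed (use i mono Laurents_divided_diff_mono in blast)
qed (simp_all add: divided_diff_add divided_diff_scalar Laurents_add Laurents_scalar)

lemma Laurents_DL: "f \<in> Laurents n \<Longrightarrow> 1 \<le> i \<Longrightarrow> i < n \<Longrightarrow> DL i f \<in> Laurents n"
  unfolding DL_def mult.assoc
  by (intro Laurents_minus Laurents_divided_diff Laurents_mult[of "xvar i"] Laurents_scalar Laurents_xvar) auto

lemma Laurents_DLi: "f \<in> Laurents n \<Longrightarrow> 1 \<le> i \<Longrightarrow> i < n \<Longrightarrow> DLi i f \<in> Laurents n"
  unfolding DLi_def by (intro Laurents_scalar Laurents_add Laurents_DL)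

lemma Zvec_act_rot: "n \<ge> 1 \<Longrightarrow> \<nu> \<in> Zvec n \<Longrightarrow> act (rot n) \<nu> \<in> Zvec n"
  by (auto simp: Zvec_iff lookup_act_rot irot_def)

lemma Zvec_act_irot:
  assumes "n \<ge> 1" "\<nu> \<in> Zvec n"
  shows "act (irot n) \<nu> \<in> Zvec n"
proof -
  have "bij (irot n)" "inv (irot n) = rot n"
    using bij_rot[OF assms(1)] inv_rot[OF assms(1)] by (metis bij_imp_bij_inv, metis inv_inv_eq)
  then show ?thesis
    using assms by (auto simp: Zvec_iff lookup_act rot_def)
qed

lemma Laurents_Rq: "n \<ge> 1 \<Longrightarrow> f \<in> Laurents n \<Longrightarrow> Rq n f \<in> Laurents n"
  unfolding Rq_def by (rule Laurents_msubst) (auto intro: Zvec_act_rot)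

lemma Laurents_Rqi: "n \<ge> 1 \<Longrightarrow> f \<in> Laurents n \<Longrightarrow> Rqi n f \<in> Laurents n"
  unfolding Rqi_def by (rule Laurents_msubst) (auto intro: Zvec_act_irot)

lemma Laurents_up: "f \<in> Laurents n \<Longrightarrow> 1 \<le> i \<Longrightarrow> i + m \<le> n \<Longrightarrow> up m i f \<in> Laurents n"
  by (induction m) (auto intro: Laurents_DL)

lemma Laurents_upi: "f \<in> Laurents n \<Longrightarrow> 1 \<le> i \<Longrightarrow> i + m \<le> n \<Longrightarrow> upi m i f \<in> Laurents n"
  by (induction m) (auto intro: Laurents_DLi)

lemma Laurents_down: "f \<in> Laurents n \<Longrightarrow> 1 \<le> i \<Longrightarrow> i + m \<le> n \<Longrightarrow> down m i f \<in> Laurents n"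
proof (induction m arbitrary: f)
  case (Suc m)
  then have "down m i (DL (i + m) f) \<in> Laurents n"
    by (intro Suc.IH Laurents_DL) auto
  then show ?case
    by simp
qed simp

lemma const_t_add: "const_t (a + b) = const_t a + const_t b"
  and const_t_mult: "const_t (a * b) = const_t a * const_t b"
  and const_t_0 [simp]: "const_t 0 = 0"
  by (simp_all add: const_t_def Zero_fract_def eq_fract)

section \<open>The bilinear form\<close>

lemma ct_kernel_add: "ct_kernel n (f + g) = ct_kernel n f + ct_kernel n g"
  unfolding ct_kernel_def
  by (rule sum_keys_add[where \<phi> = "\<lambda>\<nu> a. to_qseries a * fps_to_fls (kernel_coeff n (- \<nu>))"])
    (simp add: to_qseries_add distrib_right)

lemma ct_kernel_single: "ct_kernel n (single \<nu> a) = to_qseries a * fps_to_fls (kernel_coeff n (- \<nu>))"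
  by (cases "a = 0") (simp_all add: ct_kernel_def)

lemma ct_kernel_zero [simp]: "ct_kernel n 0 = 0"
  by (simp add: ct_kernel_def)

lemma ct_kernel_minus: "ct_kernel n (f - g) = ct_kernel n f - ct_kernel n g"
  by (rule additive_minus) (rule ct_kernel_add)

lemma ct_kernel_sum: "ct_kernel n (sum F I) = (\<Sum>x\<in>I. ct_kernel n (F x))"
  by (rule additive_sum) (rule ct_kernel_add)

lemma ct_kernel_scalar: "ct_kernel n (scalar a * f) = to_qseries a * ct_kernel n f"
proof (induction f rule: poly_mapping_linear_induct)
  case (single k c)
  have "scalar a * single k c = single k (a * c)"
    by (simp add: scalar_def mult_single)
  then show ?case
    by (simp add: ct_kernel_single to_qseries_mult mult.assoc)
qed (simp_all add: ct_kernel_add distrib_left)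

lemma ct_kernel_xmono: "ct_kernel n (xmono \<nu>) = fps_to_fls (kernel_coeff n (- \<nu>))"
  by (simp add: xmono_def ct_kernel_single)

text \<open>A monomial is paired with the kernel coefficient at the negated exponent, whence the
  choice of \<rho>. The coefficient of \<open>q^z\<close> is then \<open>jc_sw\<close> at \<rho>
  with \<open>z\<close> added at index \<open>0\<close>.\<close>

lemma ct_kernel_symmetric_mono:
  assumes n: "n \<ge> 1" and i: "1 \<le> i" "i < n" and \<nu>: "\<nu> \<in> Zvec n"
  shows "ct_kernel n ((xvar (Suc i) - scalar tK * xvar i) * (xmono \<nu> + sv i (xmono \<nu>))) = 0"
proof -
  define \<rho> where "\<rho> = - \<nu> - single i 1"
  have \<rho>: "\<rho> \<in> Zvec n" "act (sw i) \<rho> \<in> Zvec n"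
    using i \<nu> by (auto simp: \<rho>_def intro!: Zvec_minus Zvec_uminus Zvec_single Zvec_act_sw)
  have s\<rho>: "act (sw i) \<rho> = - act (sw i) \<nu> - single (Suc i) 1"
    by (simp add: \<rho>_def act_minus act_uminus)
  have 1: "xvar (Suc i) * xmono \<nu> = xmono (- (\<rho> + aroot i))"
    and 2: "xvar i * xmono \<nu> = xmono (- \<rho>)"
    and 3: "xvar (Suc i) * xmono (act (sw i) \<nu>) = xmono (- act (sw i) \<rho>)"
    and 4: "xvar i * xmono (act (sw i) \<nu>) = xmono (- (act (sw i) \<rho> - aroot i))"
    unfolding s\<rho> by (simp_all add: xvar_def xmono_add[symmetric] \<rho>_def aroot_def)
  have "(xvar (Suc i) - scalar tK * xvar i) * (xmono \<nu> + sv i (xmono \<nu>)) =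
    xmono (- (\<rho> + aroot i)) - scalar tK * xmono (- \<rho>)
    + (xmono (- act (sw i) \<rho>) - scalar tK * xmono (- (act (sw i) \<rho> - aroot i)))"
    unfolding 1[symmetric] 2[symmetric] 3[symmetric] 4[symmetric] by (simp add: msubst_xmono algebra_simps)
  then have *: "ct_kernel n ((xvar (Suc i) - scalar tK * xvar i) * (xmono \<nu> + sv i (xmono \<nu>))) =
    fps_to_fls (kernel_coeff n (\<rho> + aroot i)) - fls_const tt * fps_to_fls (kernel_coeff n \<rho>)
    + (fps_to_fls (kernel_coeff n (act (sw i) \<rho>)) - fls_const tt * fps_to_fls (kernel_coeff n (act (sw i) \<rho> - aroot i)))"
    by (simp only: ct_kernel_add ct_kernel_minus ct_kernel_scalar ct_kernel_xmono to_qseries_tK minus_minus)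
  have "sw i 0 = 0"
    using i by (simp add: transpose_def)
  then have s0: "act (sw i) (\<rho> + single 0 z) = act (sw i) \<rho> + single 0 z" for z
    by (simp add: act_add)
  have "fls_nth (fps_to_fls (kernel_coeff n (\<rho> + aroot i)) - fls_const tt * fps_to_fls (kernel_coeff n \<rho>)
    + (fps_to_fls (kernel_coeff n (act (sw i) \<rho>)) - fls_const tt * fps_to_fls (kernel_coeff n (act (sw i) \<rho> - aroot i)))) z = 0" for z
    using jc_sw[OF n i, of "\<rho> + single 0 z"] \<rho> i
    unfolding s0
    by (simp add: fls_nth_kernel_coeff[OF n] Zvec_lookup_0[of _ n] Zvec_add Zvec_minus Zvec_aroot add.assoc del: fps_to_fls_nth)
      (simp add: algebra_simps)
  then show ?thesis
    unfolding * by (intro fls_eqI) simp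
qed

text \<open>Characteristic zero, read off from the constants; it removes the factor \<open>2\<close>
  that arises from \<open>g + s_i g\<close> for invariant \<open>g\<close>.\<close>

lemma fls_double_eq_0: "x + x = 0 \<Longrightarrow> x = 0" for x :: "tfield fls"
proof (rule fls_eqI)
  fix k
  assume "x + x = 0"
  then have "fls_nth x k + fls_nth x k = 0"
    by (metis fls_plus_nth fls_zero_nth)
  then have "(const_t 1 + const_t 1) * fls_nth x k = 0"
    by (simp add: const_t_def one_pCons[symmetric] One_fract_def[symmetric] distrib_right)
  then show "fls_nth x k = fls_nth 0 k"
    by (simp add: const_t_add[symmetric]) (simp add: const_t_def Fract_1_eq_0_iff)
qed

lemma ct_kernel_symmetric:
  assumes n: "n \<ge> 1" and i: "1 \<le> i" "i < n" and g: "g \<in> Laurents n" "sv i g = g"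
  shows "ct_kernel n ((xvar (Suc i) - scalar tK * xvar i) * g) = 0"
proof -
  have "ct_kernel n ((xvar (Suc i) - scalar tK * xvar i) * (g + sv i g)) = 0"
    using g(1)
  proof (induction g rule: Laurents_induct)
    case (mono \<nu>)
    then show ?case
      by (rule ct_kernel_symmetric_mono[OF n i])
  next
    case (add f g)
    have "(xvar (Suc i) - scalar tK * xvar i) * (f + g + sv i (f + g)) =
      (xvar (Suc i) - scalar tK * xvar i) * (f + sv i f) + (xvar (Suc i) - scalar tK * xvar i) * (g + sv i g)"
      by (simp add: msubst_add distrib_left)
    with add show ?case
      by (simp only: ct_kernel_add add_0)
  next
    case (scale a f)
    have "(xvar (Suc i) - scalar tK * xvar i) * (scalar a * f + sv i (scalar a * f)) =
      scalar a * ((xvar (Suc i) - scalar tK * xvar i) * (f + sv i f))"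
      by (simp add: sv_mult algebra_simps)
    with scale show ?case
      by (simp only: ct_kernel_scalar mult_zero_right)
  qed simp
  then show ?thesis
    unfolding g(2) distrib_left ct_kernel_add by (rule fls_double_eq_0)
qed

text \<open>The difference \<open>T_i f * h - f * T_i h\<close> equals
  \<open>(x_{i+1} - t x_i) G\<close> with \<open>G\<close> the divided difference of
  \<open>f * s_i h\<close>. Such a \<open>G\<close> is \<open>s_i\<close>-invariant, so
  \<open>ct_kernel_symmetric\<close> applies.\<close>

lemma ct_kernel_DL:
  assumes n: "n \<ge> 1" and i: "1 \<le> i" "i < n" and f: "f \<in> Laurents n" and h: "h \<in> Laurents n"
  shows "ct_kernel n (DL i f * h) = ct_kernel n (f * DL i h)"
proof -
  define D P G where "D = xvar i - xvar (Suc i)" "P = f * sv i h" "G = divided_diff i P"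
  have D: "D \<noteq> 0"
    using xvar_diff_nonzero[of i "Suc i"] by (simp add: D_P_G_def)
  have G: "D * G = P - sv i P"
    unfolding D_P_G_def by (rule divided_diff_eq)
  have "sv i (D * G) = - (D * G)"
    unfolding G by (simp add: msubst_minus)
  then have "D * sv i G = D * G"
    by (simp add: sv_mult D_P_G_def msubst_minus algebra_simps)
  then have sG: "sv i G = G"
    using D by simp
  have "D * (DL i f * h - f * DL i h) = (D * DL i f) * h - f * (D * DL i h)"
    by (simp add: algebra_simps)
  also have "\<dots> = (scalar tK * xvar i - xvar (Suc i)) * (sv i f * h - f * sv i h)"
    unfolding D_P_G_def DL_eq by (simp add: algebra_simps)
  also have "sv i f * h - f * sv i h = - (D * G)"
    unfolding G by (simp add: D_P_G_def sv_mult)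
  finally have "D * (DL i f * h - f * DL i h) = D * ((xvar (Suc i) - scalar tK * xvar i) * G)"
    by (simp add: algebra_simps)
  then have "DL i f * h - f * DL i h = (xvar (Suc i) - scalar tK * xvar i) * G"
    using D by simp
  moreover have "ct_kernel n ((xvar (Suc i) - scalar tK * xvar i) * G) = 0"
    using f h i sG unfolding D_P_G_def
    by (intro ct_kernel_symmetric[OF n i] Laurents_divided_diff Laurents_mult Laurents_sv) (auto simp: D_P_G_def)
  ultimately have "ct_kernel n (DL i f * h - f * DL i h) = 0"
    by simp
  then show ?thesis
    by (simp add: ct_kernel_minus)
qed

lemma ct_kernel_DLi:
  assumes n: "n \<ge> 1" and i: "1 \<le> i" "i < n" and f: "f \<in> Laurents n" and h: "h \<in> Laurents n"
  shows "ct_kernel n (DLi i f * h) = ct_kernel n (f * DLi i h)"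
  using ct_kernel_DL[OF assms]
  by (simp add: DLi_def mult.assoc mult.left_commute[of f] ct_kernel_scalar ct_kernel_add distrib_left distrib_right)

text \<open>Besides permuting an exponent, the rotation multiplies by a power of \<open>q\<close>.
  Shifting the \<open>q\<close>-series by it is exactly what \<open>pihat\<close> records at index
  \<open>0\<close>, so \<open>jc_pihat\<close> applies.\<close>

lemma ct_kernel_Rq:
  assumes n: "n \<ge> 1" and f: "f \<in> Laurents n"
  shows "ct_kernel n (Rq n f) = ct_kernel n f"
  using f
proof (induction f rule: Laurents_induct)
  case (mono \<nu>)
  have chi: "chi (\<lambda>i. if i = n then inverse qK else 1) \<nu> = qK powi (- lookup \<nu> n)"
  proof -
    have "chi (\<lambda>i. if i = n then inverse qK else 1) \<nu> = (\<Prod>i\<in>{1..n}. (if i = n then inverse qK else 1) powi lookup \<nu> i)"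
      using mono by (intro chi_superset) (auto simp: Zvec_def)
    also have "\<dots> = (\<Prod>i\<in>{n}. inverse qK powi lookup \<nu> i)"
      using n by (intro prod.mono_neutral_cong_right) auto
    finally show ?thesis
      by (simp add: power_int_minus power_int_inverse)
  qed
  have "fls_nth (fls_X powi (- lookup \<nu> n) * fps_to_fls (kernel_coeff n (- act (rot n) \<nu>))) z =
    fls_nth (fps_to_fls (kernel_coeff n (- \<nu>))) z" for z
  proof -
    have "rot n 0 = 0"
      using n by (simp add: rot_def)
    have "fls_nth (fls_X powi (- lookup \<nu> n) * fps_to_fls (kernel_coeff n (- act (rot n) \<nu>))) z =
      fls_nth (fps_to_fls (kernel_coeff n (- act (rot n) \<nu>))) (z + lookup \<nu> n)"
      by (simp add: fls_X_intpow_times_conv_shift(1)[of "- lookup \<nu> n", simplified] del: fps_to_fls_nth)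
    also have "\<dots> = jc n (- act (rot n) \<nu> + single 0 (z + lookup \<nu> n))"
      using Zvec_uminus[OF Zvec_act_rot[OF n mono]] by (intro fls_nth_kernel_coeff[OF n] Zvec_lookup_0)
    also have "- act (rot n) \<nu> + single 0 (z + lookup \<nu> n) = pihat n (- \<nu> + single 0 z)"
      using n \<open>rot n 0 = 0\<close>
      by (simp add: pihat_def[OF n] act_minus lookup_minus lookup_single when_def single_add single_uminus)
    also have "jc n \<dots> = fls_nth (fps_to_fls (kernel_coeff n (- \<nu>))) z"
      unfolding jc_pihat[OF n] using Zvec_uminus[OF mono]
      by (intro fls_nth_kernel_coeff[OF n, symmetric] Zvec_lookup_0)
    finally show ?thesis .
  qed
  then have "fls_X powi (- lookup \<nu> n) * fps_to_fls (kernel_coeff n (- act (rot n) \<nu>)) = fps_to_fls (kernel_coeff n (- \<nu>))"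
    by (rule fls_eqI)
  then show ?case
    by (simp add: Rq_def msubst_xmono ct_kernel_scalar ct_kernel_xmono chi to_qseries_power_int to_qseries_qK)
qed (simp_all add: Rq_add Rq_scalar ct_kernel_add ct_kernel_scalar additive_zero[of "Rq n", OF Rq_add])

lemma ct_kernel_Rq_adjoint:
  assumes n: "n \<ge> 1" and f: "f \<in> Laurents n" and h: "h \<in> Laurents n"
  shows "ct_kernel n (Rq n f * h) = ct_kernel n (f * Rqi n h)"
proof -
  have "ct_kernel n (f * Rqi n h) = ct_kernel n (Rq n (f * Rqi n h))"
    using ct_kernel_Rq[OF n Laurents_mult[OF f Laurents_Rqi[OF n h]]] by simp
  then show ?thesis
    using n by (simp add: Rq_mult)
qed

lemma ct_kernel_up:
  assumes "1 \<le> i" "i + m \<le> n" and f: "f \<in> Laurents n" and h: "h \<in> Laurents n"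
  shows "ct_kernel n (up m i f * h) = ct_kernel n (f * down m i h)"
  using assms
proof (induction m arbitrary: h)
  case (Suc m)
  have "ct_kernel n (up (Suc m) i f * h) = ct_kernel n (up m i f * DL (i + m) h)"
    using Suc.prems by (simp add: ct_kernel_DL Laurents_up)
  also have "\<dots> = ct_kernel n (f * down m i (DL (i + m) h))"
    using Suc.prems by (intro Suc.IH Laurents_DL) auto
  finally show ?case
    by simp
qed simp

lemma ct_kernel_upi:
  assumes "1 \<le> i" "i + m \<le> n" and f: "f \<in> Laurents n" and h: "h \<in> Laurents n"
  shows "ct_kernel n (upi m i f * h) = ct_kernel n (f * downi m i h)"
  using assms
proof (induction m arbitrary: h)
  case (Suc m)
  have "ct_kernel n (upi (Suc m) i f * h) = ct_kernel n (upi m i f * DLi (i + m) h)"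
    using Suc.prems by (simp add: ct_kernel_DLi Laurents_upi)
  also have "\<dots> = ct_kernel n (f * downi m i (DLi (i + m) h))"
    using Suc.prems by (intro Suc.IH Laurents_DLi) auto
  finally show ?case
    by simp
qed simp

lemma ct_kernel_Yop:
  assumes i: "1 \<le> i" "i \<le> n" and f: "f \<in> Laurents n" and h: "h \<in> Laurents n"
  shows "ct_kernel n (Yop n i f * h) = ct_kernel n (f * Ystar n i h)"
proof -
  have n: "n \<ge> 1"
    using i by simp
  have "ct_kernel n (Yop n i f * h) = ct_kernel n (Rq n (upi (n - i) i f) * down (i - 1) 1 h)"
    unfolding Yop_def using i by (intro ct_kernel_up Laurents_Rq Laurents_upi f h) auto
  also have "\<dots> = ct_kernel n (upi (n - i) i f * Rqi n (down (i - 1) 1 h))"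
    using i by (intro ct_kernel_Rq_adjoint[OF n] Laurents_upi Laurents_down f h) auto
  also have "\<dots> = ct_kernel n (f * Ystar n i h)"
    unfolding Ystar_def using i by (intro ct_kernel_upi Laurents_Rqi Laurents_down f h) auto
  finally show ?thesis .
qed

section \<open>The bar involution\<close>

lemma Fract_sum: "(\<Sum>i\<in>A. Fract (f i) 1) = Fract (sum f A) 1"
  by (induction A rule: infinite_finite_induct) (simp_all add: Zero_fract_def)

lemma Fract_power: "Fract a 1 ^ k = Fract (a ^ k) 1"
  by (induction k) (simp_all add: One_fract_def)

text \<open>An indeterminate is transcendental over the constants, hence so is its inverse.\<close>

lemma sum_Fract_monom: "(\<Sum>i\<le>m. Fract [:c i:] 1 * Fract [:0, 1:] 1 ^ i) = Fract (\<Sum>i\<le>m. monom (c i) i) 1"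
  for c :: "nat \<Rightarrow> 'a::field"
  by (simp add: Fract_power Fract_sum[symmetric] monom_altdef smult_conv_map_poly)

lemma poly_indeterminate_inverse_nonzero:
  fixes p :: "'a::field poly" and c :: "'a \<Rightarrow> 'b::field"
  assumes p: "p \<noteq> 0" and c: "\<And>a. c a = 0 \<longleftrightarrow> a = 0"
  shows "poly (map_poly (\<lambda>a. Fract [:c a:] 1) p) (inverse (Fract [:0, 1:] 1)) \<noteq> 0"
proof
  let ?X = "Fract [:0, 1 :: 'b:] 1" and ?m = "degree p"
  assume zero: "poly (map_poly (\<lambda>a. Fract [:c a:] 1) p) (inverse ?X) = 0"
  have X: "?X \<noteq> 0"
    by (simp add: Fract_1_eq_0_iff)
  have c0: "Fract [:c a:] 1 = 0 \<longleftrightarrow> a = 0" for a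
    by (simp add: Fract_1_eq_0_iff c)
  have deg: "degree (map_poly (\<lambda>a. Fract [:c a:] 1) p) = ?m"
    using p c0 by (intro degree_map_poly) auto
  \<comment> \<open>Multiplying by this power of the indeterminate reverses the list of
    coefficients, so the leading coefficient of \<open>p\<close> becomes a constant term.\<close>
  have "poly (map_poly (\<lambda>a. Fract [:c a:] 1) p) (inverse ?X) * ?X ^ ?m =
    (\<Sum>i\<le>?m. Fract [:c (coeff p i):] 1 * ?X ^ (?m - i))"
    unfolding poly_altdef deg sum_distrib_right
    by (rule sum.cong) (use X c0 in \<open>auto simp: coeff_map_poly power_diff field_simps\<close>)
  also have "\<dots> = (\<Sum>i\<le>?m. Fract [:c (coeff p (?m - i)):] 1 * ?X ^ i)"
    by (rule sum.reindex_bij_witness[where i = "\<lambda>i. ?m - i" and j = "\<lambda>i. ?m - i"]) auto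
  also have "\<dots> = Fract (\<Sum>i\<le>?m. monom (c (coeff p (?m - i))) i) 1"
    by (rule sum_Fract_monom)
  finally have "(\<Sum>i\<le>?m. monom (c (coeff p (?m - i))) i) = 0"
    unfolding zero by (simp add: Fract_1_eq_0_iff)
  then have "coeff (\<Sum>i\<le>?m. monom (c (coeff p (?m - i))) i) 0 = 0"
    by simp
  then have "c (coeff p ?m) = 0"
    by (simp add: coeff_sum)
  then show False
    using p c by simp
qed

lemma Fract_eq_0_iff: "b \<noteq> 0 \<Longrightarrow> Fract a b = 0 \<longleftrightarrow> a = 0"
  by (simp add: Zero_fract_def eq_fract)

lemma bar_t_eq_0_iff: "bar_t c = 0 \<longleftrightarrow> c = 0"
proof -
  define h where "h p = poly (map_poly const_t p) (inverse thalf)" for p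
  have const: "const_t = (\<lambda>a. Fract [:a:] 1)"
    by (simp add: fun_eq_iff const_t_def)
  have h0: "h p \<noteq> 0" if "p \<noteq> 0" for p
    unfolding h_def const thalf_def using that
    by (rule poly_indeterminate_inverse_nonzero[where c = "\<lambda>a. a"]) simp
  have "map_poly const_t (p * q) = map_poly const_t p * map_poly const_t q" for p q
    by (rule poly_eqI) (simp add: coeff_map_poly coeff_mult additive_sum[OF const_t_add] const_t_mult)
  then have hm: "h (p * q) = h p * h q" for p q
    by (simp add: h_def)
  show ?thesis
  proof (cases c rule: Fract_cases)
    case (Fract a b)
    have "bar_t (Fract a b) = h a / h b"
      unfolding bar_t_def h_def[abs_def, symmetric] using hm h0 Fract by (intro fract_lift_Fract) auto
    moreover have "h 0 = 0"
      by (simp add: h_def)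
    ultimately show ?thesis
      using Fract h0[of a] h0[of b] by (auto simp: Fract_eq_0_iff)
  qed
qed

text \<open>\<open>1 = Fract a b\<close> forces \<open>a = b\<close>, so the quotient of the
  evaluations is \<open>1\<close> once they are known not to vanish.\<close>

lemma bar_qt_1: "bar_qt 1 = 1"
proof -
  define h where "h p = poly (map_poly (\<lambda>c. const_qt (bar_t c)) p) (inverse qK)" for p
  have h0: "h p \<noteq> 0" if "p \<noteq> 0" for p
    unfolding h_def const_qt_def qK_def using that
    by (rule poly_indeterminate_inverse_nonzero[where c = bar_t]) (rule bar_t_eq_0_iff)
  show ?thesis
    unfolding bar_qt_def fract_lift_def h_def[symmetric]
  proof (rule the_equality)
    show "\<exists>a b. b \<noteq> 0 \<and> 1 = Fract a b \<and> 1 = h a / h b"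
      using h0[of 1] by (intro exI[of _ 1]) (simp add: One_fract_def)
    fix w assume "\<exists>a b. b \<noteq> 0 \<and> 1 = Fract a b \<and> w = h a / h b"
    then show "w = 1"
      using h0 by (auto simp: One_fract_def eq_fract)
  qed
qed

lemma bar_xmono: "bar (xmono \<nu>) = xmono (- \<nu>)"
  by (simp add: bar_def xmono_def bar_qt_1)

lemma inner_qt_xmono: "inner_qt n f (xmono \<nu>) = ct_kernel n (f * xmono (- \<nu>))"
  by (simp add: inner_qt_def bar_xmono)

section \<open>Triangularity\<close>

text \<open>While the factors of \<open>Y_i\<close> are applied, the entry at position
  \<open>p\<close> of the original exponent is stored at \<open>w p\<close>, up to the sign
  \<open>s\<close>. Being lower refers to the exponent before this rearrangement.\<close>

definition lower :: "(expo \<Rightarrow> expo) \<Rightarrow> nat \<Rightarrow> (nat \<Rightarrow> nat) \<Rightarrow> expo \<Rightarrow> expo set" where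
  "lower s n w \<nu> = (\<lambda>\<kappa>. s (act w \<kappa>)) ` {\<kappa>. prec n \<kappa> \<nu>}"

text \<open>A single \<open>T_j\<close> is triangular only in this sense, with differently
  rearranged source and target. By \<open>triangular_apply\<close> such steps compose and their
  leading coefficients multiply.\<close>

definition triangular :: "(expo \<Rightarrow> expo) \<Rightarrow> nat \<Rightarrow> (nat \<Rightarrow> nat) \<Rightarrow> expo \<Rightarrow> qtfield \<Rightarrow> laurent \<Rightarrow> bool" where
  "triangular s n w \<nu> c f \<longleftrightarrow> (\<exists>g. f = scalar c * xmono (s (act w \<nu>)) + g \<and> keys g \<subseteq> lower s n w \<nu>)"

lemma keys_scalar_mult: "keys (scalar a * f) \<subseteq> keys f"
  by (auto simp: in_keys_iff)

lemma keys_add_subset: "keys f \<subseteq> S \<Longrightarrow> keys g \<subseteq> S \<Longrightarrow> keys (f + g) \<subseteq> S"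
  using keys_add[of f g] by blast

lemma keys_scalar_subset: "keys f \<subseteq> S \<Longrightarrow> keys (scalar a * f) \<subseteq> S"
  using keys_scalar_mult[of a f] by blast

lemma keys_sum_subset: "(\<And>x. x \<in> I \<Longrightarrow> keys (F x) \<subseteq> S) \<Longrightarrow> keys (sum F I) \<subseteq> S" for F :: "'a \<Rightarrow> laurent"
proof (induction I rule: infinite_finite_induct)
  case (insert x I)
  then show ?case
    by (simp add: keys_add_subset)
qed simp_all

lemma keys_xmono [simp]: "keys (xmono \<nu>) = {\<nu>}"
  by (simp add: xmono_def)

lemma laurent_expand: "f = (\<Sum>\<nu>\<in>keys f. scalar (lookup f \<nu>) * xmono \<nu>)"
  using poly_mapping_sum_single[of f] by (simp add: single_eq_scalar_xmono)

lemma keys_linear_image: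
  assumes F: "\<And>f g. F (f + g) = F f + F g" "\<And>a f. F (scalar a * f) = scalar a * F f"
    and S: "keys f \<subseteq> S" "\<And>\<nu>. \<nu> \<in> S \<Longrightarrow> keys (F (xmono \<nu>)) \<subseteq> T"
  shows "keys (F f) \<subseteq> T"
proof -
  have "F f = (\<Sum>\<nu>\<in>keys f. scalar (lookup f \<nu>) * F (xmono \<nu>))"
    by (subst (1) laurent_expand[of f]) (simp add: additive_sum[OF F(1)] F(2))
  then show ?thesis
    using S by (auto intro!: keys_sum_subset keys_scalar_subset)
qed

lemma lower_mono: "prec n \<kappa> \<nu> \<Longrightarrow> lower s n w \<kappa> \<subseteq> lower s n w \<nu>"
  unfolding lower_def using prec_trans by blast

lemma triangular_keys:
  assumes "triangular s n w \<kappa> c f" "\<kappa> = \<nu> \<or> prec n \<kappa> \<nu>"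
  shows "keys f \<subseteq> insert (s (act w \<nu>)) (lower s n w \<nu>)"
    and "prec n \<kappa> \<nu> \<Longrightarrow> keys f \<subseteq> lower s n w \<nu>"
proof -
  obtain g where g: "f = scalar c * xmono (s (act w \<kappa>)) + g" "keys g \<subseteq> lower s n w \<kappa>"
    using assms(1) by (auto simp: triangular_def)
  have f: "keys f \<subseteq> insert (s (act w \<kappa>)) (lower s n w \<kappa>)"
    unfolding g(1) using g(2) by (intro keys_add_subset keys_scalar_subset) auto
  show 2: "keys f \<subseteq> lower s n w \<nu>" if "prec n \<kappa> \<nu>"
  proof -
    have "s (act w \<kappa>) \<in> lower s n w \<nu>"
      using that by (auto simp: lower_def)
    then show ?thesis
      using f lower_mono[OF that, of s w] by blast
  qed
  show "keys f \<subseteq> insert (s (act w \<nu>)) (lower s n w \<nu>)"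
    using f 2 assms(2) by blast
qed

lemma triangular_apply:
  assumes F: "\<And>f g. F (f + g) = F f + F g" "\<And>a f. F (scalar a * f) = scalar a * F f"
    and step: "\<And>\<kappa>. \<kappa> \<in> Zvec n \<Longrightarrow> triangular s n w' \<kappa> (d \<kappa>) (F (xmono (s (act w \<kappa>))))"
    and \<nu>: "\<nu> \<in> Zvec n" and f: "triangular s n w \<nu> c f"
  shows "triangular s n w' \<nu> (c * d \<nu>) (F f)"
proof -
  obtain g where g: "f = scalar c * xmono (s (act w \<nu>)) + g" "keys g \<subseteq> lower s n w \<nu>"
    using f by (auto simp: triangular_def)
  obtain h where h: "F (xmono (s (act w \<nu>))) = scalar (d \<nu>) * xmono (s (act w' \<nu>)) + h" "keys h \<subseteq> lower s n w' \<nu>"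
    using step[OF \<nu>] by (auto simp: triangular_def)
  have "keys (F g) \<subseteq> lower s n w' \<nu>"
  proof (rule keys_linear_image[OF F g(2)])
    fix \<rho> assume "\<rho> \<in> lower s n w \<nu>"
    then obtain \<kappa> where "\<rho> = s (act w \<kappa>)" "prec n \<kappa> \<nu>"
      by (auto simp: lower_def)
    then show "keys (F (xmono \<rho>)) \<subseteq> lower s n w' \<nu>"
      using triangular_keys(2)[OF step, of \<kappa> \<nu>] by (auto simp: prec_def)
  qed
  then have "keys (scalar c * h + F g) \<subseteq> lower s n w' \<nu>"
    using h(2) by (intro keys_add_subset keys_scalar_subset)
  moreover have "F f = scalar (c * d \<nu>) * xmono (s (act w' \<nu>)) + (scalar c * h + F g)"
    unfolding g(1) F h(1) by (simp add: scalar_mult algebra_simps)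
  ultimately show ?thesis
    unfolding triangular_def by blast
qed

text \<open>The sign \<open>s\<close> is \<open>+\<close> for the operators \<open>Yop\<close> and \<open>-\<close> for their adjoints.\<close>

definition is_sign :: "(expo \<Rightarrow> expo) \<Rightarrow> bool" where
  "is_sign s \<longleftrightarrow> s = id \<or> s = uminus"

lemma uminus_neq_id: "uminus \<noteq> (id :: expo \<Rightarrow> expo)"
proof
  assume "uminus = (id :: expo \<Rightarrow> expo)"
  then have "lookup (- single 0 1 :: expo) 0 = lookup (single 0 1 :: expo) 0"
    by (metis id_apply)
  then show False
    by simp
qed

lemma is_sign_simps:
  assumes "is_sign s"
  shows "s (s \<nu>) = \<nu>" "s (act w \<nu>) = act w (s \<nu>)"
  using assms by (auto simp: is_sign_def act_uminus)

lemma sum_transfer_two: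
  assumes "a \<in> {1..n}" "b \<in> {1..n}" "a \<noteq> b" "\<And>p. p \<noteq> a \<Longrightarrow> p \<noteq> b \<Longrightarrow> lookup \<kappa>' p = lookup \<kappa> p"
    "lookup \<kappa>' a + lookup \<kappa>' b = lookup \<kappa> a + lookup \<kappa> b"
  shows "psum n \<kappa>' = psum n \<kappa>"
proof -
  define C where "C = {1..n} - {a, b}"
  have C: "{1..n} = insert a (insert b C)" "a \<notin> C" "b \<notin> C" "finite C"
    using assms by (auto simp: C_def)
  have "(\<Sum>j\<in>C. lookup \<kappa>' j) = (\<Sum>j\<in>C. lookup \<kappa> j)"
    using C by (intro sum.cong refl assms(4)) auto
  then show ?thesis
    unfolding psum_def C(1) using C assms by simp
qed

lemma prec_interior:
  assumes "a \<in> {1..n}" "b \<in> {1..n}" "a \<noteq> b" "\<kappa> \<in> Zvec n" "\<And>p. p \<noteq> a \<Longrightarrow> p \<noteq> b \<Longrightarrow> lookup \<kappa>' p = lookup \<kappa> p"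
    "lookup \<kappa>' a + lookup \<kappa>' b = lookup \<kappa> a + lookup \<kappa> b"
    "lookup \<kappa> a < lookup \<kappa>' a" "lookup \<kappa>' a < lookup \<kappa> b"
  shows "prec n \<kappa>' \<kappa>"
proof -
  have "\<kappa>' \<in> Zvec n"
    using assms(1,2,4,5) unfolding Zvec_iff by metis
  then show ?thesis
    unfolding prec_def using assms DBlex_less_interior[OF assms(1-3,5-8)] sum_transfer_two[OF assms(1-3,5,6)] by blast
qed

lemma prec_swap:
  assumes "1 \<le> a" "a < b" "b \<le> n" "\<kappa> \<in> Zvec n" "lookup \<kappa> a < lookup \<kappa> b"
  shows "prec n (act (transpose a b) \<kappa>) \<kappa>"
proof -
  have "transpose a b permutes {1..n}"
    using assms by (intro permutes_swap_id) auto
  then have "act (transpose a b) \<kappa> \<in> Zvec n"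
    using assms act_Zvec by blast
  moreover have "psum n (act (transpose a b) \<kappa>) = psum n \<kappa>"
    using assms by (intro sum_transfer_two[of a _ b]) (auto simp: lookup_act_transpose)
  ultimately show ?thesis
    unfolding prec_def using assms DBlex_less_swap[OF assms(1-3,5)] by blast
qed

section \<open>One Demazure--Lusztig operator on rearranged exponents\<close>

context
  fixes n j :: nat and w :: "nat \<Rightarrow> nat" and s :: "expo \<Rightarrow> expo" and a b :: nat
  assumes j: "1 \<le> j" "j < n" and w: "w permutes {1..n}" and s: "is_sign s"
    and wab: "w b = j" "w a = Suc j"
begin

lemma ab: "a \<in> {1..n}" "b \<in> {1..n}" "a \<noteq> b"
  using permutes_in_image[OF w, of a] permutes_in_image[OF w, of b] wab j by auto

lemma w_eq: "w p = j \<longleftrightarrow> p = b" "w p = Suc j \<longleftrightarrow> p = a"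
  using inj_eq[OF permutes_inj[OF w], of p b] inj_eq[OF permutes_inj[OF w], of p a] unfolding wab by blast+

lemma sw_w: "sw j \<circ> w = w \<circ> transpose a b"
proof
  fix p
  show "(sw j \<circ> w) p = (w \<circ> transpose a b) p"
    using ab(3) wab w_eq[of p] by (simp add: transpose_def)
qed

text \<open>\<kappa>' is a point of the root string through \<rho>, read in the new positions
  \<open>sw j \<circ> w\<close>. The term \<open>lookup (s (single 0 z)) 0\<close> stands for
  \<open>z\<close> or \<open>- z\<close>, according to the sign.\<close>

lemma lookup_string:
  assumes \<rho>: "\<rho> = s (act w \<kappa>)" and \<kappa>': "\<kappa>' = act (transpose a b) (act (inv w) (s (\<rho> + zmul z (aroot j))))"
  shows "s (act (sw j \<circ> w) \<kappa>') = \<rho> + zmul z (aroot j)"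
    and "lookup \<kappa>' a = lookup \<kappa> b + lookup (s (single 0 z)) 0"
    and "lookup \<kappa>' b = lookup \<kappa> a - lookup (s (single 0 z)) 0"
    and "p \<noteq> a \<Longrightarrow> p \<noteq> b \<Longrightarrow> lookup \<kappa>' p = lookup \<kappa> p"
proof -
  have inv: "act (inv w) (act w \<nu>) = \<nu>" "act w (act (inv w) \<nu>) = \<nu>" for \<nu>
    using permutes_inv_o[OF w] by (simp_all add: act_act)
  show "s (act (sw j \<circ> w) \<kappa>') = \<rho> + zmul z (aroot j)"
    unfolding sw_w \<kappa>' by (simp add: act_act[symmetric] inv is_sign_simps[OF s])
  have "act (transpose a b) \<kappa>' = act (inv w) (s (\<rho> + zmul z (aroot j)))"
    by (simp add: \<kappa>')
  also have "\<dots> = \<kappa> + act (inv w) (s (zmul z (aroot j)))"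
    unfolding \<rho> using s inv by (auto simp: is_sign_def act_add act_minus act_uminus)
  finally have *: "lookup (act (transpose a b) \<kappa>') p = lookup \<kappa> p + lookup (s (zmul z (aroot j))) (w p)" for p
    using lookup_act_permutes[OF permutes_inv[OF w]] permutes_inv_inv[OF w] by (simp add: lookup_add)
  have st: "lookup (s (zmul z (aroot j))) j = lookup (s (single 0 z)) 0"
    "lookup (s (zmul z (aroot j))) (Suc j) = - lookup (s (single 0 z)) 0"
    "p \<noteq> j \<Longrightarrow> p \<noteq> Suc j \<Longrightarrow> lookup (s (zmul z (aroot j))) p = 0" for p
    using s by (auto simp: is_sign_def lookup_aroot)
  show "lookup \<kappa>' a = lookup \<kappa> b + lookup (s (single 0 z)) 0"
    using *[of b] st wab by (simp add: lookup_act_transpose)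
  show "lookup \<kappa>' b = lookup \<kappa> a - lookup (s (single 0 z)) 0"
    using *[of a] st wab by (simp add: lookup_act_transpose)
  show "lookup \<kappa>' p = lookup \<kappa> p" if "p \<noteq> a" "p \<noteq> b"
    using *[of p] st(3)[of "w p"] w_eq[of p] that by (simp add: lookup_act_transpose transpose_def)
qed

lemma lookup_s_act: "lookup (s (act w \<kappa>)) j = lookup (s (single 0 (lookup \<kappa> b))) 0"
  "lookup (s (act w \<kappa>)) (Suc j) = lookup (s (single 0 (lookup \<kappa> a))) 0"
  using s lookup_act_permutes'[OF w, of \<kappa> b] lookup_act_permutes'[OF w, of \<kappa> a] wab by (auto simp: is_sign_def)

lemma string_interior:
  assumes \<kappa>: "\<kappa> \<in> Zvec n" and \<rho>: "\<rho> = s (act w \<kappa>)"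
    and z: "(0 < z \<and> z < lookup \<rho> (Suc j) - lookup \<rho> j) \<or> (lookup \<rho> (Suc j) - lookup \<rho> j < z \<and> z < 0)"
  shows "\<rho> + zmul z (aroot j) \<in> lower s n (sw j \<circ> w) \<kappa>"
proof -
  define \<kappa>' where "\<kappa>' = act (transpose a b) (act (inv w) (s (\<rho> + zmul z (aroot j))))"
  note st = lookup_string[OF \<rho> \<kappa>'_def]
  have "(lookup \<kappa> a < lookup \<kappa>' a \<and> lookup \<kappa>' a < lookup \<kappa> b) \<or> (lookup \<kappa> b < lookup \<kappa>' b \<and> lookup \<kappa>' b < lookup \<kappa> a)"
    using z s unfolding \<rho> lookup_s_act st(2,3) by (auto simp: is_sign_def)
  then have "prec n \<kappa>' \<kappa>"
  proof
    assume "lookup \<kappa> a < lookup \<kappa>' a \<and> lookup \<kappa>' a < lookup \<kappa> b"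
    then show ?thesis
      using st ab \<kappa> by (intro prec_interior[of a n b]) auto
  next
    assume "lookup \<kappa> b < lookup \<kappa>' b \<and> lookup \<kappa>' b < lookup \<kappa> a"
    then show ?thesis
      using st ab \<kappa> by (intro prec_interior[of b n a]) auto
  qed
  then show ?thesis
    unfolding lower_def st(1)[symmetric] by blast
qed

text \<open>In the new positions the unchanged monomial reads as \<kappa> with the entries at
  \<open>a\<close> and \<open>b\<close> exchanged; this is smaller if the larger entry stood
  later.\<close>

lemma string_end:
  assumes \<kappa>: "\<kappa> \<in> Zvec n" and less: "(a < b \<and> lookup \<kappa> a < lookup \<kappa> b) \<or> (b < a \<and> lookup \<kappa> b < lookup \<kappa> a)"
  shows "s (act w \<kappa>) \<in> lower s n (sw j \<circ> w) \<kappa>"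
proof -
  have "act w \<kappa> = act (sw j \<circ> w) (act (transpose a b) \<kappa>)"
    unfolding sw_w by (simp add: act_act[symmetric])
  moreover have "prec n (act (transpose a b) \<kappa>) \<kappa>"
    using less prec_swap[of a b n \<kappa>] prec_swap[of b a n \<kappa>] ab \<kappa> by (auto simp: transpose_commute)
  ultimately show ?thesis
    unfolding lower_def by auto
qed

lemma triangularI:
  assumes "f = scalar c * xmono (act (sw j) (s (act w \<kappa>))) + g" "keys g \<subseteq> lower s n (sw j \<circ> w) \<kappa>"
  shows "triangular s n (sw j \<circ> w) \<kappa> c f"
proof -
  have "act (sw j) (s (act w \<kappa>)) = s (act (sw j \<circ> w) \<kappa>)"
    by (simp add: act_act[symmetric] is_sign_simps[OF s])
  then show ?thesis
    using assms unfolding triangular_def by auto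
qed

text \<open>The term \<rho> itself occurs only if its entry at \<open>j\<close> exceeds the one at
  \<open>j + 1\<close>, and the side condition makes it lower then. In the opposite case all further
  terms are interior and the leading coefficient is \<open>t\<close>.\<close>

lemma DL_triangular:
  assumes \<kappa>: "\<kappa> \<in> Zvec n" and side: "if s = id then a < b else b < a"
  shows "triangular s n (sw j \<circ> w) \<kappa> (if lookup \<kappa> (min a b) > lookup \<kappa> (max a b) then tK else 1)
    (DL j (xmono (s (act w \<kappa>))))"
proof -
  define \<rho> where "\<rho> = s (act w \<kappa>)"
  note lk = lookup_s_act[of \<kappa>, folded \<rho>_def]
  note inner = string_interior[OF \<kappa> \<rho>_def]
  show ?thesis
  proof (cases "lookup \<rho> (Suc j) \<le> lookup \<rho> j")
    case True
    define N where "N = nat (lookup \<rho> j - lookup \<rho> (Suc j))"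
    have N: "lookup \<rho> j - lookup \<rho> (Suc j) = int N"
      using True by (simp add: N_def)
    have "\<not> lookup \<kappa> (max a b) < lookup \<kappa> (min a b)"
      using True side s lk by (auto simp: is_sign_def split: if_splits)
    moreover have "keys (scalar (1 - tK) * (\<Sum>k<N. xmono (\<rho> - zmul (int k) (aroot j)))) \<subseteq> lower s n (sw j \<circ> w) \<kappa>"
    proof (intro keys_scalar_subset keys_sum_subset)
      fix k assume k: "k \<in> {..<N}"
      have "\<rho> - zmul (int k) (aroot j) \<in> lower s n (sw j \<circ> w) \<kappa>"
      proof (cases "k = 0")
        case True
        have "(a < b \<and> lookup \<kappa> a < lookup \<kappa> b) \<or> (b < a \<and> lookup \<kappa> b < lookup \<kappa> a)"
          using k N side s lk by (auto simp: is_sign_def split: if_splits)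
        then show ?thesis
          using string_end[OF \<kappa>] True by (simp add: zmul_simps \<rho>_def)
      next
        case False
        have "\<rho> - zmul (int k) (aroot j) = \<rho> + zmul (- int k) (aroot j)"
          by (rule poly_mapping_eqI) (simp add: lookup_add lookup_minus)
        moreover have "\<rho> + zmul (- int k) (aroot j) \<in> lower s n (sw j \<circ> w) \<kappa>"
          using False k N by (intro inner) auto
        ultimately show ?thesis
          by (simp only:)
      qed
      then show "keys (xmono (\<rho> - zmul (int k) (aroot j))) \<subseteq> lower s n (sw j \<circ> w) \<kappa>"
        by simp
    qed
    ultimately show ?thesis
      unfolding \<rho>_def[symmetric] DL_xmono_ge[OF N] by (intro triangularI) (auto simp: \<rho>_def)
  next
    case False
    define N where "N = nat (lookup \<rho> (Suc j) - lookup \<rho> j - 1)"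
    have N: "lookup \<rho> (Suc j) - lookup \<rho> j = int (Suc N)"
      using False by (simp add: N_def)
    have "lookup \<kappa> (max a b) < lookup \<kappa> (min a b)"
      using False side s lk by (auto simp: is_sign_def split: if_splits)
    moreover have "keys (scalar (- (1 - tK)) * (\<Sum>k<N. xmono (\<rho> + zmul (int (Suc k)) (aroot j)))) \<subseteq> lower s n (sw j \<circ> w) \<kappa>"
    proof (intro keys_scalar_subset keys_sum_subset)
      fix k assume "k \<in> {..<N}"
      then have "\<rho> + zmul (int (Suc k)) (aroot j) \<in> lower s n (sw j \<circ> w) \<kappa>"
        using N by (intro inner) auto
      then show "keys (xmono (\<rho> + zmul (int (Suc k)) (aroot j))) \<subseteq> lower s n (sw j \<circ> w) \<kappa>"
        by simp
    qed
    moreover have "DL j (xmono \<rho>) = scalar tK * xmono (act (sw j) \<rho>) +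
        scalar (- (1 - tK)) * (\<Sum>k<N. xmono (\<rho> + zmul (int (Suc k)) (aroot j)))"
      unfolding DL_xmono_less[OF N] scalar_uminus by simp
    ultimately show ?thesis
      unfolding \<rho>_def[symmetric] by (intro triangularI) (simp_all only: \<rho>_def if_True)
  qed
qed

text \<open>For the inverse the end point \<rho> occurs in the opposite case, when its entry at
  \<open>j\<close> is the smaller one; this is why the side condition is reversed.\<close>

lemma DLi_triangular:
  assumes \<kappa>: "\<kappa> \<in> Zvec n" and side: "if s = id then b < a else a < b"
  shows "triangular s n (sw j \<circ> w) \<kappa> (if lookup \<kappa> (min a b) > lookup \<kappa> (max a b) then inverse tK else 1)
    (DLi j (xmono (s (act w \<kappa>))))"
proof -
  define \<rho> where "\<rho> = s (act w \<kappa>)"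
  note lk = lookup_s_act[of \<kappa>, folded \<rho>_def]
  note inner = string_interior[OF \<kappa> \<rho>_def]
  consider "lookup \<rho> (Suc j) < lookup \<rho> j" | "lookup \<rho> (Suc j) = lookup \<rho> j" | "lookup \<rho> j < lookup \<rho> (Suc j)"
    by linarith
  then show ?thesis
  proof cases
    case 1
    define N where "N = nat (lookup \<rho> j - lookup \<rho> (Suc j) - 1)"
    have N: "lookup \<rho> j - lookup \<rho> (Suc j) = int (Suc N)"
      using 1 by (simp add: N_def)
    define g where "g = (\<Sum>k<N. xmono (\<rho> - zmul (int (Suc k)) (aroot j)))"
    have "lookup \<kappa> (max a b) < lookup \<kappa> (min a b)"
      using 1 side s lk by (auto simp: is_sign_def split: if_splits)
    moreover have "keys (scalar (inverse tK) * (scalar (1 - tK) * g)) \<subseteq> lower s n (sw j \<circ> w) \<kappa>"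
      unfolding g_def
    proof (intro keys_scalar_subset keys_sum_subset)
      fix k assume k: "k \<in> {..<N}"
      have "\<rho> - zmul (int (Suc k)) (aroot j) = \<rho> + zmul (- int (Suc k)) (aroot j)"
        by (rule poly_mapping_eqI) (simp add: lookup_add lookup_minus algebra_simps)
      also have "\<dots> \<in> lower s n (sw j \<circ> w) \<kappa>"
        using k N by (intro inner) auto
      finally show "keys (xmono (\<rho> - zmul (int (Suc k)) (aroot j))) \<subseteq> lower s n (sw j \<circ> w) \<kappa>"
        by simp
    qed
    moreover have "DLi j (xmono \<rho>) = scalar (inverse tK) * xmono (act (sw j) \<rho>) + scalar (inverse tK) * (scalar (1 - tK) * g)"
    proof -
      have "(\<Sum>k<Suc N. xmono (\<rho> - zmul (int k) (aroot j))) = xmono \<rho> + g"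
        unfolding g_def by (subst sum.lessThan_Suc_shift) (simp add: zmul_simps)
      then have "DL j (xmono \<rho>) + scalar (tK - 1) * xmono \<rho> = xmono (act (sw j) \<rho>) + scalar (1 - tK) * g"
        unfolding DL_xmono_ge[OF N] by (simp add: scalar_minus algebra_simps)
      then show ?thesis
        unfolding DLi_def by (simp add: distrib_left)
    qed
    ultimately show ?thesis
      unfolding \<rho>_def[symmetric] by (intro triangularI) (auto simp: \<rho>_def)
  next
    case 2
    have "\<not> lookup \<kappa> (max a b) < lookup \<kappa> (min a b)"
      using 2 side s lk by (auto simp: is_sign_def split: if_splits)
    moreover have "DL j (xmono \<rho>) = xmono (act (sw j) \<rho>)"
      using DL_xmono_ge[of \<rho> j 0] 2 by simp
    moreover have "act (sw j) \<rho> = \<rho>"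
      using 2 by (simp add: act_adj_eq zmul_simps)
    ultimately have "DLi j (xmono \<rho>) = scalar 1 * xmono (act (sw j) \<rho>) + 0"
      by (metis DLi_DL add.right_neutral mult_1 scalar_1)
    with \<open>\<not> lookup \<kappa> (max a b) < lookup \<kappa> (min a b)\<close> show ?thesis
      unfolding \<rho>_def[symmetric] by (intro triangularI[where g = 0]) (auto simp: \<rho>_def)
  next
    case 3
    define N where "N = nat (lookup \<rho> (Suc j) - lookup \<rho> j - 1)"
    have N: "lookup \<rho> (Suc j) - lookup \<rho> j = int (Suc N)"
      using 3 by (simp add: N_def)
    define g where "g = (\<Sum>k<N. xmono (\<rho> + zmul (int (Suc k)) (aroot j)))"
    have "\<not> lookup \<kappa> (max a b) < lookup \<kappa> (min a b)"
      using 3 side s lk by (auto simp: is_sign_def split: if_splits)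
    moreover have "keys (scalar (inverse tK) * (scalar (tK - 1) * (xmono \<rho> + g))) \<subseteq> lower s n (sw j \<circ> w) \<kappa>"
      unfolding g_def
    proof (intro keys_scalar_subset keys_add_subset keys_sum_subset)
      have "(a < b \<and> lookup \<kappa> a < lookup \<kappa> b) \<or> (b < a \<and> lookup \<kappa> b < lookup \<kappa> a)"
        using 3 side s lk by (auto simp: is_sign_def split: if_splits)
      then show "keys (xmono \<rho>) \<subseteq> lower s n (sw j \<circ> w) \<kappa>"
        using string_end[OF \<kappa>] by (simp add: \<rho>_def)
      fix k assume "k \<in> {..<N}"
      then have "\<rho> + zmul (int (Suc k)) (aroot j) \<in> lower s n (sw j \<circ> w) \<kappa>"
        using N by (intro inner) auto
      then show "keys (xmono (\<rho> + zmul (int (Suc k)) (aroot j))) \<subseteq> lower s n (sw j \<circ> w) \<kappa>"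
        by simp
    qed
    moreover have "DLi j (xmono \<rho>) = scalar 1 * xmono (act (sw j) \<rho>) + scalar (inverse tK) * (scalar (tK - 1) * (xmono \<rho> + g))"
    proof -
      have "DL j (xmono \<rho>) + scalar (tK - 1) * xmono \<rho> = scalar tK * xmono (act (sw j) \<rho>) + scalar (tK - 1) * (xmono \<rho> + g)"
        unfolding DL_xmono_less[OF N] g_def by (simp add: scalar_minus algebra_simps del: of_nat_Suc)
      then show ?thesis
        unfolding DLi_def by (simp add: distrib_left scalar_inverse_cancel)
    qed
    ultimately show ?thesis
      unfolding \<rho>_def[symmetric] by (intro triangularI) (auto simp: \<rho>_def)
  qed
qed

end

section \<open>Eigenvalues of the Cherednik operators\<close>

text \<open>The product as it accumulates along the factors of \<open>Y_i\<close>; its closed form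
  is \<open>eigval_eq_prod\<close>.\<close>

definition eigval :: "nat \<Rightarrow> nat \<Rightarrow> expo \<Rightarrow> qtfield" where
  "eigval n i \<nu> = qK powi (- lookup \<nu> i) *
    ((\<Prod>k<n - i. if lookup \<nu> i > lookup \<nu> (i + Suc k) then inverse tK else 1) *
     (\<Prod>k<i - 1. if lookup \<nu> (Suc k) > lookup \<nu> i then tK else 1))"

text \<open>Positions of the exponents while the factors of \<open>Yop\<close> to the right, respectively to the
  left, of the rotation are applied.\<close>

definition stage1 :: "nat \<Rightarrow> nat \<Rightarrow> nat \<Rightarrow> nat" where
  "stage1 i k l = (if l = i then i + k else if i < l \<and> l \<le> i + k then l - 1 else l)"

definition stage2 :: "nat \<Rightarrow> nat \<Rightarrow> nat \<Rightarrow> nat" where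
  "stage2 i k l = (if l = i then Suc k else if k < l \<and> l < i then Suc l else l)"

lemma stage1_0: "stage1 i 0 = id"
  by (auto simp: stage1_def fun_eq_iff)

lemma stage1_Suc: "stage1 i (Suc k) = sw (i + k) \<circ> stage1 i k"
  by (auto simp: stage1_def transpose_def fun_eq_iff)

lemma stage1_Suc': "stage1 i k = sw (i + k) \<circ> stage1 i (Suc k)"
  by (auto simp: stage1_Suc fun_eq_iff)

lemma stage2_end: "1 \<le> i \<Longrightarrow> stage2 i (i - Suc 0) = id"
  by (auto simp: stage2_def fun_eq_iff)

lemma stage2_Suc: "Suc k < i \<Longrightarrow> stage2 i (Suc k) = sw (Suc k) \<circ> stage2 i k"
  by (auto simp: stage2_def transpose_def fun_eq_iff)

lemma stage2_Suc': "Suc k < i \<Longrightarrow> stage2 i k = sw (Suc k) \<circ> stage2 i (Suc k)"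
  by (auto simp: stage2_Suc fun_eq_iff)

lemma stage2_0: "1 \<le> i \<Longrightarrow> i \<le> n \<Longrightarrow> stage2 i 0 l = rot n (stage1 i (n - i) l)"
  by (auto simp: stage1_def stage2_def rot_def)

lemma stage1_permutes: "1 \<le> i \<Longrightarrow> i + k \<le> n \<Longrightarrow> stage1 i k permutes {1..n}"
proof (induction k)
  case 0
  show ?case
    unfolding stage1_0 by (rule permutes_id)
next
  case (Suc k)
  then show ?case
    unfolding stage1_Suc by (intro permutes_compose sw_permutes) auto
qed

lemma rot_permutes: "n \<ge> 1 \<Longrightarrow> rot n permutes {1..n}"
  using bij_rot[of n] unfolding permutes_def bij_iff by (auto simp: rot_def)

lemma stage2_permutes: "1 \<le> i \<Longrightarrow> i \<le> n \<Longrightarrow> k < i \<Longrightarrow> stage2 i k permutes {1..n}"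
proof (induction k)
  case 0
  have "stage2 i 0 = rot n \<circ> stage1 i (n - i)"
    using 0 by (simp add: fun_eq_iff stage2_0)
  moreover have "rot n \<circ> stage1 i (n - i) permutes {1..n}"
    using 0 by (intro permutes_compose stage1_permutes rot_permutes) auto
  ultimately show ?case
    by (simp only:)
next
  case (Suc k)
  then show ?case
    unfolding stage2_Suc[OF Suc.prems(3)] by (intro permutes_compose sw_permutes) auto
qed

context
  fixes n i :: nat and \<nu> :: expo
  assumes i: "1 \<le> i" "i \<le> n" and \<nu>: "\<nu> \<in> Zvec n"
begin

text \<open>The entry at \<open>i\<close> travels right past its successors, and passing a smaller
  one contributes \<open>t^{-1}\<close>.\<close>

lemma upi_triangular:
  assumes "triangular id n id \<nu> c f" "k \<le> n - i"
  shows "triangular id n (stage1 i k) \<nu>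
    (c * (\<Prod>k<k. if lookup \<nu> i > lookup \<nu> (i + Suc k) then inverse tK else 1)) (upi k i f)"
  using assms(2)
proof (induction k)
  case 0
  show ?case
    using assms(1) by (simp only: stage1_0 lessThan_0 prod.empty mult_1_right upi.simps)
next
  case (Suc k)
  define d where "d \<kappa> = (if lookup \<kappa> i > lookup \<kappa> (i + Suc k) then inverse tK else 1)" for \<kappa> :: expo
  have "triangular id n (sw (i + k) \<circ> stage1 i k) \<kappa> (d \<kappa>) (DLi (i + k) (xmono (id (act (stage1 i k) \<kappa>))))"
    if "\<kappa> \<in> Zvec n" for \<kappa>
  proof -
    have "min (i + Suc k) i = i" "max (i + Suc k) i = i + Suc k"
      by auto
    moreover have w: "stage1 i k permutes {1..n}"
      using Suc.prems i by (intro stage1_permutes) auto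
    moreover have "triangular id n (sw (i + k) \<circ> stage1 i k) \<kappa>
      (if lookup \<kappa> (min (i + Suc k) i) > lookup \<kappa> (max (i + Suc k) i) then inverse tK else 1)
      (DLi (i + k) (xmono (id (act (stage1 i k) \<kappa>))))"
      by (rule DLi_triangular[OF _ _ w]) (use that Suc.prems i in \<open>auto simp: is_sign_def stage1_def\<close>)
    ultimately show ?thesis
      by (simp only: d_def)
  qed
  from triangular_apply[where F = "DLi (i + k)", OF DLi_add DLi_scalar this \<nu> Suc.IH[OF Suc_leD[OF Suc.prems]]]
  show ?case
    by (simp only: stage1_Suc d_def upi.simps prod.lessThan_Suc mult.assoc)
qed

lemma up_triangular:
  assumes "triangular id n (stage2 i 0) \<nu> c f" "k \<le> i - 1"
  shows "triangular id n (stage2 i k) \<nu>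
    (c * (\<Prod>k<k. if lookup \<nu> (Suc k) > lookup \<nu> i then tK else 1)) (up k 1 f)"
  using assms(2)
proof (induction k)
  case 0
  show ?case
    using assms(1) by (simp only: lessThan_0 prod.empty mult_1_right up.simps)
next
  case (Suc k)
  then have k: "Suc k < i" by simp
  define d where "d \<kappa> = (if lookup \<kappa> (Suc k) > lookup \<kappa> i then tK else 1)" for \<kappa> :: expo
  have "triangular id n (sw (1 + k) \<circ> stage2 i k) \<kappa> (d \<kappa>) (DL (1 + k) (xmono (id (act (stage2 i k) \<kappa>))))"
    if "\<kappa> \<in> Zvec n" for \<kappa>
  proof -
    have "min (Suc k) i = Suc k" "max (Suc k) i = i"
      using k by auto
    moreover have w: "stage2 i k permutes {1..n}"
      using k i by (intro stage2_permutes) auto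
    moreover have "triangular id n (sw (1 + k) \<circ> stage2 i k) \<kappa>
      (if lookup \<kappa> (min (Suc k) i) > lookup \<kappa> (max (Suc k) i) then tK else 1)
      (DL (1 + k) (xmono (id (act (stage2 i k) \<kappa>))))"
      by (rule DL_triangular[OF _ _ w]) (use that k i in \<open>auto simp: is_sign_def stage2_def\<close>)
    ultimately show ?thesis
      by (simp only: d_def)
  qed
  from triangular_apply[where F = "DL (1 + k)", OF DL_add DL_scalar this \<nu> Suc.IH[OF Suc_leD[OF Suc.prems]]]
  show ?case
    by (simp only: stage2_Suc[OF k] d_def up.simps prod.lessThan_Suc mult.assoc plus_1_eq_Suc)
qed

text \<open>The adjoint runs through the stages backwards on negated exponents. Each factor meets
  the same pair of entries as in \<open>Yop\<close> and gives the same scalar, so the eigenvalues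
  coincide.\<close>

lemma down_triangular:
  assumes "triangular uminus n (stage2 i k) \<nu> c f" "k \<le> i - 1"
  shows "triangular uminus n (stage2 i 0) \<nu>
    (c * (\<Prod>k<k. if lookup \<nu> (Suc k) > lookup \<nu> i then tK else 1)) (down k 1 f)"
  using assms
proof (induction k arbitrary: c f)
  case (Suc k)
  then have k: "Suc k < i" by simp
  define d where "d \<kappa> = (if lookup \<kappa> (Suc k) > lookup \<kappa> i then tK else 1)" for \<kappa> :: expo
  have "triangular uminus n (sw (1 + k) \<circ> stage2 i (Suc k)) \<kappa> (d \<kappa>) (DL (1 + k) (xmono (- (act (stage2 i (Suc k)) \<kappa>))))"
    if "\<kappa> \<in> Zvec n" for \<kappa>
  proof -
    have "min i (Suc k) = Suc k" "max i (Suc k) = i" "stage2 i (Suc k) permutes {1..n}"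
      using k i stage2_permutes[of i n "Suc k"] by auto
    moreover from this(3) have "triangular uminus n (sw (1 + k) \<circ> stage2 i (Suc k)) \<kappa>
      (if lookup \<kappa> (min i (Suc k)) > lookup \<kappa> (max i (Suc k)) then tK else 1)
      (DL (1 + k) (xmono (- (act (stage2 i (Suc k)) \<kappa>))))"
      by (rule DL_triangular[where s = uminus and a = i and b = "Suc k", rotated 2])
        (use that k i uminus_neq_id in \<open>auto simp: is_sign_def stage2_def\<close>)
    ultimately show ?thesis
      by (simp only: d_def)
  qed
  from triangular_apply[where F = "DL (1 + k)" and s = uminus, OF DL_add DL_scalar this \<nu> Suc.prems(1)]
  have "triangular uminus n (stage2 i k) \<nu> (c * d \<nu>) (DL (1 + k) f)"
    using k by (simp add: stage2_Suc'[symmetric])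
  from Suc.IH[OF this] k show ?case
    by (simp add: d_def mult_ac)
qed simp

lemma downi_triangular:
  assumes "triangular uminus n (stage1 i k) \<nu> c f" "k \<le> n - i"
  shows "triangular uminus n id \<nu>
    (c * (\<Prod>k<k. if lookup \<nu> i > lookup \<nu> (i + Suc k) then inverse tK else 1)) (downi k i f)"
  using assms
proof (induction k arbitrary: c f)
  case 0
  then show ?case
    by (simp only: stage1_0 lessThan_0 prod.empty mult_1_right downi.simps)
next
  case (Suc k)
  define d where "d \<kappa> = (if lookup \<kappa> i > lookup \<kappa> (i + Suc k) then inverse tK else 1)" for \<kappa> :: expo
  have "triangular uminus n (sw (i + k) \<circ> stage1 i (Suc k)) \<kappa> (d \<kappa>) (DLi (i + k) (xmono (- (act (stage1 i (Suc k)) \<kappa>))))"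
    if "\<kappa> \<in> Zvec n" for \<kappa>
  proof -
    have "min i (i + Suc k) = i" "max i (i + Suc k) = i + Suc k" "stage1 i (Suc k) permutes {1..n}"
      using Suc.prems i stage1_permutes[of i "Suc k" n] by auto
    moreover from this(3) have "triangular uminus n (sw (i + k) \<circ> stage1 i (Suc k)) \<kappa>
      (if lookup \<kappa> (min i (i + Suc k)) > lookup \<kappa> (max i (i + Suc k)) then inverse tK else 1)
      (DLi (i + k) (xmono (- (act (stage1 i (Suc k)) \<kappa>))))"
      by (rule DLi_triangular[where s = uminus and a = i and b = "i + Suc k", rotated 2])
        (use that Suc.prems i uminus_neq_id in \<open>auto simp: is_sign_def stage1_def\<close>)
    ultimately show ?thesis
      by (simp only: d_def)
  qed
  from triangular_apply[where F = "DLi (i + k)" and s = uminus, OF DLi_add DLi_scalar this \<nu> Suc.prems(1)]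
  have "triangular uminus n (stage1 i k) \<nu> (c * d \<nu>) (DLi (i + k) f)"
    by (simp add: stage1_Suc'[symmetric])
  from Suc.IH[OF this] Suc.prems show ?case
    by (simp add: d_def mult_ac)
qed

end

lemma chi_point:
  assumes "m \<in> {1..n}" "\<nu> \<in> Zvec n"
  shows "chi (\<lambda>i. if i = m then c else 1) \<nu> = c powi lookup \<nu> m"
proof -
  have "chi (\<lambda>i. if i = m then c else 1) \<nu> = (\<Prod>i\<in>{1..n}. (if i = m then c else 1) powi lookup \<nu> i)"
    using assms(2) by (intro chi_superset) (auto simp: Zvec_def)
  also have "\<dots> = (\<Prod>i\<in>{m}. c powi lookup \<nu> i)"
    using assms(1) by (intro prod.mono_neutral_cong_right) auto
  finally show ?thesis
    by simp
qed

text \<open>Monomials go to monomials, so there are no lower terms. The travelling entry stands at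
  position \<open>n\<close> and yields the power of \<open>q\<close>.\<close>

lemma Rq_triangular:
  assumes i: "1 \<le> i" "i \<le> n" and \<kappa>: "\<kappa> \<in> Zvec n"
  shows "triangular id n (stage2 i 0) \<kappa> (qK powi (- lookup \<kappa> i)) (Rq n (xmono (id (act (stage1 i (n - i)) \<kappa>))))"
proof -
  let ?w = "stage1 i (n - i)"
  have w: "?w permutes {1..n}"
    using i by (intro stage1_permutes) auto
  have "lookup (act ?w \<kappa>) n = lookup \<kappa> i"
    using lookup_act_permutes'[OF w, of \<kappa> i] i by (simp add: stage1_def)
  then have "chi (\<lambda>i. if i = n then inverse qK else 1) (act ?w \<kappa>) = qK powi (- lookup \<kappa> i)"
    using i act_Zvec[OF w \<kappa>] by (subst chi_point) (auto simp: power_int_minus power_int_inverse)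
  moreover have "act (rot n) (act ?w \<kappa>) = act (stage2 i 0) \<kappa>"
    unfolding act_act by (rule act_cong) (simp add: stage2_0[OF i])
  ultimately show ?thesis
    unfolding triangular_def Rq_def by (intro exI[of _ 0]) (simp add: msubst_xmono)
qed

lemma Rqi_triangular:
  assumes i: "1 \<le> i" "i \<le> n" and \<kappa>: "\<kappa> \<in> Zvec n"
  shows "triangular uminus n (stage1 i (n - i)) \<kappa> (qK powi (- lookup \<kappa> i)) (Rqi n (xmono (- (act (stage2 i 0) \<kappa>))))"
proof -
  let ?w = "stage2 i 0"
  have w: "?w permutes {1..n}"
    using i by (intro stage2_permutes) auto
  have "lookup (act ?w \<kappa>) 1 = lookup \<kappa> i"
    using lookup_act_permutes'[OF w, of \<kappa> i] i by (simp add: stage2_def)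
  then have "chi (\<lambda>i. if i = 1 then qK else 1) (- act ?w \<kappa>) = qK powi (- lookup \<kappa> i)"
    using i Zvec_uminus[OF act_Zvec[OF w \<kappa>]] by (subst chi_point) auto
  moreover have "act (irot n) (act ?w \<kappa>) = act (stage1 i (n - i)) \<kappa>"
    unfolding act_act by (rule act_cong) (use i in \<open>simp add: stage2_0 irot_rot\<close>)
  ultimately show ?thesis
    unfolding triangular_def Rqi_def by (intro exI[of _ 0]) (simp add: msubst_xmono act_uminus)
qed

lemma triangular_xmono: "triangular s n id \<nu> 1 (xmono (s \<nu>))"
  unfolding triangular_def by (intro exI[of _ 0]) simp

lemma Yop_triangular:
  assumes i: "1 \<le> i" "i \<le> n" and \<nu>: "\<nu> \<in> Zvec n"
  shows "triangular id n id \<nu> (eigval n i \<nu>) (Yop n i (xmono \<nu>))"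
proof -
  let ?A = "\<Prod>k<n - i. if lookup \<nu> i > lookup \<nu> (i + Suc k) then inverse tK else 1"
  have "triangular id n (stage1 i (n - i)) \<nu> ?A (upi (n - i) i (xmono \<nu>))"
    using upi_triangular[OF i \<nu> triangular_xmono] by simp
  from triangular_apply[where F = "Rq n", OF Rq_add Rq_scalar Rq_triangular[OF i] \<nu> this]
  have "triangular id n (stage2 i 0) \<nu> (?A * qK powi (- lookup \<nu> i)) (Rq n (upi (n - i) i (xmono \<nu>)))" .
  from up_triangular[OF i \<nu> this, of "i - 1"] show ?thesis
    using i by (simp add: Yop_def eigval_def stage2_end mult_ac)
qed

lemma Ystar_triangular:
  assumes i: "1 \<le> i" "i \<le> n" and \<nu>: "\<nu> \<in> Zvec n"
  shows "triangular uminus n id \<nu> (eigval n i \<nu>) (Ystar n i (xmono (- \<nu>)))"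
proof -
  let ?B = "\<Prod>k<i - 1. if lookup \<nu> (Suc k) > lookup \<nu> i then tK else 1"
  have "triangular uminus n (stage2 i (i - 1)) \<nu> 1 (xmono (- \<nu>))"
    using triangular_xmono[of uminus] i stage2_end[of i] by (simp only: One_nat_def)
  from down_triangular[OF i \<nu> this]
  have "triangular uminus n (stage2 i 0) \<nu> ?B (down (i - 1) 1 (xmono (- \<nu>)))"
    by simp
  from triangular_apply[where F = "Rqi n" and s = uminus, OF Rqi_add Rqi_scalar Rqi_triangular[OF i] \<nu> this]
  have "triangular uminus n (stage1 i (n - i)) \<nu> (?B * qK powi (- lookup \<nu> i)) (Rqi n (down (i - 1) 1 (xmono (- \<nu>))))" .
  from downi_triangular[OF i \<nu> this] show ?thesis
    using i by (simp add: Ystar_def eigval_def mult_ac)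
qed

section \<open>Joint eigenvectors\<close>

text \<open>The \<open>q\<close>-adic valuation. It does not see \<open>t\<close>, so on an
  eigenvalue it recovers the entry of the exponent up to sign.\<close>

definition qord :: "qtfield \<Rightarrow> int" where
  "qord c = fls_subdegree (to_qseries c)"

lemma qord_mult: "c \<noteq> 0 \<Longrightarrow> d \<noteq> 0 \<Longrightarrow> qord (c * d) = qord c + qord d"
  by (simp add: qord_def to_qseries_mult)

lemma qord_qK_power_int: "qord (qK powi k) = k"
  by (simp add: qord_def to_qseries_power_int to_qseries_qK)

lemma qord_tK: "qord tK = 0"
  by (simp add: qord_def to_qseries_tK)

lemma qord_1 [simp]: "qord 1 = 0"
  by (simp add: qord_def)

lemma qord_tK_power_int: "qord (tK powi k) = 0"
  by (simp add: qord_def to_qseries_power_int to_qseries_tK)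

text \<open>\<open>A\<close> counts the smaller entries to the right, \<open>B\<close> the larger
  and \<open>C\<close> the remaining ones to the left. From
  \<open>vperm n \<nu> i = 1 + card C + card A\<close> and \<open>card B + card C = i - 1\<close>
  the exponent of \<open>t\<close> is \<open>card B - card A\<close>.\<close>

lemma eigval_eq_prod: "i \<ge> 1 \<Longrightarrow> i \<le> n \<Longrightarrow> eigval n i \<nu> = qK powi (- lookup \<nu> i) * tK powi (int i - int (vperm n \<nu> i))"
proof -
  assume i: "1 \<le> i" "i \<le> n"
  define A B where "A = {s \<in> {1..n}. i < s \<and> lookup \<nu> s < lookup \<nu> i}"
    and "B = {s \<in> {1..n}. s < i \<and> lookup \<nu> s > lookup \<nu> i}"
  have "(\<Prod>k<n - i. if lookup \<nu> i > lookup \<nu> (i + Suc k) then inverse tK else 1)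
    = (\<Prod>s\<in>{Suc i..n}. if lookup \<nu> i > lookup \<nu> s then inverse tK else 1)"
    by (rule prod.reindex_bij_witness[where i = "\<lambda>s. s - Suc i" and j = "\<lambda>k. i + Suc k"]) (use i in auto)
  also have "\<dots> = (\<Prod>s\<in>{s \<in> {Suc i..n}. lookup \<nu> i > lookup \<nu> s}. inverse tK)"
    by (rule prod.inter_filter[symmetric]) simp
  also have "{s \<in> {Suc i..n}. lookup \<nu> i > lookup \<nu> s} = A"
    by (auto simp: A_def B_def)
  finally have 1: "(\<Prod>k<n - i. if lookup \<nu> i > lookup \<nu> (i + Suc k) then inverse tK else 1) = tK powi (- int (card A))"
    by (simp add: power_int_minus power_inverse)
  have "(\<Prod>k<i - 1. if lookup \<nu> (Suc k) > lookup \<nu> i then tK else 1)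
    = (\<Prod>s\<in>{1..<i}. if lookup \<nu> s > lookup \<nu> i then tK else 1)"
    by (rule prod.reindex_bij_witness[where i = "\<lambda>s. s - 1" and j = Suc]) (use i in auto)
  also have "\<dots> = (\<Prod>s\<in>{s \<in> {1..<i}. lookup \<nu> s > lookup \<nu> i}. tK)"
    by (rule prod.inter_filter[symmetric]) simp
  also have "{s \<in> {1..<i}. lookup \<nu> s > lookup \<nu> i} = B"
    using i by (auto simp: A_def B_def)
  finally have 2: "(\<Prod>k<i - 1. if lookup \<nu> (Suc k) > lookup \<nu> i then tK else 1) = tK powi int (card B)"
    by simp
  define C where "C = {s \<in> {1..n}. s < i \<and> lookup \<nu> s \<le> lookup \<nu> i}"
  have "B \<union> C = {1..<i}" "B \<inter> C = {}" "finite B" "finite C"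
    using i by (auto simp: A_def B_def C_def)
  then have "card B + card C = i - 1"
    using card_Un_disjoint[of B C] by simp
  moreover have "vperm n \<nu> i = 1 + card C + card A"
    by (simp add: vperm_def A_def B_def C_def)
  ultimately have v: "int i - int (vperm n \<nu> i) = - int (card A) + int (card B)"
    using i by linarith
  have "tK powi (- int (card A) + int (card B)) = tK powi (- int (card A)) * tK powi int (card B)"
    by (rule power_int_add) simp
  then show ?thesis
    unfolding eigval_def 1 2 v by (simp only:)
qed

lemma eigval_nonzero: "1 \<le> i \<Longrightarrow> i \<le> n \<Longrightarrow> eigval n i \<nu> \<noteq> 0"
  by (simp add: eigval_eq_prod)

lemma qord_eigval: "1 \<le> i \<Longrightarrow> i \<le> n \<Longrightarrow> qord (eigval n i \<nu>) = - lookup \<nu> i"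
  by (simp add: eigval_eq_prod qord_mult qord_qK_power_int qord_tK_power_int)

lemma Zvec_eqI: "\<mu> \<in> Zvec n \<Longrightarrow> \<nu> \<in> Zvec n \<Longrightarrow> (\<And>i. i \<in> {1..n} \<Longrightarrow> lookup \<mu> i = lookup \<nu> i) \<Longrightarrow> \<mu> = \<nu>"
  by (rule poly_mapping_eqI) (metis Zvec_iff)

lemma lower_id: "lower id n id \<nu> = {\<kappa>. prec n \<kappa> \<nu>}"
  by (auto simp: lower_def)

lemma Yop_xmono:
  assumes "1 \<le> i" "i \<le> n" "\<kappa> \<in> Zvec n"
  shows "lookup (Yop n i (xmono \<kappa>)) \<kappa> = eigval n i \<kappa>"
    and "\<nu> \<in> keys (Yop n i (xmono \<kappa>)) \<Longrightarrow> \<nu> = \<kappa> \<or> prec n \<nu> \<kappa>"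
proof -
  obtain g where g: "Yop n i (xmono \<kappa>) = scalar (eigval n i \<kappa>) * xmono \<kappa> + g" "keys g \<subseteq> {\<rho>. prec n \<rho> \<kappa>}"
    using Yop_triangular[OF assms] unfolding triangular_def lower_id by auto
  have "\<kappa> \<notin> keys g"
    using g(2) prec_irrefl by auto
  then show "lookup (Yop n i (xmono \<kappa>)) \<kappa> = eigval n i \<kappa>"
    by (simp add: g(1) lookup_add lookup_xmono in_keys_iff)
  show "\<nu> \<in> keys (Yop n i (xmono \<kappa>)) \<Longrightarrow> \<nu> = \<kappa> \<or> prec n \<nu> \<kappa>"
    using g by (auto simp: in_keys_iff lookup_add lookup_xmono split: if_splits)
qed

lemma Yop_expand: "Yop n i f = (\<Sum>\<kappa>\<in>keys f. scalar (lookup f \<kappa>) * Yop n i (xmono \<kappa>))"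
proof -
  have add: "Yop n i (g + h) = Yop n i g + Yop n i h" for g h
    by (rule Yop_add)
  show ?thesis
    by (subst (1) laurent_expand[of f]) (simp add: additive_sum[of "Yop n i", OF add] Yop_scalar)
qed

text \<open>A maximal monomial of a joint eigenvector determines the eigenvalues, whose orders in \<open>q\<close> in
  turn determine the monomial. So there is only one maximal monomial.\<close>

lemma joint_eigenvector:
  assumes f: "f \<in> Laurents n" "f \<noteq> 0" and \<mu>: "\<mu> \<in> Zvec n"
    and eig: "\<And>i. i \<in> {1..n} \<Longrightarrow> Yop n i f = scalar (e i) * f"
    and ord: "\<And>i. i \<in> {1..n} \<Longrightarrow> qord (e i) = - lookup \<mu> i"
  shows "\<kappa> \<in> keys f \<Longrightarrow> \<kappa> = \<mu> \<or> prec n \<kappa> \<mu>" and "\<mu> \<in> keys f"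
    and "i \<in> {1..n} \<Longrightarrow> e i = eigval n i \<mu>"
proof -
  have max: "\<nu> = \<mu> \<and> (\<forall>i\<in>{1..n}. e i = eigval n i \<mu>)" if \<nu>: "\<nu> \<in> keys f" "\<And>\<kappa>. \<kappa> \<in> keys f \<Longrightarrow> \<not> prec n \<nu> \<kappa>" for \<nu>
  proof -
    have \<nu>Z: "\<nu> \<in> Zvec n" and keysZ: "keys f \<subseteq> Zvec n"
      using f(1) \<nu>(1) by (auto simp: Laurents_def)
    have e: "e i = eigval n i \<nu>" if i: "i \<in> {1..n}" for i
    proof -
      \<comment> \<open>Other monomials of \<open>f\<close> could contribute here only from above
        \<nu>, which maximality excludes.\<close>
      have "lookup (Yop n i f) \<nu> = (\<Sum>\<kappa>\<in>keys f. lookup f \<kappa> * lookup (Yop n i (xmono \<kappa>)) \<nu>)"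
        unfolding Yop_expand[of n i f] lookup_sum by simp
      also have "\<dots> = (\<Sum>\<kappa>\<in>{\<nu>}. lookup f \<kappa> * lookup (Yop n i (xmono \<kappa>)) \<nu>)"
      proof (rule sum.mono_neutral_right)
        show "\<forall>\<kappa>\<in>keys f - {\<nu>}. lookup f \<kappa> * lookup (Yop n i (xmono \<kappa>)) \<nu> = 0"
        proof
          fix \<kappa> assume "\<kappa> \<in> keys f - {\<nu>}"
          then have "\<nu> \<notin> keys (Yop n i (xmono \<kappa>))"
            using Yop_xmono(2)[of i n \<kappa> \<nu>] i \<nu>(2)[of \<kappa>] keysZ by auto
          then show "lookup f \<kappa> * lookup (Yop n i (xmono \<kappa>)) \<nu> = 0"
            by (simp add: in_keys_iff)
        qed
      qed (use \<nu> in auto)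
      also have "\<dots> = lookup f \<nu> * eigval n i \<nu>"
        using Yop_xmono(1)[of i n \<nu>] i \<nu>Z by simp
      finally have "e i * lookup f \<nu> = lookup f \<nu> * eigval n i \<nu>"
        using eig[OF i] by simp
      then show ?thesis
        using \<nu>(1) by (simp add: in_keys_iff)
    qed
    have "\<nu> = \<mu>"
      using \<nu>Z \<mu>
    proof (rule Zvec_eqI)
      show "lookup \<nu> i = lookup \<mu> i" if "i \<in> {1..n}" for i
        using e[OF that] ord[OF that] qord_eigval[of i n \<nu>] that by simp
    qed
    with e show ?thesis by blast
  qed
  have fin: "finite (keys f)" by simp
  show "\<kappa> = \<mu> \<or> prec n \<kappa> \<mu>" if "\<kappa> \<in> keys f"
    using finite_prec_maximal[OF fin that, of n] max by metis
  obtain \<kappa> where "\<kappa> \<in> keys f"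
    using f(2) by fastforce
  then obtain \<nu> where "\<nu> \<in> keys f" "\<And>\<kappa>. \<kappa> \<in> keys f \<Longrightarrow> \<not> prec n \<nu> \<kappa>"
    using finite_prec_maximal[OF fin, of \<kappa> n] by metis
  then show "\<mu> \<in> keys f" and "i \<in> {1..n} \<Longrightarrow> e i = eigval n i \<mu>"
    using max by blast+
qed

definition is_E :: "nat \<Rightarrow> expo \<Rightarrow> laurent \<Rightarrow> bool" where
  "is_E n \<mu> f \<longleftrightarrow> f \<in> Laurents n \<and> lookup f \<mu> = 1 \<and>
     (\<forall>i\<in>{1..n}. Yop n i f = scalar (eigval n i \<mu>) * f)"

lemma is_E_nonzero: "is_E n \<mu> f \<Longrightarrow> f \<noteq> 0"
  by (auto simp: is_E_def)

lemma is_E_keys: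
  assumes "is_E n \<mu> f" "\<mu> \<in> Zvec n" "\<kappa> \<in> keys f"
  shows "\<kappa> = \<mu> \<or> prec n \<kappa> \<mu>"
  using joint_eigenvector(1)[of f n \<mu> "\<lambda>i. eigval n i \<mu>" \<kappa>] assms is_E_nonzero[OF assms(1)] qord_eigval
  by (auto simp: is_E_def)

text \<open>A nonzero difference would be a joint eigenvector for the same eigenvalues lacking the
  monomial \<mu>, against \<open>joint_eigenvector\<close>.\<close>

lemma is_E_unique:
  assumes f: "is_E n \<mu> f" and g: "is_E n \<mu> g" and \<mu>: "\<mu> \<in> Zvec n"
  shows "f = g"
proof (rule ccontr)
  assume "f \<noteq> g"
  then have "f - g \<noteq> 0"
    by simp
  moreover have "Yop n i (f - g) = scalar (eigval n i \<mu>) * (f - g)" if "i \<in> {1..n}" for i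
    using f g that additive_minus[of "Yop n i", OF Yop_add] by (simp add: is_E_def right_diff_distrib)
  moreover have "f - g \<in> Laurents n"
    using f g by (auto simp: is_E_def intro: Laurents_minus)
  ultimately have "\<mu> \<in> keys (f - g)"
    using \<mu> qord_eigval by (intro joint_eigenvector(2)[where e = "\<lambda>i. eigval n i \<mu>"]) auto
  then show False
    using f g by (simp add: in_keys_iff lookup_minus is_E_def)
qed

text \<open>It suffices that the eigenvalues have the right orders in \<open>q\<close>; their exact
  values follow from the leading monomial.\<close>

lemma is_E_intro:
  assumes "f \<in> Laurents n" "\<mu> \<in> Zvec n" "lookup f \<mu> = 1"
    "\<And>i. i \<in> {1..n} \<Longrightarrow> Yop n i f = scalar (e i) * f" "\<And>i. i \<in> {1..n} \<Longrightarrow> qord (e i) = - lookup \<mu> i"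
  shows "is_E n \<mu> f"
proof -
  have "f \<noteq> 0"
    using assms(3) by auto
  then show ?thesis
    using joint_eigenvector(3)[of f n \<mu> e] assms by (auto simp: is_E_def)
qed

section \<open>The recursion\<close>

lemma DL_one [simp]: "DL i 1 = 1"
  by (rule DL_unique) (simp add: scalar_minus algebra_simps)

lemma DLi_one [simp]: "DLi i 1 = 1"
  using DLi_DL[of i 1] by simp

lemma up_one: "up m i 1 = 1" and upi_one: "upi m i 1 = 1"
  by (induction m) simp_all

lemma is_E_zero: "is_E n 0 1"
proof (rule is_E_intro[where e = "\<lambda>_. 1"])
  show "1 \<in> Laurents n"
    using Laurents_xmono[of 0 n] by simp
qed (simp_all add: Yop_def up_one upi_one Rq_def)

lemma lookup_vec: "lookup (vec n f) j = (if j \<in> {1..n} then f j else 0)"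
  by (simp add: vec_def lookup_sum lookup_single when_def)

lemma vec_Zvec: "vec n f \<in> Zvec n"
  by (simp add: Zvec_iff lookup_vec)

lemma lookup_msubst:
  assumes "inj w"
  shows "lookup (msubst c w f) (act w \<nu>) = lookup f \<nu> * chi c \<nu>"
proof -
  have "act w \<mu> = act w \<nu> \<longleftrightarrow> \<mu> = \<nu>" for \<mu>
    using lookup_act_eq[OF assms] by (metis poly_mapping_eqI)
  then show ?thesis
    by (induction f rule: poly_mapping_linear_induct)
      (auto simp: msubst_add msubst_single lookup_add lookup_single when_def algebra_simps)
qed

definition shift_expo :: "nat \<Rightarrow> expo \<Rightarrow> expo" where
  "shift_expo n \<mu> = vec n (\<lambda>i. if i = 1 then lookup \<mu> n + 1 else lookup \<mu> (i - 1))"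

lemma shift_expo_eq: "n \<ge> 1 \<Longrightarrow> \<mu> \<in> Zvec n \<Longrightarrow> shift_expo n \<mu> = act (rot n) \<mu> + single 1 1"
  by (rule poly_mapping_eqI)
    (auto simp: shift_expo_def lookup_vec lookup_add lookup_act_rot lookup_single when_def irot_def Zvec_iff)

text \<open>The intertwining relations shift the eigenvalues cyclically. The factor
  \<open>q^{-\<mu>_n}\<close> that the rotation puts on the leading monomial is cancelled by the
  scalar of (E1).\<close>

lemma is_E_Phi:
  assumes n: "n \<ge> 1" and \<mu>: "\<mu> \<in> Zvec n" and f: "is_E n \<mu> f"
  shows "is_E n (shift_expo n \<mu>) (scalar (qK powi lookup \<mu> n) * Phi n f)"
proof (rule is_E_intro[where e = "\<lambda>i. if i = 1 then inverse qK * inverse tK ^ (n - 1) * eigval n n \<mu> else tK * eigval n (i - 1) \<mu>"])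
  have fL: "f \<in> Laurents n" and eig: "\<And>i. i \<in> {1..n} \<Longrightarrow> Yop n i f = scalar (eigval n i \<mu>) * f" and f1: "lookup f \<mu> = 1"
    using f by (auto simp: is_E_def)
  have Phi_scalar: "Phi n (scalar a * g) = scalar a * Phi n g" for a g
    by (simp add: Phi_def Rq_scalar mult.left_commute)
  show "scalar (qK powi lookup \<mu> n) * Phi n f \<in> Laurents n"
    unfolding Phi_def using n fL by (intro Laurents_scalar Laurents_mult[of "xvar 1"] Laurents_xvar Laurents_Rq) auto
  show "shift_expo n \<mu> \<in> Zvec n"
    by (simp add: shift_expo_def vec_Zvec)
  have "lookup (Phi n f) (shift_expo n \<mu>) = lookup (Rq n f) (act (rot n) \<mu>)"
    unfolding Phi_def xvar_def lookup_xmono_mult shift_expo_eq[OF n \<mu>] by simp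
  also have "\<dots> = qK powi (- lookup \<mu> n)"
    unfolding Rq_def using n \<mu> f1 by (simp add: lookup_msubst inj_rot chi_point[of n n] power_int_minus power_int_inverse)
  finally show "lookup (scalar (qK powi lookup \<mu> n) * Phi n f) (shift_expo n \<mu>) = 1"
    by (simp add: power_int_minus)
  fix i assume i: "i \<in> {1..n}"
  let ?e = "\<lambda>i. if i = 1 then inverse qK * inverse tK ^ (n - 1) * eigval n n \<mu> else tK * eigval n (i - 1) \<mu>"
  have "Yop n i (Phi n f) = scalar (?e i) * Phi n f"
  proof (cases "i = 1")
    case True
    then show ?thesis
      using Yop_1_Phi[OF n, of f] eig[of n] n by (simp add: Phi_scalar scalar_mult mult.assoc)
  next
    case False
    then obtain k where k: "i = Suc k" "1 \<le> k" "k < n"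
      using i by (cases i) auto
    then show ?thesis
      using Yop_Suc_Phi[of k n f] eig[of k] by (simp add: Phi_scalar scalar_mult mult.assoc)
  qed
  then show "Yop n i (scalar (qK powi lookup \<mu> n) * Phi n f) = scalar (?e i) * (scalar (qK powi lookup \<mu> n) * Phi n f)"
    by (simp only: Yop_scalar mult.left_commute)
  have q1: "qord (inverse qK) = - 1"
    using qord_qK_power_int[of "-1"] by (simp add: power_int_minus)
  have t1: "qord (inverse tK ^ (n - 1)) = 0"
    using qord_tK_power_int[of "- int (n - 1)"] by (simp add: power_int_minus power_inverse)
  show "qord (?e i) = - lookup (shift_expo n \<mu>) i"
    using i n by (auto simp: shift_expo_def lookup_vec qord_mult eigval_nonzero qord_eigval q1 t1 t1[unfolded One_nat_def] qord_tK)
qed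

lemma DL_xmono_keys:
  assumes i: "1 \<le> i" "i < n" and \<kappa>: "\<kappa> \<in> Zvec n"
  shows "keys (DL i (xmono \<kappa>)) \<subseteq> insert (act (sw i) \<kappa>) (insert \<kappa> {\<nu>. prec n \<nu> \<kappa>})"
proof (cases "lookup \<kappa> (Suc i) \<le> lookup \<kappa> i")
  case True
  define N where "N = nat (lookup \<kappa> i - lookup \<kappa> (Suc i))"
  have N: "lookup \<kappa> i - lookup \<kappa> (Suc i) = int N"
    using True by (simp add: N_def)
  have inner: "\<kappa> - zmul (int k) (aroot i) \<in> insert \<kappa> {\<nu>. prec n \<nu> \<kappa>}" if "k < N" for k
  proof (cases "k = 0")
    case True
    then show ?thesis
      by (simp add: zmul_simps)
  next
    case False
    have "prec n (\<kappa> - zmul (int k) (aroot i)) \<kappa>"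
      using i \<kappa> False that N by (intro prec_interior[of "Suc i" n i]) (auto simp: lookup_minus lookup_aroot)
    then show ?thesis
      by simp
  qed
  show ?thesis
    unfolding DL_xmono_ge[OF N] using inner
    by (intro keys_add_subset keys_scalar_subset keys_sum_subset) auto
next
  case False
  define N where "N = nat (lookup \<kappa> (Suc i) - lookup \<kappa> i - 1)"
  have N: "lookup \<kappa> (Suc i) - lookup \<kappa> i = int (Suc N)"
    using False by (simp add: N_def)
  have inner: "prec n (\<kappa> + zmul (int (Suc k)) (aroot i)) \<kappa>" if "k < N" for k
    using i \<kappa> that N by (intro prec_interior[of i n "Suc i"]) (auto simp: lookup_add lookup_aroot)
  show ?thesis
    unfolding DL_xmono_less[OF N] diff_conv_add_uminus scalar_uminus[symmetric] mult_minus_left[symmetric] using inner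
    by (intro keys_add_subset keys_scalar_subset keys_sum_subset) auto
qed

lemma eigval_ratio:
  assumes "1 \<le> i" "i < n"
  shows "qK powi (lookup \<mu> i - lookup \<mu> (i + 1)) * tK powi (int (vperm n \<mu> i) - int (vperm n \<mu> (i + 1)))
    = eigval n (Suc i) \<mu> / (tK * eigval n i \<mu>)"
  using assms by (simp add: eigval_eq_prod power_int_diff power_int_minus power_int_add field_simps)

text \<open>\<mu> lies below its reflection. Hence \<open>f\<close> does not contain the reflected
  monomial, and among the monomials of \<open>f\<close> only \<mu> itself produces it under
  \<open>T_i\<close>.\<close>

lemma lookup_DL_swap:
  assumes i: "1 \<le> i" "i < n" and \<mu>: "\<mu> \<in> Zvec n" "lookup \<mu> i > lookup \<mu> (Suc i)" and f: "is_E n \<mu> f"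
  shows "lookup f (act (sw i) \<mu>) = 0" and "lookup (DL i f) (act (sw i) \<mu>) = 1"
proof -
  let ?\<nu> = "act (sw i) \<mu>"
  have "prec n (act (sw i) ?\<nu>) ?\<nu>"
    using i \<mu> by (intro prec_swap Zvec_act_sw) (auto simp: lookup_act_transpose)
  then have up: "prec n \<mu> ?\<nu>"
    by simp
  have not: "\<not> prec n ?\<nu> \<mu>"
    using prec_trans[OF up] prec_irrefl by blast
  moreover have neq: "?\<nu> \<noteq> \<mu>"
    using up prec_irrefl[of n \<mu>] by metis
  ultimately show "lookup f ?\<nu> = 0"
    using is_E_keys[OF f \<mu>(1), of ?\<nu>] by (auto simp: in_keys_iff)
  have other: "lookup (DL i (xmono \<kappa>)) ?\<nu> = 0" if "\<kappa> \<in> keys f" "\<kappa> \<noteq> \<mu>" for \<kappa>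
  proof -
    have \<kappa>: "prec n \<kappa> \<mu>" "\<kappa> \<in> Zvec n"
      using that is_E_keys[OF f \<mu>(1)] by (auto simp: prec_def)
    have "?\<nu> \<noteq> act (sw i) \<kappa>"
      using that(2) by (metis act_transpose_transpose)
    moreover have "?\<nu> \<noteq> \<kappa>" "\<not> prec n ?\<nu> \<kappa>"
      using \<kappa> not prec_trans by blast+
    ultimately have "?\<nu> \<notin> keys (DL i (xmono \<kappa>))"
      using DL_xmono_keys[OF i \<kappa>(2)] by blast
    then show ?thesis
      by (simp add: in_keys_iff)
  qed
  have self: "lookup (DL i (xmono \<mu>)) ?\<nu> = 1"
  proof -
    define N where "N = nat (lookup \<mu> i - lookup \<mu> (Suc i))"
    have N: "lookup \<mu> i - lookup \<mu> (Suc i) = int N"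
      using \<mu> by (simp add: N_def)
    have "?\<nu> \<noteq> \<mu> - zmul (int k) (aroot i)" if "k < N" for k
    proof
      assume "?\<nu> = \<mu> - zmul (int k) (aroot i)"
      then have "lookup ?\<nu> i = lookup (\<mu> - zmul (int k) (aroot i)) i"
        by simp
      then show False
        using N that by (simp add: lookup_act_transpose lookup_minus lookup_aroot)
    qed
    then have "lookup (\<Sum>k<N. xmono (\<mu> - zmul (int k) (aroot i))) ?\<nu> = 0"
      by (simp add: lookup_sum lookup_xmono)
    then show ?thesis
      unfolding DL_xmono_ge[OF N] by (simp add: lookup_add lookup_xmono)
  qed
  have "DL i f = (\<Sum>\<kappa>\<in>keys f. scalar (lookup f \<kappa>) * DL i (xmono \<kappa>))"
    by (subst (1) laurent_expand[of f]) (simp add: DL_sum DL_scalar)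
  then have "lookup (DL i f) ?\<nu> = (\<Sum>\<kappa>\<in>keys f. lookup f \<kappa> * lookup (DL i (xmono \<kappa>)) ?\<nu>)"
    by (simp add: lookup_sum)
  also have "\<dots> = (\<Sum>\<kappa>\<in>{\<mu>}. lookup f \<kappa> * lookup (DL i (xmono \<kappa>)) ?\<nu>)"
    using f other by (intro sum.mono_neutral_right) (auto simp: is_E_def in_keys_iff)
  also have "\<dots> = 1"
    using f self by (simp add: is_E_def)
  finally show "lookup (DL i f) ?\<nu> = 1" .
qed

text \<open>The span of \<open>f\<close> and \<open>T_i f\<close> is stable under \<open>Y_i\<close>
  and \<open>Y_{i+1}\<close>, and \<open>c (1 - a) = (1 - t) a\<close> is the condition for
  \<open>T_i f + c f\<close> to be an eigenvector of both. If \<open>A\<close>, \<open>B\<close> are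
  the eigenvalues for \<open>f\<close>, the new ones are \<open>a A = B / t\<close> and
  \<open>t A\<close>; the other \<open>Y_j\<close> commute with \<open>T_i\<close>.\<close>

lemma is_E_swap:
  assumes i: "1 \<le> i" "i < n" and \<mu>: "\<mu> \<in> Zvec n" "lookup \<mu> i > lookup \<mu> (i + 1)" and f: "is_E n \<mu> f"
    and a: "a = qK powi (lookup \<mu> i - lookup \<mu> (i + 1)) * tK powi (int (vperm n \<mu> i) - int (vperm n \<mu> (i + 1)))"
  shows "is_E n (act (sw i) \<mu>) (DL i f + scalar ((1 - tK) * a / (1 - a)) * f)"
proof -
  define A B c where "A = eigval n i \<mu>" "B = eigval n (Suc i) \<mu>" "c = (1 - tK) * a / (1 - a)"
  have fL: "f \<in> Laurents n" and eig: "\<And>j. j \<in> {1..n} \<Longrightarrow> Yop n j f = scalar (eigval n j \<mu>) * f"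
    using f by (auto simp: is_E_def)
  have nz: "A \<noteq> 0" "B \<noteq> 0"
    using i by (simp_all add: A_B_c_def eigval_nonzero)
  have aB: "B = a * (tK * A)"
    using eigval_ratio[OF i, of \<mu>] nz unfolding a A_B_c_def by (simp add: field_simps)
  have "qord a = lookup \<mu> i - lookup \<mu> (i + 1)"
    by (simp add: a qord_mult qord_qK_power_int qord_tK_power_int)
  then have "a \<noteq> 1"
    using \<mu>(2) by auto
  then have ca: "c * (1 - a) = (1 - tK) * a"
    by (simp add: A_B_c_def)
  define T where "T = DL i f"
  have TT: "DL i T = scalar (1 - tK) * T + scalar tK * f"
    by (simp add: T_def DL_quadratic)
  have Tinv: "DLi i f = scalar (inverse tK) * (T + scalar (tK - 1) * f)"
    by (simp add: T_def DLi_def)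
  have Yf: "Yop n i f = scalar A * f" "Yop n (Suc i) f = scalar B * f"
    using eig i by (auto simp: A_B_c_def)
  have "DL i (Yop n i T) = scalar B * f"
    using Yop_Suc[OF i, of f] Yf by (simp add: T_def)
  then have "Yop n i T = DLi i (scalar B * f)"
    by (metis DLi_DL)
  then have YT: "Yop n i T = scalar (a * A) * (T + scalar (tK - 1) * f)"
  proof -
    have "B * inverse tK = a * A"
      unfolding aB by (simp add: field_simps)
    then have "scalar B * (scalar (inverse tK) * h) = scalar (a * A) * h" for h
      by (simp add: mult.assoc[symmetric] scalar_mult[symmetric])
    then show ?thesis
      using \<open>Yop n i T = DLi i (scalar B * f)\<close> by (simp only: DLi_scalar Tinv)
  qed
  let ?g = "T + scalar c * f"
  have e1: "Yop n i ?g = scalar (a * A) * ?g"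
  proof -
    have "Yop n i ?g = scalar (a * A) * T + scalar (a * A * (tK - 1) + c * A) * f"
      by (simp add: Yop_add Yop_scalar YT Yf scalar_mult scalar_add distrib_left distrib_right mult.assoc)
    also have "a * A * (tK - 1) + c * A = a * A * c"
    proof -
      have "a * A * (tK - 1) + c * A - a * A * c = A * (c * (1 - a) - (1 - tK) * a)"
        by (simp add: algebra_simps)
      then show ?thesis
        by (simp add: ca)
    qed
    finally show ?thesis
      by (simp add: scalar_mult distrib_left mult.assoc)
  qed
  have e2: "Yop n (Suc i) ?g = scalar (tK * A) * ?g"
  proof -
    have Tg: "DL i ?g = scalar (1 - tK + c) * T + scalar tK * f"
      by (simp add: DL_add DL_scalar TT scalar_add distrib_right) (simp add: T_def)
    have TTf: "DL i (T + scalar (tK - 1) * f) = scalar tK * f"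
    proof -
      have "DL i (T + scalar (tK - 1) * f) = DL i T + scalar (tK - 1) * T"
        unfolding DL_add DL_scalar by (simp add: T_def)
      then show ?thesis
        by (simp add: TT scalar_minus algebra_simps)
    qed
    have "Yop n (Suc i) ?g = DL i (Yop n i (DL i ?g))"
      by (simp add: Yop_Suc[OF i])
    also have "\<dots> = scalar ((1 - tK + c) * (a * A)) * DL i (T + scalar (tK - 1) * f) + scalar (tK * A) * DL i f"
      unfolding Tg Yop_add Yop_scalar YT Yf DL_add[of i "scalar _ * _" "scalar _ * _"] DL_scalar
      by (simp add: scalar_mult mult.assoc)
    also have "\<dots> = scalar (tK * A) * T + scalar ((1 - tK + c) * (a * A) * tK) * f"
      unfolding TTf by (simp add: T_def scalar_mult mult.assoc)
    also have "(1 - tK + c) * (a * A) * tK = tK * A * c"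
    proof -
      have "(1 - tK + c) * (a * A) * tK - tK * A * c = tK * A * ((1 - tK) * a - c * (1 - a))"
        by (simp add: algebra_simps)
      then show ?thesis
        by (simp add: ca)
    qed
    finally show ?thesis
      by (simp add: scalar_mult distrib_left mult.assoc)
  qed
  define e where "e j = (if j = i then a * A else if j = Suc i then tK * A else eigval n j \<mu>)" for j
  have "is_E n (act (sw i) \<mu>) ?g"
  proof (rule is_E_intro[where e = e])
    show "?g \<in> Laurents n"
      unfolding T_def using fL i by (intro Laurents_add Laurents_scalar Laurents_DL)
    show "act (sw i) \<mu> \<in> Zvec n"
      using i \<mu> by (intro Zvec_act_sw)
    show "lookup ?g (act (sw i) \<mu>) = 1"
      using lookup_DL_swap[OF i \<mu>(1) _ f] \<mu>(2) by (simp add: lookup_add T_def)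
    fix j assume j: "j \<in> {1..n}"
    show "Yop n j ?g = scalar (e j) * ?g"
    proof (cases "j = i \<or> j = Suc i")
      case True
      then show ?thesis
        using e1 e2 by (auto simp: e_def)
    next
      case False
      then have "DL i (Yop n j f) = Yop n j T"
        unfolding T_def using i j by (intro DL_Yop) auto
      then have "Yop n j T = scalar (eigval n j \<mu>) * T"
        using eig[OF j] by (simp add: DL_scalar T_def)
      then show ?thesis
        using False eig[OF j] by (simp add: Yop_add Yop_scalar e_def distrib_left mult.left_commute)
    qed
    have "a \<noteq> 0"
      using aB nz by auto
    have "qord A = - lookup \<mu> i"
      using i by (simp add: A_B_c_def qord_eigval)
    then show "qord (e j) = - lookup (act (sw i) \<mu>) j"
      using j i nz \<open>a \<noteq> 0\<close> \<open>qord a = _\<close>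
      by (auto simp: e_def lookup_act_transpose transpose_def qord_mult qord_tK qord_eigval)
  qed
  then show ?thesis
    by (simp add: T_def A_B_c_def)
qed

lemma up_symmetric: "(\<And>j. i \<le> j \<Longrightarrow> j < i + m \<Longrightarrow> sv j p = p) \<Longrightarrow> up m i (p * f) = p * up m i f"
  and upi_symmetric: "(\<And>j. i \<le> j \<Longrightarrow> j < i + m \<Longrightarrow> sv j p = p) \<Longrightarrow> upi m i (p * f) = p * upi m i f"
  by (induction m) (simp_all add: DL_mult_symmetric DLi_mult_symmetric)

text \<open>The factor is invariant under all \<open>s_j\<close>, so it passes through every
  \<open>T_j\<close>, and the rotation multiplies it by \<open>q\<close>. All eigenvalues thus gain
  a factor \<open>q\<close>.\<close>

lemma is_E_translate:
  assumes n: "n \<ge> 1" and \<mu>: "\<mu> \<in> Zvec n" and f: "is_E n \<mu> f"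
  shows "is_E n (\<mu> - vec n (\<lambda>_. 1)) (xmono (- vec n (\<lambda>_. 1)) * f)"
proof -
  define \<delta> p where "\<delta> = - vec n (\<lambda>_. 1)" and "p = xmono (- vec n (\<lambda>_. 1))"
  have \<delta>: "lookup \<delta> j = (if j \<in> {1..n} then - 1 else 0)" "\<delta> \<in> Zvec n" for j
    by (simp_all add: \<delta>_def p_def lookup_vec Zvec_uminus vec_Zvec)
  have fL: "f \<in> Laurents n" and eig: "\<And>j. j \<in> {1..n} \<Longrightarrow> Yop n j f = scalar (eigval n j \<mu>) * f"
    using f by (auto simp: is_E_def)
  have "act (sw j) \<delta> = \<delta>" if "1 \<le> j" "j < n" for j
    by (rule poly_mapping_eqI) (use that in \<open>auto simp: lookup_act_transpose \<delta> transpose_def\<close>)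
  then have sp: "sv j p = p" if "1 \<le> j" "j < n" for j
    using that by (simp add: \<delta>_def p_def msubst_xmono)
  have "act (rot n) \<delta> = \<delta>"
    by (rule poly_mapping_eqI) (use n in \<open>auto simp: lookup_act_rot \<delta> irot_def\<close>)
  moreover have "chi (\<lambda>i. if i = n then inverse qK else 1) \<delta> = qK"
    using n \<delta> by (simp add: chi_point[of n n] power_int_minus)
  ultimately have Rp: "Rq n p = scalar qK * p"
    by (simp add: \<delta>_def p_def Rq_def msubst_xmono)
  have Y: "Yop n j (p * f) = scalar (qK * eigval n j \<mu>) * (p * f)" if j: "j \<in> {1..n}" for j
  proof -
    have "upi (n - j) j (p * f) = p * upi (n - j) j f"
      using j by (intro upi_symmetric sp) auto
    then have "Yop n j (p * f) = up (j - 1) 1 (scalar qK * (p * Rq n (upi (n - j) j f)))"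
      by (simp add: Yop_def Rq_mult Rp mult.assoc)
    also have "\<dots> = scalar qK * up (j - 1) 1 (p * Rq n (upi (n - j) j f))"
      by (rule up_scalar)
    also have "up (j - 1) 1 (p * Rq n (upi (n - j) j f)) = p * Yop n j f"
      unfolding Yop_def using j by (intro up_symmetric sp) auto
    finally show ?thesis
      using eig[OF j] by (simp add: scalar_mult mult_ac)
  qed
  have "is_E n (\<mu> + \<delta>) (p * f)"
  proof (rule is_E_intro[where e = "\<lambda>j. qK * eigval n j \<mu>"])
    show "p * f \<in> Laurents n"
      using fL \<delta> by (auto simp: \<delta>_def p_def intro!: Laurents_mult Laurents_xmono)
    show "\<mu> + \<delta> \<in> Zvec n"
      using \<mu> \<delta> by (auto intro: Zvec_add)
    show "lookup (p * f) (\<mu> + \<delta>) = 1"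
      using f by (simp add: \<delta>_def p_def is_E_def)
    fix j assume j: "j \<in> {1..n}"
    show "Yop n j (p * f) = scalar (qK * eigval n j \<mu>) * (p * f)"
      by (rule Y[OF j])
    show "qord (qK * eigval n j \<mu>) = - lookup (\<mu> + \<delta>) j"
      using j qord_qK_power_int[of 1] by (simp add: qord_mult eigval_nonzero qord_eigval lookup_add \<delta>)
  qed
  then show ?thesis
    by (simp add: \<delta>_def p_def)
qed

text \<open>A nonzero exponent without negative entries is a shift of one of smaller degree if its
  first entry is nonzero; otherwise a swap brings the first nonzero entry one place forward. Hence
  the lexicographic measure by degree and position of that entry.\<close>

lemma Zvec_induct [consumes 2, case_names zero shift swap translate]:
  assumes n: "n \<ge> 1" and \<mu>: "\<mu> \<in> Zvec n" and zero: "P 0"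
    and shift: "\<And>\<mu>. \<mu> \<in> Zvec n \<Longrightarrow> P \<mu> \<Longrightarrow> P (shift_expo n \<mu>)"
    and swap: "\<And>\<mu> i. \<mu> \<in> Zvec n \<Longrightarrow> \<forall>j\<in>{1..n}. 0 \<le> lookup \<mu> j \<Longrightarrow> 1 \<le> i \<Longrightarrow> i < n \<Longrightarrow>
      lookup \<mu> i > lookup \<mu> (i + 1) \<Longrightarrow> P \<mu> \<Longrightarrow> P (act (sw i) \<mu>)"
    and translate: "\<And>\<mu>. \<mu> \<in> Zvec n \<Longrightarrow> P \<mu> \<Longrightarrow> P (\<mu> - vec n (\<lambda>_. 1))"
  shows "P \<mu>"
proof -
  have nonneg: "P \<mu>" if "\<mu> \<in> Zvec n" "\<forall>j\<in>{1..n}. 0 \<le> lookup \<mu> j" for \<mu>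
    using that
  proof (induction \<mu> rule: wf_induct_rule[OF wf_measures[of "[\<lambda>\<mu>. nat (psum n \<mu>), \<lambda>\<mu>. LEAST p. lookup \<mu> p \<noteq> 0]"]])
    case (1 \<mu>)
    note less = 1
    show ?case
    proof (cases "\<mu> = 0")
      case False
      then obtain p0 where "lookup \<mu> p0 \<noteq> 0"
        by (metis lookup_zero poly_mapping_eqI)
      define p where "p = (LEAST p. lookup \<mu> p \<noteq> 0)"
      have p: "lookup \<mu> p \<noteq> 0" and below: "\<And>k. k < p \<Longrightarrow> lookup \<mu> k = 0"
        unfolding p_def using \<open>lookup \<mu> p0 \<noteq> 0\<close> by (rule LeastI) (blast dest: not_less_Least)
      have pn: "p \<in> {1..n}" "lookup \<mu> p > 0"
        using less(2,3) p unfolding Zvec_iff by (metis, metis order_le_less)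
      show ?thesis
      proof (cases "p = 1")
        case True
        define \<kappa> where "\<kappa> = vec n (\<lambda>i. if i = n then lookup \<mu> 1 - 1 else lookup \<mu> (i + 1))"
        have \<kappa>: "\<kappa> \<in> Zvec n" "\<forall>j\<in>{1..n}. 0 \<le> lookup \<kappa> j"
          using less(2,3) pn True n by (auto simp: \<kappa>_def vec_Zvec lookup_vec)
        have eq: "shift_expo n \<kappa> = \<mu>"
          by (rule poly_mapping_eqI)
            (use less(2,3) n in \<open>auto simp: shift_expo_def \<kappa>_def lookup_vec Zvec_iff\<close>)
        obtain m where m: "n = Suc m"
          using n by (cases n) auto
        have "psum n \<kappa> = (\<Sum>j=1..m. lookup \<mu> (Suc j)) + (lookup \<mu> 1 - 1)"
          by (simp add: psum_def m) (simp add: \<kappa>_def lookup_vec m)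
        moreover have "psum n \<mu> = lookup \<mu> 1 + (\<Sum>j=1..m. lookup \<mu> (Suc j))"
        proof -
          have "psum n \<mu> = lookup \<mu> 1 + (\<Sum>j=Suc 1..Suc m. lookup \<mu> j)"
            unfolding psum_def m by (rule sum.atLeast_Suc_atMost) simp
          then show ?thesis
            unfolding sum.shift_bounds_cl_Suc_ivl .
        qed
        moreover have "psum n \<kappa> \<ge> 0"
          unfolding psum_def using \<kappa> by (intro sum_nonneg) auto
        ultimately have "nat (psum n \<kappa>) < nat (psum n \<mu>)"
          by simp
        then have "P \<kappa>"
          using \<kappa> by (intro less(1)) auto
        then show ?thesis
          using shift[OF \<kappa>(1)] eq by simp
      next
        case False
        define i where "i = p - 1"
        have i: "p = Suc i" "1 \<le> i" "i < n"
          using pn False by (auto simp: i_def)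
        define \<kappa> where "\<kappa> = act (sw i) \<mu>"
        have \<kappa>: "\<kappa> \<in> Zvec n" "\<forall>j\<in>{1..n}. 0 \<le> lookup \<kappa> j"
          using less(2,3) i Zvec_act_sw by (auto simp: \<kappa>_def lookup_act_transpose transpose_def)
        have "psum n \<kappa> = psum n \<mu>"
          unfolding psum_def \<kappa>_def using sum_act_permutes_all[OF sw_permutes[OF i(2,3)], of "\<lambda>x. x"] by simp
        moreover have "(LEAST p. lookup \<kappa> p \<noteq> 0) < p"
        proof -
          have "lookup \<kappa> i \<noteq> 0"
            using p i by (simp add: \<kappa>_def lookup_act_transpose)
          then show ?thesis
            using Least_le[of "\<lambda>p. lookup \<kappa> p \<noteq> 0" i] i by simp
        qed
        ultimately have "P \<kappa>"
          using \<kappa> by (intro less(1)) (auto simp: p_def)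
        moreover have "lookup \<kappa> i > lookup \<kappa> (i + 1)"
          using pn below[of i] i by (simp add: \<kappa>_def lookup_act_transpose)
        ultimately have "P (act (sw i) \<kappa>)"
          using swap \<kappa> i by blast
        then show ?thesis
          by (simp add: \<kappa>_def)
      qed
    qed (use zero in simp)
  qed
  \<comment> \<open>Adding \<open>c\<close> to all entries makes them nonnegative; \<open>c\<close>
    translations then lead back to \<mu>.\<close>
  define c where "c = (\<Sum>j\<in>{1..n}. \<bar>lookup \<mu> j\<bar>)"
  have c: "0 \<le> lookup \<mu> j + c" if "j \<in> {1..n}" for j
  proof -
    have "\<bar>lookup \<mu> j\<bar> \<le> c"
      unfolding c_def using that by (intro member_le_sum) auto
    then show ?thesis by linarith
  qed
  have lowered: "P (vec n (\<lambda>j. lookup \<mu> j + c - int k))" for k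
  proof (induction k)
    case 0
    show ?case
      using c by (intro nonneg vec_Zvec) (auto simp: lookup_vec)
  next
    case (Suc k)
    have "vec n (\<lambda>j. lookup \<mu> j + c - int (Suc k)) = vec n (\<lambda>j. lookup \<mu> j + c - int k) - vec n (\<lambda>_. 1)"
      by (rule poly_mapping_eqI) (simp add: lookup_vec lookup_minus)
    then show ?case
      using translate[OF vec_Zvec Suc.IH] by simp
  qed
  have "c \<ge> 0"
    unfolding c_def by (rule sum_nonneg) simp
  then have "vec n (\<lambda>j. lookup \<mu> j + c - int (nat c)) = \<mu>"
    using \<mu> by (intro poly_mapping_eqI) (auto simp: lookup_vec Zvec_iff)
  with lowered[of "nat c"] show ?thesis
    by simp
qed

section \<open>The polynomials \<open>E\<close>\<close>

lemma msubst_Rq: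
  assumes n: "n \<ge> 1" and f: "f \<in> Laurents n"
  shows "msubst (\<lambda>i. if i = n then inverse qK else 1) (\<lambda>i. if i = n then 1 else i + 1) f = Rq n f"
proof -
  have "act (\<lambda>i. if i = n then 1 else i + 1) \<nu> = act (rot n) \<nu>" if "\<nu> \<in> keys f" for \<nu>
  proof (rule act_cong)
    fix i assume "i \<in> keys \<nu>"
    moreover have "keys \<nu> \<subseteq> {1..n}"
      using that f by (auto simp: Laurents_def Zvec_def)
    ultimately have "1 \<le> i" "i \<le> n"
      by auto
    then show "(if i = n then 1 else i + 1) = rot n i"
      by (simp add: rot_def)
  qed
  then show ?thesis
    unfolding Rq_def msubst_def by (intro sum.cong) simp_all
qed

lemma Macdonald_family_is_E:
  assumes n: "n \<ge> 1" and E: "Macdonald_family n E" and L: "\<And>\<mu>. \<mu> \<in> Zvec n \<Longrightarrow> E \<mu> \<in> Laurents n" and \<mu>: "\<mu> \<in> Zvec n"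
  shows "is_E n \<mu> (E \<mu>)"
  using n \<mu>
proof (induction \<mu> rule: Zvec_induct)
  case zero
  then show ?case
    using E is_E_zero by (simp add: Macdonald_family_def)
next
  case (shift \<mu>)
  have "E (shift_expo n \<mu>) = scalar (qK powi lookup \<mu> n) * Phi n (E \<mu>)"
    using E shift.hyps L[OF shift.hyps] n unfolding Macdonald_family_def shift_expo_def Phi_def
    by (simp add: msubst_Rq mult.assoc del: One_nat_def)
  then show ?case
    using is_E_Phi[OF n shift.hyps shift.IH] by simp
next
  case (swap \<mu> i)
  define a where "a = qK powi (lookup \<mu> i - lookup \<mu> (i + 1)) * tK powi (int (vperm n \<mu> i) - int (vperm n \<mu> (i + 1)))"
  have "E (act (adj i) \<mu>) = divided_diff i (xvar i * E \<mu>) - scalar tK * xvar i * divided_diff i (E \<mu>)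
      + scalar ((1 - tK) * a / (1 - a)) * E \<mu>"
    using E swap.hyps unfolding Macdonald_family_def Let_def a_def by blast
  then have "E (act (sw i) \<mu>) = DL i (E \<mu>) + scalar ((1 - tK) * a / (1 - a)) * E \<mu>"
    by (simp add: DL_def)
  then show ?case
    using is_E_swap[OF swap.hyps(3,4,1,5) swap.IH a_def] by simp
next
  case (translate \<mu>)
  have "E (\<mu> - vec n (\<lambda>_. 1)) = xmono (- vec n (\<lambda>_. 1)) * E \<mu>"
    using E translate.hyps unfolding Macdonald_family_def by blast
  then show ?case
    using is_E_translate[OF n translate.hyps translate.IH] by simp
qed

lemma is_E_exists:
  assumes n: "n \<ge> 1" and \<mu>: "\<mu> \<in> Zvec n"
  shows "\<exists>f. is_E n \<mu> f"
  using n \<mu>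
proof (induction \<mu> rule: Zvec_induct)
  case zero
  show ?case
    using is_E_zero by blast
next
  case (shift \<mu>)
  then show ?case
    using is_E_Phi[OF n] by blast
next
  case (swap \<mu> i)
  then show ?case
    using is_E_swap by blast
next
  case (translate \<mu>)
  then show ?case
    using is_E_translate[OF n] by blast
qed

text \<open>The normalised joint eigenvectors, restricted to \<open>Zvec n\<close>, satisfy
  (E0)--(E3), and every solution consists of them; so they are what \<open>THE\<close>
  selects.\<close>

lemma Macdonald_E_is_E:
  assumes n: "n \<ge> 1" and \<mu>: "\<mu> \<in> Zvec n"
  shows "is_E n \<mu> (Macdonald_E n \<mu>)"
proof -
  define E where "E = restrict (\<lambda>\<mu>. THE f. is_E n \<mu> f) (Zvec n)"
  have is_E: "is_E n \<mu> (E \<mu>)" if "\<mu> \<in> Zvec n" for \<mu>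
  proof -
    have "\<exists>!f. is_E n \<mu> f"
      using is_E_exists[OF n that] is_E_unique[OF _ _ that] by blast
    then show ?thesis
      using theI'[of "is_E n \<mu>"] that by (simp add: E_def)
  qed
  have EI: "E \<mu> = f" if "is_E n \<mu> f" "\<mu> \<in> Zvec n" for \<mu> f
    using is_E_unique[OF is_E that(1)] that by blast
  have L: "E \<mu> \<in> Laurents n" if "\<mu> \<in> Zvec n" for \<mu>
    using is_E[OF that] by (simp add: is_E_def)
  have ext: "E \<in> Zvec n \<rightarrow>\<^sub>E Laurents n"
    using L by (auto simp: E_def)
  have family: "Macdonald_family n E"
    unfolding Macdonald_family_def
  proof (intro conjI ballI allI impI)
    show "E 0 = 1"
      using is_E_zero by (rule EI) simp
  next
    fix \<mu> assume \<mu>: "\<mu> \<in> Zvec n"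
    show "E (vec n (\<lambda>i. if i = 1 then lookup \<mu> n + 1 else lookup \<mu> (i - 1))) =
      scalar (qK powi lookup \<mu> n) * xvar 1 *
      msubst (\<lambda>i. if i = n then inverse qK else 1) (\<lambda>i. if i = n then 1 else i + 1) (E \<mu>)"
      unfolding msubst_Rq[OF n L[OF \<mu>]] mult.assoc Phi_def[symmetric] shift_expo_def[symmetric]
      by (rule EI[OF is_E_Phi[OF n \<mu> is_E[OF \<mu>]]]) (simp add: shift_expo_def vec_Zvec)
    show "E (\<mu> - vec n (\<lambda>_. 1)) = xmono (- vec n (\<lambda>_. 1)) * E \<mu>"
      by (rule EI[OF is_E_translate[OF n \<mu> is_E[OF \<mu>]]]) (intro Zvec_minus \<mu> vec_Zvec)
    fix i assume i: "1 \<le> i \<and> i < n \<and> (\<forall>j\<in>{1..n}. 0 \<le> lookup \<mu> j) \<and> lookup \<mu> (i + 1) < lookup \<mu> i"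
    define a where "a = qK powi (lookup \<mu> i - lookup \<mu> (i + 1)) * tK powi (int (vperm n \<mu> i) - int (vperm n \<mu> (i + 1)))"
    have "E (act (sw i) \<mu>) = DL i (E \<mu>) + scalar ((1 - tK) * a / (1 - a)) * E \<mu>"
      using i by (intro EI[OF is_E_swap[OF _ _ \<mu> _ is_E[OF \<mu>] a_def]] Zvec_act_sw \<mu>) auto
    then show "let a = qK powi (lookup \<mu> i - lookup \<mu> (i + 1)) * tK powi (int (vperm n \<mu> i) - int (vperm n \<mu> (i + 1)))
      in E (act (adj i) \<mu>) = divided_diff i (xvar i * E \<mu>) - scalar tK * xvar i * divided_diff i (E \<mu>)
        + scalar ((1 - tK) * a / (1 - a)) * E \<mu>"
      unfolding Let_def a_def[symmetric] by (simp add: DL_def)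
  qed
  have "Macdonald_E n = E"
    unfolding Macdonald_E_def
  proof (rule the_equality)
    fix F assume F: "F \<in> Zvec n \<rightarrow>\<^sub>E Laurents n \<and> Macdonald_family n F"
    show "F = E"
    proof (rule PiE_ext)
      show "F \<in> Zvec n \<rightarrow>\<^sub>E Laurents n" "E \<in> Zvec n \<rightarrow>\<^sub>E Laurents n"
        using F ext by auto
      show "F \<mu> = E \<mu>" if "\<mu> \<in> Zvec n" for \<mu>
        using Macdonald_family_is_E[OF n, of F \<mu>] F that EI by (metis PiE_mem)
    qed
  qed (use ext family in blast)
  then show ?thesis
    using is_E[OF \<mu>] by simp
qed

section \<open>Orthogonality and nondegeneracy\<close>

text \<open>Passing \<open>Y_i\<close> to its adjoint multiplies the pairing once by the eigenvalue
  at \<mu> and once by that at \<nu>, since the lower terms vanish by induction. For some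
  \<open>i\<close> the two differ. The induction stays in the degree of \<nu>, which may differ from
  that of \<mu>.\<close>

lemma ct_kernel_orthogonal:
  assumes n: "n \<ge> 1" and \<mu>: "\<mu> \<in> Zvec n" and f: "is_E n \<mu> f" and \<nu>: "\<nu> \<in> Zvec n" "DBlex_less n \<nu> \<mu>"
  shows "ct_kernel n (f * xmono (- \<nu>)) = 0"
  using wf_prec[of n] \<nu>
proof (induction \<nu> rule: wf_induct_rule)
  case (less \<nu>)
  have fL: "f \<in> Laurents n" and eig: "\<And>j. j \<in> {1..n} \<Longrightarrow> Yop n j f = scalar (eigval n j \<mu>) * f"
    using f by (auto simp: is_E_def)
  have "\<nu> \<noteq> \<mu>"
    using less.prems DBlex_less_irrefl by blast
  then obtain i where i: "i \<in> {1..n}" "lookup \<nu> i \<noteq> lookup \<mu> i"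
    using Zvec_eqI less.prems \<mu> by metis
  then have i': "1 \<le> i" "i \<le> n"
    by auto
  obtain g where g: "Ystar n i (xmono (- \<nu>)) = scalar (eigval n i \<nu>) * xmono (- \<nu>) + g"
    "keys g \<subseteq> lower uminus n id \<nu>"
    using Ystar_triangular[OF i' less.prems(1)] unfolding triangular_def by auto
  have zero: "ct_kernel n (f * xmono \<rho>) = 0" if "\<rho> \<in> keys g" for \<rho>
  proof -
    obtain \<kappa> where \<kappa>: "\<rho> = - \<kappa>" "prec n \<kappa> \<nu>"
      using \<open>\<rho> \<in> keys g\<close> g(2) by (auto simp: lower_def)
    then have "DBlex_less n \<kappa> \<mu>" "\<kappa> \<in> Zvec n"
      using DBlex_less_trans less.prems \<mu> unfolding prec_def by metis+
    then show ?thesis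
      using less.IH \<kappa> by simp
  qed
  have "f * g = (\<Sum>\<rho>\<in>keys g. scalar (lookup g \<rho>) * (f * xmono \<rho>))"
    by (subst (1) laurent_expand[of g]) (simp add: sum_distrib_left mult.left_commute)
  then have "ct_kernel n (f * g) = 0"
    using zero by (simp add: ct_kernel_sum ct_kernel_scalar)
  then have "ct_kernel n (f * Ystar n i (xmono (- \<nu>))) = to_qseries (eigval n i \<nu>) * ct_kernel n (f * xmono (- \<nu>))"
    unfolding g(1) distrib_left ct_kernel_add mult.left_commute[of f "scalar _"] ct_kernel_scalar by simp
  moreover have "ct_kernel n (f * Ystar n i (xmono (- \<nu>))) = ct_kernel n (Yop n i f * xmono (- \<nu>))"
    using less.prems(1) by (intro ct_kernel_Yop[OF i' fL, symmetric] Laurents_xmono Zvec_uminus)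
  moreover have "\<dots> = to_qseries (eigval n i \<mu>) * ct_kernel n (f * xmono (- \<nu>))"
    unfolding eig[OF i(1)] mult.assoc by (rule ct_kernel_scalar)
  ultimately have eq: "to_qseries (eigval n i \<nu>) * ct_kernel n (f * xmono (- \<nu>)) =
      to_qseries (eigval n i \<mu>) * ct_kernel n (f * xmono (- \<nu>))"
    by (simp only:)
  have "to_qseries (eigval n i \<nu> - eigval n i \<mu>) * ct_kernel n (f * xmono (- \<nu>)) = 0"
    unfolding to_qseries_minus left_diff_distrib eq by (rule diff_self)
  moreover have "eigval n i \<nu> \<noteq> eigval n i \<mu>"
    using qord_eigval[OF i', of \<nu>] qord_eigval[OF i', of \<mu>] i(2) by auto
  ultimately show ?case
    by simp
qed

lemma fls_nth_mult_fps:
  fixes a :: "'a::comm_ring_1 fls"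
  assumes "\<And>k. k < m \<Longrightarrow> fls_nth a k = 0"
  shows "fls_nth (a * fps_to_fls b) m = fls_nth a m * fps_nth b 0"
proof -
  define c where "c = Abs_fps (\<lambda>k. fls_nth a (m + int k))"
  have a: "a = fls_shift (- m) (fps_to_fls c)"
    by (rule fls_eqI) (use assms in \<open>auto simp: c_def\<close>)
  have "a * fps_to_fls b = fls_shift (- m) (fps_to_fls (c * b))"
    unfolding a by (simp add: fls_times_fps_to_fls fls_shifted_times_simps)
  then show ?thesis
    by (simp add: c_def)
qed

text \<open>The cone is pointed: nonnegative exponents of the \<open>y_l\<close> with sum zero all
  vanish, and together with total degree zero they determine the exponent.\<close>

lemma cone_hdeg_zero:
  assumes "\<delta> \<in> cone n" "hdeg n \<delta> = 0" "n \<ge> 1"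
  shows "\<delta> = 0"
proof (rule poly_mapping_eqI)
  have msum: "msum l \<delta> = 0" if "l < n" for l
    using assms(1,2) that sum_nonneg_eq_0_iff[of "{..<n}" "\<lambda>l. msum l \<delta>"] by (auto simp: cone_def hdeg_def)
  have lt: "lookup \<delta> k = 0" if "k < n" for k
  proof (cases k)
    case 0
    then show ?thesis
      using msum[of 0] that by (simp add: msum_def)
  next
    case (Suc l)
    then show ?thesis
      using msum[of k] msum[of l] that by (simp add: msum_def)
  qed
  have "(\<Sum>i=1..n. lookup \<delta> i) = (\<Sum>i\<in>{n}. lookup \<delta> i)"
    using lt assms(3) by (intro sum.mono_neutral_right) auto
  then have "lookup \<delta> n = 0"
    using assms(1) by (simp add: cone_def lat_def)
  moreover have "lookup \<delta> k = 0" if "k > n" for k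
    using assms(1) that by (simp add: cone_def lat_def)
  ultimately show "lookup \<delta> k = lookup 0 k" for k
    using lt by (cases k n rule: linorder_cases) simp_all
qed

text \<open>At \<open>q = 0\<close> the Gram matrix of the monomials is unitriangular with respect to the positive
  root cone.\<close>

lemma ct_kernel_nondegenerate:
  assumes n: "n \<ge> 1" and g: "g \<in> Laurents n" and orth: "\<And>\<nu>. \<nu> \<in> keys g \<Longrightarrow> ct_kernel n (g * xmono (- \<nu>)) = 0"
  shows "g = 0"
proof (rule ccontr)
  assume "g \<noteq> 0"
  define c where "c \<nu> = to_qseries (lookup g \<nu>)" for \<nu>
  define m where "m = Min ((\<lambda>\<nu>. fls_subdegree (c \<nu>)) ` keys g)"
  define A where "A = {\<nu> \<in> keys g. fls_subdegree (c \<nu>) = m}"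
  have "keys g \<noteq> {}"
    using \<open>g \<noteq> 0\<close> by simp
  then have "m \<in> (\<lambda>\<nu>. fls_subdegree (c \<nu>)) ` keys g"
    unfolding m_def by (intro Min_in) auto
  then have "A \<noteq> {}" "finite A"
    by (auto simp: A_def)
  \<comment> \<open>\<kappa> has least \<open>hdeg\<close> among the coefficients of lowest order
    \<open>m\<close> in \<open>q\<close>. In the pairing with the inverse monomial, the coefficient
    of \<open>q^m\<close> sees only \<nu> in \<open>A\<close> with \<open>\<kappa> - \<nu>\<close>
    in the cone, which leaves \<open>\<nu> = \<kappa>\<close>.\<close>
  then obtain \<kappa> where \<kappa>: "\<kappa> \<in> A" and min: "\<And>\<nu>. \<nu> \<in> A \<Longrightarrow> hdeg n \<kappa> \<le> hdeg n \<nu>"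
    using ex_is_arg_min_if_finite[of A "hdeg n"] by (auto simp: is_arg_min_linorder)
  have Z: "keys g \<subseteq> Zvec n"
    using g by (simp add: Laurents_def)
  have \<kappa>Z: "\<kappa> \<in> keys g" "\<kappa> \<in> Zvec n"
    using \<kappa> Z by (auto simp: A_def)
  have low: "fls_nth (c \<nu>) k = 0" if "\<nu> \<in> keys g" "k < m" for \<nu> k
  proof (rule fls_eq0_below_subdegree)
    have "m \<le> fls_subdegree (c \<nu>)"
      unfolding m_def using that by (intro Min_le) auto
    then show "k < fls_subdegree (c \<nu>)"
      using that by simp
  qed
  have "g * xmono (- \<kappa>) = (\<Sum>\<nu>\<in>keys g. scalar (lookup g \<nu>) * xmono (\<nu> - \<kappa>))"
  proof -
    have "xmono \<nu> * xmono (- \<kappa>) = xmono (\<nu> - \<kappa>)" for \<nu>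
      by (simp add: xmono_add[symmetric])
    then show ?thesis
      by (subst (1) laurent_expand[of g]) (simp add: sum_distrib_right mult.assoc)
  qed
  then have "ct_kernel n (g * xmono (- \<kappa>)) = (\<Sum>\<nu>\<in>keys g. c \<nu> * fps_to_fls (kernel_coeff n (\<kappa> - \<nu>)))"
    by (simp add: ct_kernel_sum ct_kernel_scalar ct_kernel_xmono c_def)
  then have "0 = fls_nth (\<Sum>\<nu>\<in>keys g. c \<nu> * fps_to_fls (kernel_coeff n (\<kappa> - \<nu>))) m"
    using orth[OF \<kappa>Z(1)] by simp
  also have "\<dots> = (\<Sum>\<nu>\<in>keys g. fls_nth (c \<nu>) m * jc n (\<kappa> - \<nu>))"
    unfolding fls_nth_sum
  proof (rule sum.cong[OF refl])
    fix \<nu> assume \<nu>: "\<nu> \<in> keys g"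
    then have "lookup (\<kappa> - \<nu>) 0 = 0"
      using \<kappa>Z Z by (intro Zvec_lookup_0[of _ n] Zvec_minus) auto
    then have "fps_nth (kernel_coeff n (\<kappa> - \<nu>)) 0 = jc n (\<kappa> - \<nu>)"
      using kernel_coeff_nth[OF n, of "\<kappa> - \<nu>" 0] by simp
    then show "fls_nth (c \<nu> * fps_to_fls (kernel_coeff n (\<kappa> - \<nu>))) m = fls_nth (c \<nu>) m * jc n (\<kappa> - \<nu>)"
      using fls_nth_mult_fps[of m "c \<nu>"] low[OF \<nu>] by simp
  qed
  also have "\<dots> = (\<Sum>\<nu>\<in>{\<kappa>}. fls_nth (c \<nu>) m * jc n (\<kappa> - \<nu>))"
  proof (rule sum.mono_neutral_right)
    show "\<forall>\<nu>\<in>keys g - {\<kappa>}. fls_nth (c \<nu>) m * jc n (\<kappa> - \<nu>) = 0"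
    proof (rule ballI, rule ccontr)
      fix \<nu> assume \<nu>: "\<nu> \<in> keys g - {\<kappa>}" and nz: "fls_nth (c \<nu>) m * jc n (\<kappa> - \<nu>) \<noteq> 0"
      then have "fls_subdegree (c \<nu>) \<le> m"
        by (metis fls_subdegree_leI mult_zero_left)
      moreover have "m \<le> fls_subdegree (c \<nu>)"
        unfolding m_def using \<nu> by (intro Min_le) auto
      ultimately have "\<nu> \<in> A"
        using \<nu> by (simp add: A_def)
      have cone: "\<kappa> - \<nu> \<in> cone n"
        using nz jc_not_cone[OF n, of "\<kappa> - \<nu>"] by auto
      then have "0 \<le> hdeg n (\<kappa> - \<nu>)"
        unfolding hdeg_def cone_def by (intro sum_nonneg) auto
      with min[OF \<open>\<nu> \<in> A\<close>] have "hdeg n (\<kappa> - \<nu>) = 0"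
        by (simp add: hdeg_minus)
      from cone_hdeg_zero[OF cone this n] show False
        using \<nu> by simp
    qed
  qed (use \<kappa>Z in auto)
  also have "\<dots> = fls_nth (c \<kappa>) (fls_subdegree (c \<kappa>))"
    using \<kappa> by (simp add: jc_zero[OF n] A_def)
  also have "\<dots> \<noteq> 0"
    using \<kappa>Z(1) by (simp add: c_def in_keys_iff)
  finally show False
    by simp
qed

theorem proposition6p2:
  fixes n :: nat and \<mu> :: expo
  assumes "n \<ge> 1" and "\<mu> \<in> Zvec n"
  shows "Macdonald_E n \<mu> \<in> Laurents n \<and>
    (\<forall>f\<in>Laurents n.
       (keys (f - xmono \<mu>) \<subseteq> {\<nu> \<in> Zvec n. DBlex_less n \<nu> \<mu>} \<and>
        (\<forall>\<nu>\<in>Zvec n. DBlex_less n \<nu> \<mu> \<longrightarrow> inner_qt n f (xmono \<nu>) = 0))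
       \<longleftrightarrow> f = Macdonald_E n \<mu>)"
proof -
  define E where "E = Macdonald_E n \<mu>"
  have E: "is_E n \<mu> E"
    unfolding E_def using assms by (rule Macdonald_E_is_E)
  then have EL: "E \<in> Laurents n"
    by (simp add: is_E_def)
  have Ekeys: "keys (E - xmono \<mu>) \<subseteq> {\<nu> \<in> Zvec n. DBlex_less n \<nu> \<mu>}"
  proof
    fix \<nu> assume "\<nu> \<in> keys (E - xmono \<mu>)"
    then have "lookup E \<nu> \<noteq> (if \<nu> = \<mu> then 1 else 0)"
      by (simp add: in_keys_iff lookup_minus lookup_xmono)
    then have "\<nu> \<noteq> \<mu>" "\<nu> \<in> keys E"
      using E by (auto simp: is_E_def in_keys_iff split: if_splits)
    then show "\<nu> \<in> {\<nu> \<in> Zvec n. DBlex_less n \<nu> \<mu>}"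
      using is_E_keys[OF E assms(2)] by (auto simp: prec_def)
  qed
  have Eorth: "inner_qt n E (xmono \<nu>) = 0" if "\<nu> \<in> Zvec n" "DBlex_less n \<nu> \<mu>" for \<nu>
    unfolding inner_qt_xmono using ct_kernel_orthogonal[OF assms E that] .
  have "f = E" if f: "f \<in> Laurents n" and keys: "keys (f - xmono \<mu>) \<subseteq> {\<nu> \<in> Zvec n. DBlex_less n \<nu> \<mu>}"
    and orth: "\<forall>\<nu>\<in>Zvec n. DBlex_less n \<nu> \<mu> \<longrightarrow> inner_qt n f (xmono \<nu>) = 0" for f
  proof -
    have "f - E = (f - xmono \<mu>) - (E - xmono \<mu>)"
      by simp
    then have sub: "keys (f - E) \<subseteq> {\<nu> \<in> Zvec n. DBlex_less n \<nu> \<mu>}"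
      using keys_minus_subset[of "f - xmono \<mu>" "E - xmono \<mu>"] keys Ekeys by auto
    \<comment> \<open>The difference is supported below \<mu> and orthogonal to all monomials there,
      hence to those of its own support.\<close>
    have "f - E = 0"
      using assms(1) Laurents_minus[OF f EL]
    proof (rule ct_kernel_nondegenerate)
      fix \<nu> assume "\<nu> \<in> keys (f - E)"
      then have "\<nu> \<in> Zvec n" "DBlex_less n \<nu> \<mu>"
        using sub by auto
      then show "ct_kernel n ((f - E) * xmono (- \<nu>)) = 0"
        using orth Eorth by (simp add: inner_qt_xmono left_diff_distrib ct_kernel_minus)
    qed
    then show ?thesis
      by simp
  qed
  then show ?thesis
    unfolding E_def[symmetric] using EL Ekeys Eorth by blast
qed

end
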